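(* Let $\mathsf{M}$ be a two-sided ideal of a perfect algebra with bracket (AWB) $\mathsf{A}$. Then there is an exact sequence of vector spaces $$\mathrm{Ker}\big(\mathsf{M}\boxtimes\mathsf{A}\xrightarrow{\psi_{\mathsf{M}}}\mathsf{M}\big)\to\mathsf{H}_1^{AWB}(\mathsf{A})\to\mathsf{H}_1^{AWB}(\mathsf{A}/\mathsf{M})\to\frac{\mathsf{M}}{[[\mathsf{A},\mathsf{M}]]}\to0,$$ where $\mathsf{M}\boxtimes\mathsf{A}$ is the non-abelian tensor product with respect to the mutual actions given by the operations of $\mathsf{A}$.
   Context: All vector spaces, algebras and tensor products $\otimes$ are over a fixed field $\mathbb{K}$. An algebra with bracket (AWB) is an associative, not necessarily commutative (and not necessarily unital) algebra $\mathsf{A}$ with a bilinear map $[-,-]:\mathsf{A}\times\mathsf{A}\to\mathsf{A}$ such that $[ab,c]=[a,c]b+a[b,c]$ for all $a,b,c$. Homomorphisms preserve product and bracket. A two-sided ideal is a subspace $\mathsf{B}$ with $\mathsf{A}\mathsf{B},\mathsf{B}\mathsf{A},[\mathsf{A},\mathsf{B}],[\mathsf{B},\mathsf{A}]\subseteq\mathsf{B}$. For two-sided ideals $\mathsf{B},\mathsf{C}$ of $\mathsf{A}$, $[[\mathsf{B},\mathsf{C}]]$ is the two-sided ideal of $\mathsf{A}$ generated by all $bc,cb,[b,c],[c,b]$ with $b\in\mathsf{B}$, $c\in\mathsf{C}$. $\mathsf{A}$ is perfect if $\mathsf{A}=[[\mathsf{A},\mathsf{A}]]$. Homology with trivial coefficients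 $\mathsf{H}^{AWB}_*(\mathsf{A})$: the homology of the complex with $C_0(\mathsf{A})=\mathsf{A}$ and $C_n(\mathsf{A})=\mathsf{A}^{\otimes(n+1)}\oplus\mathsf{A}^{\otimes(n+1)}$ for $n\ge1$, where elements of the first summand are written $a_1\otimes\cdots\otimes a_{n+1}$ and of the second $a_1\circ\cdots\circ a_{n+1}$, with boundary $d_n:C_n\to C_{n-1}$ ($n\geq1$) $$d_n(a_1\otimes\cdots\otimes a_{n+1})=\sum_{i=1}^{n}(-1)^{i+1}a_1\otimes\cdots\otimes a_ia_{i+1}\otimes\cdots\otimes a_{n+1},$$ $$d_n(a_1\circ\cdots\circ a_{n+1})=\sum_{i=1}^{n}a_1\otimes\cdots\otimes[a_i,a_{n+1}]\otimes\cdots\otimes a_n+\sum_{i=1}^{n-1}(-1)^i a_1\circ\cdots\circ a_ia_{i+1}\circ\cdots\circ a_{n+1}.$$ Non-abelian tensor product. In general it is defined for AWBs $\mathsf{M},\mathsf{N}$ with compatible mutual actions ${}^{m\cdot}n$, $n^{\cdot m}$, ${}^{m\ast}n$, $n^{\ast m}\in\mathsf{N}$ and ${}^{n\cdot}m$, $m^{\cdot n}$, ${}^{n\ast}m$, $m^{\ast n}\in\mathsf{M}$; here $\mathsf{N}=\mathsf{A}$, $\mathsf{M}$ is a two-sided ideal of $\mathsf{A}$, and the actions are ${}^{x\cdot}y=xy$, $y^{\cdot x}=yx$, ${}^{x\ast}y=[x,y]$, $y^{\ast x}=[y,x]$ computed in $\mathsf{A}$, which are compatible. Call a pair $(u_{\mathsf{M}},u_{\mathsf{N}})\in\mathsf{M}\times\mathsf{N}$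 basic if it is one of $(m^{\cdot n},{}^{m\cdot}n)$, $({}^{n\cdot}m,n^{\cdot m})$, $(m^{\ast n},{}^{m\ast}n)$, $({}^{n\ast}m,n^{\ast m})$ for some $m\in\mathsf{M}$, $n\in\mathsf{N}$. Then $\mathsf{M}\boxtimes\mathsf{N}$ is the vector space spanned by formal symbols $m\odot n$, $n\odot m$, $m\circledast n$, $n\circledast m$ for $m\in\mathsf{M}$, $n\in\mathsf{N}$ (four formally distinct families, also when $\mathsf{M}$ and $\mathsf{N}$ have elements in common), modulo the following relations, for all $\lambda\in\mathbb{K}$ and all elements, where $\star$ stands for either of $\odot$, $\circledast$: (1) $\lambda(m\star n)=(\lambda m)\star n=m\star(\lambda n)$, $(m+m')\star n=m\star n+m'\star n$, $m\star(n+n')=m\star n+m\star n'$; (2) $u_{\mathsf{M}}\star v_{\mathsf{N}}=u_{\mathsf{N}}\star v_{\mathsf{M}}$ for all basic pairs $(u_{\mathsf{M}},u_{\mathsf{N}})$, $(v_{\mathsf{M}},v_{\mathsf{N}})$; (3) $(m_1m_2)\odot n=m_1\odot({}^{m_2\cdot}n)$; $\ n\odot(m_1m_2)=(n^{\cdot m_1})\odot m_2$; $\ (m_1m_2)\circledast n=m_1\odot({}^{m_2\ast}n)+({}^{m_1\ast}n)\odot m_2$; $\ ({}^{m_1\cdot}n)\circledast m_2=m_1\odot(n^{\ast m_2})+[m_1,m_2]\odot n$; $\ (n^{\cdot m_1})\circledast m_2=(n^{\ast m_2})\odot m_1+n\odot[m_1,m_2]$; $\ ({}^{m_1\cdot}n)\odot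 m_2=m_1\odot(n^{\cdot m_2})$; (4) all relations obtained from (1) and (3) by exchanging the roles of elements of $\mathsf{M}$ and $\mathsf{N}$. To each generator $g$ associate a basic pair $(g_{\mathsf{M}},g_{\mathsf{N}})$: $m\odot n\mapsto(m^{\cdot n},{}^{m\cdot}n)$, $n\odot m\mapsto({}^{n\cdot}m,n^{\cdot m})$, $m\circledast n\mapsto(m^{\ast n},{}^{m\ast}n)$, $n\circledast m\mapsto({}^{n\ast}m,n^{\ast m})$. The AWB structure on $\mathsf{M}\boxtimes\mathsf{N}$ is given on generators by $g\,h=g_{\mathsf{M}}\odot h_{\mathsf{N}}$ and $[g,h]=g_{\mathsf{M}}\circledast h_{\mathsf{N}}$. The map $\psi_{\mathsf{M}}:\mathsf{M}\boxtimes\mathsf{N}\to\mathsf{M}$, $g\mapsto g_{\mathsf{M}}$, is a well-defined AWB homomorphism; here it sends $m\odot a\mapsto ma$, $a\odot m\mapsto am$, $m\circledast a\mapsto[m,a]$, $a\circledast m\mapsto[a,m]$. *)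

theory Defs
  imports "HOL.Hull" "HOL-Algebra.Module" "HOL-Algebra.QuotRing"
begin

section \<open>Vector spaces\<close>

text \<open>
  A vector space over \<open>K\<close> is a \<^locale>\<open>module\<close> over a \<^locale>\<open>field\<close>. The record
  \<^typ>\<open>('k, 'a) module\<close> extends \<^typ>\<open>'a ring\<close>; for objects that are only vector spaces
  its fields \<open>mult\<close> and \<open>one\<close> are irrelevant.
\<close>

locale linear_map = V?: module K V + W?: module K W
  for K and V and W +
  fixes f
  assumes map_closed: "x \<in> carrier V \<Longrightarrow> f x \<in> carrier W"
    and map_add: "\<lbrakk>x \<in> carrier V; y \<in> carrier V\<rbrakk> \<Longrightarrow> f (x \<oplus>\<^bsub>V\<^esub> y) = f x \<oplus>\<^bsub>W\<^esub> f y"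
    and map_smult: "\<lbrakk>k \<in> carrier K; x \<in> carrier V\<rbrakk> \<Longrightarrow> f (k \<odot>\<^bsub>V\<^esub> x) = k \<odot>\<^bsub>W\<^esub> f x"

definition quot_smult :: "('k, 'a, 'r) module_scheme \<Rightarrow> 'a set \<Rightarrow> 'k \<Rightarrow> 'a set \<Rightarrow> 'a set"
  where "quot_smult V U k X = (\<Union>x\<in>X. U +>\<^bsub>V\<^esub> (k \<odot>\<^bsub>V\<^esub> x))"

definition quot_mod :: "('k, 'a, 'r) module_scheme \<Rightarrow> 'a set \<Rightarrow> ('k, 'a set) module"
  where "quot_mod V U =
    \<lparr>carrier = a_rcosets\<^bsub>V\<^esub> U, mult = rcoset_mult V U, one = U +>\<^bsub>V\<^esub> \<one>\<^bsub>V\<^esub>,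
     zero = U, add = set_add V, smult = quot_smult V U\<rparr>"

subsection \<open>Vector spaces given by generators and relations\<close>

definition free_vs :: "('k, 'z) ring_scheme \<Rightarrow> 'x set \<Rightarrow> ('k, 'x \<Rightarrow> 'k) module"
  where "free_vs K X =
    \<lparr>carrier = {f. range f \<subseteq> carrier K \<and> finite {x. f x \<noteq> \<zero>\<^bsub>K\<^esub>} \<and> {x. f x \<noteq> \<zero>\<^bsub>K\<^esub>} \<subseteq> X},
     mult = (\<lambda>f g x. f x \<otimes>\<^bsub>K\<^esub> g x), one = (\<lambda>x. \<one>\<^bsub>K\<^esub>),
     zero = (\<lambda>x. \<zero>\<^bsub>K\<^esub>), add = (\<lambda>f g x. f x \<oplus>\<^bsub>K\<^esub> g x),
     smult = (\<lambda>k f x. k \<otimes>\<^bsub>K\<^esub> f x)\<rparr>"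

definition free_gen :: "('k, 'z) ring_scheme \<Rightarrow> 'x \<Rightarrow> 'x \<Rightarrow> 'k"
  where "free_gen K x = (\<lambda>y. if y = x then \<one>\<^bsub>K\<^esub> else \<zero>\<^bsub>K\<^esub>)"

text \<open>A pair \<open>(l, r)\<close> in \<open>R\<close> stands for the relation \<open>l = r\<close> imposed on the free space on \<open>X\<close>.\<close>

definition rel_space ::
    "('k, 'z) ring_scheme \<Rightarrow> 'x set \<Rightarrow> (('x \<Rightarrow> 'k) \<times> ('x \<Rightarrow> 'k)) set \<Rightarrow> ('x \<Rightarrow> 'k) set"
  where "rel_space K X R =
    (\<lambda>H. submodule H K (free_vs K X)) hull {l \<ominus>\<^bsub>free_vs K X\<^esub> r | l r. (l, r) \<in> R}"

definition pres_vs ::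
    "('k, 'z) ring_scheme \<Rightarrow> 'x set \<Rightarrow> (('x \<Rightarrow> 'k) \<times> ('x \<Rightarrow> 'k)) set \<Rightarrow> ('k, ('x \<Rightarrow> 'k) set) module"
  where "pres_vs K X R = quot_mod (free_vs K X) (rel_space K X R)"

definition pres_gen ::
    "('k, 'z) ring_scheme \<Rightarrow> 'x set \<Rightarrow> (('x \<Rightarrow> 'k) \<times> ('x \<Rightarrow> 'k)) set \<Rightarrow> 'x \<Rightarrow> ('x \<Rightarrow> 'k) set"
  where "pres_gen K X R x = rel_space K X R +>\<^bsub>free_vs K X\<^esub> free_gen K x"

text \<open>
  The linear map from a presented space to \<open>W\<close> with prescribed values \<open>\<phi>\<close> on the generators.
  An element \<open>C\<close> of the presented space is a coset; if \<open>\<phi>\<close> respects the relations, the linear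
  extension of \<open>\<phi>\<close> is constant on \<open>C\<close>.
\<close>

definition lin_ext :: "('k, 'z) ring_scheme \<Rightarrow> ('k, 'w, 'r) module_scheme \<Rightarrow> ('x \<Rightarrow> 'w) \<Rightarrow> ('x \<Rightarrow> 'k) \<Rightarrow> 'w"
  where "lin_ext K W \<phi> f = (\<Oplus>\<^bsub>W\<^esub>x\<in>{x. f x \<noteq> \<zero>\<^bsub>K\<^esub>}. f x \<odot>\<^bsub>W\<^esub> \<phi> x)"

definition pres_map ::
    "('k, 'z) ring_scheme \<Rightarrow> ('k, 'w, 'r) module_scheme \<Rightarrow> ('x \<Rightarrow> 'w) \<Rightarrow> ('x \<Rightarrow> 'k) set \<Rightarrow> 'w"
  where "pres_map K W \<phi> C = the_elem (lin_ext K W \<phi> ` C)"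


section \<open>Algebras with bracket\<close>

text \<open>The field \<open>one\<close> inherited from \<^typ>\<open>'a ring\<close> is unconstrained: algebras need not be unital.\<close>

record ('k, 'a) awb = "('k, 'a) module" +
  bracket :: "'a \<Rightarrow> 'a \<Rightarrow> 'a"

locale awb = K?: field K + A?: module K A
  for K and A (structure) +
  assumes mult_closed: "\<lbrakk>a \<in> carrier A; b \<in> carrier A\<rbrakk> \<Longrightarrow> a \<otimes> b \<in> carrier A"
    and mult_assoc: "\<lbrakk>a \<in> carrier A; b \<in> carrier A; c \<in> carrier A\<rbrakk> \<Longrightarrow>
      (a \<otimes> b) \<otimes> c = a \<otimes> (b \<otimes> c)"
    and mult_add_left: "\<lbrakk>a \<in> carrier A; b \<in> carrier A; c \<in> carrier A\<rbrakk> \<Longrightarrow>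
      (a \<oplus> b) \<otimes> c = a \<otimes> c \<oplus> b \<otimes> c"
    and mult_add_right: "\<lbrakk>a \<in> carrier A; b \<in> carrier A; c \<in> carrier A\<rbrakk> \<Longrightarrow>
      a \<otimes> (b \<oplus> c) = a \<otimes> b \<oplus> a \<otimes> c"
    and mult_smult_left: "\<lbrakk>k \<in> carrier K; a \<in> carrier A; b \<in> carrier A\<rbrakk> \<Longrightarrow>
      (k \<odot> a) \<otimes> b = k \<odot> (a \<otimes> b)"
    and mult_smult_right: "\<lbrakk>k \<in> carrier K; a \<in> carrier A; b \<in> carrier A\<rbrakk> \<Longrightarrow>
      a \<otimes> (k \<odot> b) = k \<odot> (a \<otimes> b)"
    and bracket_closed: "\<lbrakk>a \<in> carrier A; b \<in> carrier A\<rbrakk> \<Longrightarrow> bracket A a b \<in> carrier A"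
    and bracket_add_left: "\<lbrakk>a \<in> carrier A; b \<in> carrier A; c \<in> carrier A\<rbrakk> \<Longrightarrow>
      bracket A (a \<oplus> b) c = bracket A a c \<oplus> bracket A b c"
    and bracket_add_right: "\<lbrakk>a \<in> carrier A; b \<in> carrier A; c \<in> carrier A\<rbrakk> \<Longrightarrow>
      bracket A a (b \<oplus> c) = bracket A a b \<oplus> bracket A a c"
    and bracket_smult_left: "\<lbrakk>k \<in> carrier K; a \<in> carrier A; b \<in> carrier A\<rbrakk> \<Longrightarrow>
      bracket A (k \<odot> a) b = k \<odot> bracket A a b"
    and bracket_smult_right: "\<lbrakk>k \<in> carrier K; a \<in> carrier A; b \<in> carrier A\<rbrakk> \<Longrightarrow>
      bracket A a (k \<odot> b) = k \<odot> bracket A a b"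
    and bracket_mult: "\<lbrakk>a \<in> carrier A; b \<in> carrier A; c \<in> carrier A\<rbrakk> \<Longrightarrow>
      bracket A (a \<otimes> b) c = bracket A a c \<otimes> b \<oplus> a \<otimes> bracket A b c"

locale awb_ideal = submodule I K A for K and A (structure) and I +
  assumes ideal_mult_left: "\<lbrakk>a \<in> carrier A; x \<in> I\<rbrakk> \<Longrightarrow> a \<otimes> x \<in> I"
    and ideal_mult_right: "\<lbrakk>a \<in> carrier A; x \<in> I\<rbrakk> \<Longrightarrow> x \<otimes> a \<in> I"
    and ideal_bracket_left: "\<lbrakk>a \<in> carrier A; x \<in> I\<rbrakk> \<Longrightarrow> bracket A a x \<in> I"
    and ideal_bracket_right: "\<lbrakk>a \<in> carrier A; x \<in> I\<rbrakk> \<Longrightarrow> bracket A x a \<in> I"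

definition awb_commutator ::
    "('k, 'z) ring_scheme \<Rightarrow> ('k, 'a) awb \<Rightarrow> 'a set \<Rightarrow> 'a set \<Rightarrow> 'a set"
  where "awb_commutator K A B C = awb_ideal K A hull
    (\<Union>b\<in>B. \<Union>c\<in>C. {b \<otimes>\<^bsub>A\<^esub> c, c \<otimes>\<^bsub>A\<^esub> b, bracket A b c, bracket A c b})"

definition awb_perfect :: "('k, 'z) ring_scheme \<Rightarrow> ('k, 'a) awb \<Rightarrow> bool"
  where "awb_perfect K A \<longleftrightarrow> carrier A = awb_commutator K A (carrier A) (carrier A)"

definition awb_quot :: "('k, 'a) awb \<Rightarrow> 'a set \<Rightarrow> ('k, 'a set) awb"
  where "awb_quot A I =
    \<lparr>carrier = a_rcosets\<^bsub>A\<^esub> I, mult = rcoset_mult A I, one = I +>\<^bsub>A\<^esub> \<one>\<^bsub>A\<^esub>,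
     zero = I, add = set_add A, smult = quot_smult A I,
     bracket = (\<lambda>X Y. \<Union>x\<in>X. \<Union>y\<in>Y. I +>\<^bsub>A\<^esub> bracket A x y)\<rparr>"


section \<open>Homology with trivial coefficients\<close>

text \<open>
  \<open>Tens [a\<^sub>1, \<dots>, a\<^sub>m]\<close> and \<open>Circ [a\<^sub>1, \<dots>, a\<^sub>m]\<close> are the symbols
  \<open>a\<^sub>1 \<otimes> \<dots> \<otimes> a\<^sub>m\<close> and \<open>a\<^sub>1 \<circ> \<dots> \<circ> a\<^sub>m\<close> spanning the two copies of the tensor power.
  In degree 0 there is only the first copy, the tensor power with a single factor, which is
  \<open>A\<close> itself.
\<close>

datatype 'a chain_sym = Tens "'a list" | Circ "'a list"

definition words :: "('k, 'a) awb \<Rightarrow> nat \<Rightarrow> 'a list set"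
  where "words A m = {xs. length xs = m \<and> set xs \<subseteq> carrier A}"

definition multilinear_rels ::
    "('k, 'z) ring_scheme \<Rightarrow> ('k, 'a) awb \<Rightarrow> 'x set \<Rightarrow> nat \<Rightarrow> ('a list \<Rightarrow> 'x)
      \<Rightarrow> (('x \<Rightarrow> 'k) \<times> ('x \<Rightarrow> 'k)) set"
  where "multilinear_rels K A X m c =
    {(free_gen K (c (xs[i := x \<oplus>\<^bsub>A\<^esub> y])),
      free_gen K (c (xs[i := x])) \<oplus>\<^bsub>free_vs K X\<^esub> free_gen K (c (xs[i := y])))
      | xs i x y. xs \<in> words A m \<and> i < m \<and> x \<in> carrier A \<and> y \<in> carrier A} \<union>
    {(free_gen K (c (xs[i := k \<odot>\<^bsub>A\<^esub> x])), k \<odot>\<^bsub>free_vs K X\<^esub> free_gen K (c (xs[i := x])))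
      | xs i k x. xs \<in> words A m \<and> i < m \<and> k \<in> carrier K \<and> x \<in> carrier A}"

definition chain_syms :: "('k, 'a) awb \<Rightarrow> nat \<Rightarrow> 'a chain_sym set"
  where "chain_syms A n =
    Tens ` words A (Suc n) \<union> (if n = 0 then {} else Circ ` words A (Suc n))"

definition chain_rels ::
    "('k, 'z) ring_scheme \<Rightarrow> ('k, 'a) awb \<Rightarrow> nat
      \<Rightarrow> (('a chain_sym \<Rightarrow> 'k) \<times> ('a chain_sym \<Rightarrow> 'k)) set"
  where "chain_rels K A n =
    multilinear_rels K A (chain_syms A n) (Suc n) Tens \<union>
    (if n = 0 then {} else multilinear_rels K A (chain_syms A n) (Suc n) Circ)"

definition chains ::
    "('k, 'z) ring_scheme \<Rightarrow> ('k, 'a) awb \<Rightarrow> nat \<Rightarrow> ('k, ('a chain_sym \<Rightarrow> 'k) set) module"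
  where "chains K A n = pres_vs K (chain_syms A n) (chain_rels K A n)"

definition chain_gen ::
    "('k, 'z) ring_scheme \<Rightarrow> ('k, 'a) awb \<Rightarrow> nat \<Rightarrow> 'a chain_sym \<Rightarrow> ('a chain_sym \<Rightarrow> 'k) set"
  where "chain_gen K A n = pres_gen K (chain_syms A n) (chain_rels K A n)"

definition contract :: "('k, 'a) awb \<Rightarrow> nat \<Rightarrow> 'a list \<Rightarrow> 'a list"
  where "contract A i xs = take i xs @ (xs ! i \<otimes>\<^bsub>A\<^esub> xs ! Suc i) # drop (Suc (Suc i)) xs"

text \<open>
  List positions start at 0, so the position \<open>i\<close> below is the summation index of the usual
  formula minus 1. For \<open>n = 0\<close> the sum is empty and the boundary is the zero map.
\<close>

fun boundary_sym ::
    "('k, 'z) ring_scheme \<Rightarrow> ('k, 'a) awb \<Rightarrow> nat \<Rightarrow> 'a chain_sym \<Rightarrow> ('a chain_sym \<Rightarrow> 'k) set"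
  where
  "boundary_sym K A n (Tens xs) =
    (\<Oplus>\<^bsub>chains K A (n - 1)\<^esub>i\<in>{..<n}.
      ((\<ominus>\<^bsub>K\<^esub> \<one>\<^bsub>K\<^esub>) [^]\<^bsub>K\<^esub> i) \<odot>\<^bsub>chains K A (n - 1)\<^esub>
        chain_gen K A (n - 1) (Tens (contract A i xs)))"
| "boundary_sym K A n (Circ xs) =
    (\<Oplus>\<^bsub>chains K A (n - 1)\<^esub>i\<in>{..<n}.
      chain_gen K A (n - 1) (Tens ((butlast xs)[i := bracket A (xs ! i) (last xs)])))
    \<oplus>\<^bsub>chains K A (n - 1)\<^esub>
    (\<Oplus>\<^bsub>chains K A (n - 1)\<^esub>i\<in>{..<n - 1}.
      ((\<ominus>\<^bsub>K\<^esub> \<one>\<^bsub>K\<^esub>) [^]\<^bsub>K\<^esub> Suc i) \<odot>\<^bsub>chains K A (n - 1)\<^esub>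
        chain_gen K A (n - 1) (Circ (contract A i xs)))"

definition boundary ::
    "('k, 'z) ring_scheme \<Rightarrow> ('k, 'a) awb \<Rightarrow> nat
      \<Rightarrow> ('a chain_sym \<Rightarrow> 'k) set \<Rightarrow> ('a chain_sym \<Rightarrow> 'k) set"
  where "boundary K A n = pres_map K (chains K A (n - 1)) (boundary_sym K A n)"

definition cycles ::
    "('k, 'z) ring_scheme \<Rightarrow> ('k, 'a) awb \<Rightarrow> nat \<Rightarrow> ('k, ('a chain_sym \<Rightarrow> 'k) set) module"
  where "cycles K A n =
    (chains K A n)\<lparr>carrier := a_kernel (chains K A n) (chains K A (n - 1)) (boundary K A n)\<rparr>"

definition boundaries ::
    "('k, 'z) ring_scheme \<Rightarrow> ('k, 'a) awb \<Rightarrow> nat \<Rightarrow> ('a chain_sym \<Rightarrow> 'k) set set"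
  where "boundaries K A n = boundary K A (Suc n) ` carrier (chains K A (Suc n))"

definition homology ::
    "('k, 'z) ring_scheme \<Rightarrow> ('k, 'a) awb \<Rightarrow> nat \<Rightarrow> ('k, ('a chain_sym \<Rightarrow> 'k) set set) module"
  where "homology K A n = quot_mod (cycles K A n) (boundaries K A n)"

definition chain_map ::
    "('k, 'z) ring_scheme \<Rightarrow> ('k, 'b) awb \<Rightarrow> ('a \<Rightarrow> 'b) \<Rightarrow> nat
      \<Rightarrow> ('a chain_sym \<Rightarrow> 'k) set \<Rightarrow> ('b chain_sym \<Rightarrow> 'k) set"
  where "chain_map K B \<phi> n =
    pres_map K (chains K B n) (\<lambda>s. chain_gen K B n (map_chain_sym \<phi> s))"

definition homology_map ::
    "('k, 'z) ring_scheme \<Rightarrow> ('k, 'b) awb \<Rightarrow> ('a \<Rightarrow> 'b) \<Rightarrow> nat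
      \<Rightarrow> ('a chain_sym \<Rightarrow> 'k) set set \<Rightarrow> ('b chain_sym \<Rightarrow> 'k) set set"
  where "homology_map K B \<phi> n Z =
    the_elem ((\<lambda>z. boundaries K B n +>\<^bsub>cycles K B n\<^esub> chain_map K B \<phi> n z) ` Z)"


section \<open>Non-abelian tensor product\<close>

text \<open>
  The four operations by which an algebra with elements \<open>p\<close> acts on one with elements \<open>q\<close>:
  \<open>ldot p q\<close>, \<open>rdot q p\<close>, \<open>lstar p q\<close>, \<open>rstar q p\<close> are the elements written with \<open>p\<close> as an
  exponent of \<open>q\<close>: upper left with a dot, upper right with a dot, upper left with an asterisk,
  upper right with an asterisk.
\<close>

record ('p, 'q) awb_action =
  ldot :: "'p \<Rightarrow> 'q \<Rightarrow> 'q"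
  rdot :: "'q \<Rightarrow> 'p \<Rightarrow> 'q"
  lstar :: "'p \<Rightarrow> 'q \<Rightarrow> 'q"
  rstar :: "'q \<Rightarrow> 'p \<Rightarrow> 'q"

text \<open>
  \<open>MN Odot m n\<close>, \<open>NM Odot n m\<close>, \<open>MN Ast m n\<close>, \<open>NM Ast n m\<close> are the symbols
  \<open>m \<odot> n\<close>, \<open>n \<odot> m\<close>, \<open>m \<circledast> n\<close>, \<open>n \<circledast> m\<close>.
\<close>

datatype tensor_op = Odot | Ast

datatype ('m, 'n) tensor_sym = MN tensor_op 'm 'n | NM tensor_op 'n 'm

text \<open>
  From here on \<open>\<alpha>\<close> is the action of \<open>M\<close> on \<open>N\<close> and \<open>\<beta>\<close> is the action of \<open>N\<close> on \<open>M\<close>.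
  \<open>sym_M \<beta> g\<close> and \<open>sym_N \<alpha> g\<close> are the components of the basic pair of the symbol \<open>g\<close>.
\<close>

fun sym_M :: "('n, 'm) awb_action \<Rightarrow> ('m, 'n) tensor_sym \<Rightarrow> 'm"
  where
  "sym_M \<beta> (MN Odot m n) = rdot \<beta> m n"
| "sym_M \<beta> (NM Odot n m) = ldot \<beta> n m"
| "sym_M \<beta> (MN Ast m n) = rstar \<beta> m n"
| "sym_M \<beta> (NM Ast n m) = lstar \<beta> n m"

fun sym_N :: "('m, 'n) awb_action \<Rightarrow> ('m, 'n) tensor_sym \<Rightarrow> 'n"
  where
  "sym_N \<alpha> (MN Odot m n) = ldot \<alpha> m n"
| "sym_N \<alpha> (NM Odot n m) = rdot \<alpha> n m"
| "sym_N \<alpha> (MN Ast m n) = lstar \<alpha> m n"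
| "sym_N \<alpha> (NM Ast n m) = rstar \<alpha> n m"

definition tensor_syms :: "('k, 'm) awb \<Rightarrow> ('k, 'n) awb \<Rightarrow> ('m, 'n) tensor_sym set"
  where "tensor_syms M N =
    {MN s m n | s m n. m \<in> carrier M \<and> n \<in> carrier N} \<union>
    {NM s n m | s m n. m \<in> carrier M \<and> n \<in> carrier N}"

definition basic_pairs ::
    "('k, 'm) awb \<Rightarrow> ('k, 'n) awb \<Rightarrow> ('m, 'n) awb_action \<Rightarrow> ('n, 'm) awb_action \<Rightarrow> ('m \<times> 'n) set"
  where "basic_pairs M N \<alpha> \<beta> = (\<lambda>g. (sym_M \<beta> g, sym_N \<alpha> g)) ` tensor_syms M N"

text \<open>
  Below, \<open>\<alpha>\<close> is an action of \<open>P\<close> on \<open>Q\<close>, and \<open>pq s p q\<close>, \<open>qp s q p\<close> are the elements of the free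
  space \<open>F\<close> written \<open>p \<star> q\<close> and \<open>q \<star> p\<close>. Taking \<open>(P, Q) = (M, N)\<close> and \<open>(P, Q) = (N, M)\<close> gives the
  relations and those with the roles of \<open>M\<close> and \<open>N\<close> exchanged.
\<close>

definition bilinear_rels ::
    "('k, 'z) ring_scheme \<Rightarrow> ('k, 'v) module \<Rightarrow> ('k, 'p) awb \<Rightarrow> ('k, 'q) awb
      \<Rightarrow> (tensor_op \<Rightarrow> 'p \<Rightarrow> 'q \<Rightarrow> 'v) \<Rightarrow> ('v \<times> 'v) set"
  where "bilinear_rels K F P Q pq =
    {(k \<odot>\<^bsub>F\<^esub> pq s p q, pq s (k \<odot>\<^bsub>P\<^esub> p) q)
      | k s p q. k \<in> carrier K \<and> p \<in> carrier P \<and> q \<in> carrier Q} \<union>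
    {(k \<odot>\<^bsub>F\<^esub> pq s p q, pq s p (k \<odot>\<^bsub>Q\<^esub> q))
      | k s p q. k \<in> carrier K \<and> p \<in> carrier P \<and> q \<in> carrier Q} \<union>
    {(pq s (p \<oplus>\<^bsub>P\<^esub> p') q, pq s p q \<oplus>\<^bsub>F\<^esub> pq s p' q)
      | s p p' q. p \<in> carrier P \<and> p' \<in> carrier P \<and> q \<in> carrier Q} \<union>
    {(pq s p (q \<oplus>\<^bsub>Q\<^esub> q'), pq s p q \<oplus>\<^bsub>F\<^esub> pq s p q')
      | s p q q'. p \<in> carrier P \<and> q \<in> carrier Q \<and> q' \<in> carrier Q}"

definition action_rels ::
    "('k, 'v) module \<Rightarrow> ('k, 'p) awb \<Rightarrow> ('k, 'q) awb \<Rightarrow> ('p, 'q) awb_action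
      \<Rightarrow> (tensor_op \<Rightarrow> 'p \<Rightarrow> 'q \<Rightarrow> 'v) \<Rightarrow> (tensor_op \<Rightarrow> 'q \<Rightarrow> 'p \<Rightarrow> 'v) \<Rightarrow> ('v \<times> 'v) set"
  where "action_rels F P Q \<alpha> pq qp =
    (\<Union>p\<^sub>1\<in>carrier P. \<Union>p\<^sub>2\<in>carrier P. \<Union>q\<in>carrier Q.
      {(pq Odot (p\<^sub>1 \<otimes>\<^bsub>P\<^esub> p\<^sub>2) q, pq Odot p\<^sub>1 (ldot \<alpha> p\<^sub>2 q)),
       (qp Odot q (p\<^sub>1 \<otimes>\<^bsub>P\<^esub> p\<^sub>2), qp Odot (rdot \<alpha> q p\<^sub>1) p\<^sub>2),
       (pq Ast (p\<^sub>1 \<otimes>\<^bsub>P\<^esub> p\<^sub>2) q,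
         pq Odot p\<^sub>1 (lstar \<alpha> p\<^sub>2 q) \<oplus>\<^bsub>F\<^esub> qp Odot (lstar \<alpha> p\<^sub>1 q) p\<^sub>2),
       (qp Ast (ldot \<alpha> p\<^sub>1 q) p\<^sub>2,
         pq Odot p\<^sub>1 (rstar \<alpha> q p\<^sub>2) \<oplus>\<^bsub>F\<^esub> pq Odot (bracket P p\<^sub>1 p\<^sub>2) q),
       (qp Ast (rdot \<alpha> q p\<^sub>1) p\<^sub>2,
         qp Odot (rstar \<alpha> q p\<^sub>2) p\<^sub>1 \<oplus>\<^bsub>F\<^esub> qp Odot q (bracket P p\<^sub>1 p\<^sub>2)),
       (qp Odot (ldot \<alpha> p\<^sub>1 q) p\<^sub>2, pq Odot p\<^sub>1 (rdot \<alpha> q p\<^sub>2))})"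

definition tensor_rels ::
    "('k, 'z) ring_scheme \<Rightarrow> ('k, 'm) awb \<Rightarrow> ('k, 'n) awb
      \<Rightarrow> ('m, 'n) awb_action \<Rightarrow> ('n, 'm) awb_action
      \<Rightarrow> ((('m, 'n) tensor_sym \<Rightarrow> 'k) \<times> (('m, 'n) tensor_sym \<Rightarrow> 'k)) set"
  where "tensor_rels K M N \<alpha> \<beta> =
    (let F = free_vs K (tensor_syms M N);
         mn = (\<lambda>s m n. free_gen K (MN s m n));
         nm = (\<lambda>s n m. free_gen K (NM s n m))
     in bilinear_rels K F M N mn \<union> bilinear_rels K F N M nm \<union>
        {(mn s u\<^sub>M v\<^sub>N, nm s u\<^sub>N v\<^sub>M) | s u\<^sub>M u\<^sub>N v\<^sub>M v\<^sub>N.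
          (u\<^sub>M, u\<^sub>N) \<in> basic_pairs M N \<alpha> \<beta> \<and> (v\<^sub>M, v\<^sub>N) \<in> basic_pairs M N \<alpha> \<beta>} \<union>
        action_rels F M N \<alpha> mn nm \<union> action_rels F N M \<beta> nm mn)"

text \<open>Only the vector space structure of the non-abelian tensor product is recorded.\<close>

definition nonab_tensor ::
    "('k, 'z) ring_scheme \<Rightarrow> ('k, 'm) awb \<Rightarrow> ('k, 'n) awb
      \<Rightarrow> ('m, 'n) awb_action \<Rightarrow> ('n, 'm) awb_action
      \<Rightarrow> ('k, (('m, 'n) tensor_sym \<Rightarrow> 'k) set) module"
  where "nonab_tensor K M N \<alpha> \<beta> = pres_vs K (tensor_syms M N) (tensor_rels K M N \<alpha> \<beta>)"

definition psi_M ::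
    "('k, 'z) ring_scheme \<Rightarrow> ('k, 'm) awb \<Rightarrow> ('n, 'm) awb_action
      \<Rightarrow> (('m, 'n) tensor_sym \<Rightarrow> 'k) set \<Rightarrow> 'm"
  where "psi_M K M \<beta> = pres_map K M (sym_M \<beta>)"

text \<open>
  A two-sided ideal \<open>I\<close> of \<open>A\<close>, viewed as the algebra \<open>A\<lparr>carrier := I\<rparr>\<close>, and \<open>A\<close> itself act on
  each other by the operations of \<open>A\<close>; the same record serves for both directions.
\<close>

definition own_action :: "('k, 'a) awb \<Rightarrow> ('a, 'a) awb_action"
  where "own_action A =
    \<lparr>ldot = mult A, rdot = mult A, lstar = bracket A, rstar = bracket A\<rparr>"

definition ideal_tensor ::
    "('k, 'z) ring_scheme \<Rightarrow> ('k, 'a) awb \<Rightarrow> 'a set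
      \<Rightarrow> ('k, (('a, 'a) tensor_sym \<Rightarrow> 'k) set) module"
  where "ideal_tensor K A I =
    nonab_tensor K (A\<lparr>carrier := I\<rparr>) A (own_action A) (own_action A)"

definition ker_psi ::
    "('k, 'z) ring_scheme \<Rightarrow> ('k, 'a) awb \<Rightarrow> 'a set
      \<Rightarrow> ('k, (('a, 'a) tensor_sym \<Rightarrow> 'k) set) module"
  where "ker_psi K A I =
    (ideal_tensor K A I)\<lparr>carrier :=
      a_kernel (ideal_tensor K A I) (A\<lparr>carrier := I\<rparr>)
        (psi_M K (A\<lparr>carrier := I\<rparr>) (own_action A))\<rparr>"

end

theory Submission
  imports Defs
begin

text \<open>
  The sequence comes from the snake lemma. Let \<open>T(A)\<close> be the cokernel of \<open>d\<^sub>2\<close>, that is, the vector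
  space generated by bilinear symbols \<open>a \<otimes> b\<close> and \<open>a \<circ> b\<close> subject to \<open>ab \<otimes> c = a \<otimes> bc\<close> and
  \<open>ab \<circ> c = [a,c] \<otimes> b + a \<otimes> [b,c]\<close>. The boundary \<open>d\<^sub>1\<close> induces a map \<open>T(A) \<rightarrow> A\<close>, sending
  \<open>a \<otimes> b\<close> to \<open>ab\<close> and \<open>a \<circ> b\<close> to \<open>[a,b]\<close>, and first homology is the kernel of that map.

  The relations of the non-abelian tensor product all hold in \<open>T(A)\<close> when \<open>m \<odot> a\<close>, \<open>a \<odot> m\<close> are read
  as \<open>m \<otimes> a\<close>, \<open>a \<otimes> m\<close> and \<open>m \<circledast> a\<close>, \<open>a \<circledast> m\<close> as \<open>m \<circ> a\<close>, \<open>a \<circ> m\<close>: every action is an operation of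
  \<open>A\<close>, so the relations become instances of the relations of \<open>T(A)\<close>. This gives a linear map
  \<open>M \<boxtimes> A \<rightarrow> T(A)\<close> and a commutative diagram with rows
  \<open>M \<boxtimes> A \<rightarrow> T(A) \<rightarrow> T(A/M) \<rightarrow> 0\<close> and \<open>0 \<rightarrow> M \<rightarrow> A \<rightarrow> A/M \<rightarrow> 0\<close>,
  whose first vertical map is \<open>\<psi>\<close>. The upper row is exact (\<open>tensor_to_coker_image\<close>,
  \<open>coker_proj_surj\<close>) because dividing \<open>T(A)\<close> by the symbols with an entry in \<open>M\<close> leaves the space
  generated by the symbols with entries in \<open>A/M\<close>.

  The snake lemma turns this into \<open>Ker \<psi> \<rightarrow> H\<^sub>1(A) \<rightarrow> H\<^sub>1(A/M) \<rightarrow> Coker \<psi> \<rightarrow> Coker (T(A) \<rightarrow> A)\<close>. The image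
  of \<open>\<psi>\<close> is \<open>[[A,M]]\<close> (\<open>psi_image\<close>), which identifies the fourth term, and the image of \<open>T(A) \<rightarrow> A\<close> is
  \<open>[[A,A]]\<close> (\<open>coker_diff_surj\<close>), so the last term vanishes for a perfect algebra.
\<close>

section \<open>Linear maps and quotient spaces\<close>

text \<open>
  The fields \<open>mult\<close> and \<open>one\<close> of a record do not enter: a quotient algebra is a vector space
  because the underlying quotient space is one.
\<close>

lemma module_cong:
  assumes "carrier W = carrier V" "add W = add V" "zero W = zero V" "smult W = smult V"
  shows "module K W \<longleftrightarrow> module K V"
  using assms
  by (simp add: module_def module_axioms_def abelian_group_def abelian_group_axioms_def
      abelian_monoid_def comm_group_def group_def group_axioms_def comm_monoid_def
      comm_monoid_axioms_def monoid_def Units_def)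

lemma (in module) minus_zero: "x \<in> carrier M \<Longrightarrow> x \<ominus>\<^bsub>M\<^esub> \<zero>\<^bsub>M\<^esub> = x"
  using M.minus_equality[OF M.l_zero[OF M.zero_closed] M.zero_closed M.zero_closed]
  by (simp add: a_minus_def)

lemma (in module) minus_eq_zero_iff:
  assumes "x \<in> carrier M" "y \<in> carrier M"
  shows "x \<ominus>\<^bsub>M\<^esub> y = \<zero>\<^bsub>M\<^esub> \<longleftrightarrow> x = y"
  using M.minus_equality[of x "\<ominus>\<^bsub>M\<^esub> y"] assms by (auto simp: a_minus_def M.r_neg)

context linear_map
begin

lemma map_zero: "f \<zero>\<^bsub>V\<^esub> = \<zero>\<^bsub>W\<^esub>"
proof -
  have "f \<zero>\<^bsub>V\<^esub> \<oplus>\<^bsub>W\<^esub> f \<zero>\<^bsub>V\<^esub> = f \<zero>\<^bsub>V\<^esub>"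
    using map_add[of "\<zero>\<^bsub>V\<^esub>" "\<zero>\<^bsub>V\<^esub>"] by simp
  then show ?thesis using map_closed[of "\<zero>\<^bsub>V\<^esub>"] by simp
qed

lemma map_neg: "x \<in> carrier V \<Longrightarrow> f (\<ominus>\<^bsub>V\<^esub> x) = \<ominus>\<^bsub>W\<^esub> f x"
  using map_add[of "\<ominus>\<^bsub>V\<^esub> x" x] map_closed map_zero
  by (simp add: V.M.l_neg W.M.minus_equality)

lemma map_minus:
  "x \<in> carrier V \<Longrightarrow> y \<in> carrier V \<Longrightarrow> f (x \<ominus>\<^bsub>V\<^esub> y) = f x \<ominus>\<^bsub>W\<^esub> f y"
  by (simp add: a_minus_def map_add map_neg)

lemma kernel_submodule: "submodule (a_kernel V W f) K V"
  unfolding a_kernel_def'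
  by (intro V.submoduleI) (auto simp: map_zero map_neg map_add map_smult)

lemma image_submodule: "submodule (f ` carrier V) K W"
proof (rule W.submoduleI)
  show "f ` carrier V \<subseteq> carrier W" using map_closed by auto
  show "\<zero>\<^bsub>W\<^esub> \<in> f ` carrier V" using map_zero[symmetric] by (rule image_eqI) simp
  show "\<ominus>\<^bsub>W\<^esub> a \<in> f ` carrier V" if "a \<in> f ` carrier V" for a
    using that map_neg[symmetric] by auto
  show "a \<oplus>\<^bsub>W\<^esub> b \<in> f ` carrier V" if "a \<in> f ` carrier V" "b \<in> f ` carrier V" for a b
    using that map_add[symmetric] by auto
  show "k \<odot>\<^bsub>W\<^esub> x \<in> f ` carrier V" if "k \<in> carrier K" "x \<in> f ` carrier V" for k x
    using that map_smult[symmetric] by auto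
qed

lemma preimage_submodule:
  assumes S: "submodule S K W"
  shows "submodule {x \<in> carrier V. f x \<in> S} K V"
proof (rule V.submoduleI)
  note E = W.submoduleE[OF S]
  show "\<zero>\<^bsub>V\<^esub> \<in> {x \<in> carrier V. f x \<in> S}"
    using S by (simp add: map_zero submodule_def subgroup_def)
  show "\<ominus>\<^bsub>V\<^esub> a \<in> {x \<in> carrier V. f x \<in> S}" if "a \<in> {x \<in> carrier V. f x \<in> S}" for a
    using that E(3) by (simp add: map_neg)
  show "a \<oplus>\<^bsub>V\<^esub> b \<in> {x \<in> carrier V. f x \<in> S}"
    if "a \<in> {x \<in> carrier V. f x \<in> S}" "b \<in> {x \<in> carrier V. f x \<in> S}" for a b
    using that E(5) by (simp add: map_add)
  show "k \<odot>\<^bsub>V\<^esub> a \<in> {x \<in> carrier V. f x \<in> S}"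
    if "k \<in> carrier K" "a \<in> {x \<in> carrier V. f x \<in> S}" for k a
    using that E(4) by (simp add: map_smult)
qed auto

lemma comp:
  assumes "linear_map K W X g"
  shows "linear_map K V X (\<lambda>x. g (f x))"
proof -
  interpret g: linear_map K W X g by fact
  show ?thesis
    by unfold_locales (auto simp: map_closed g.map_closed map_add g.map_add map_smult g.map_smult)
qed

lemma restrict:
  assumes S: "submodule S K V" and R: "submodule R K W" and "f ` S \<subseteq> R"
  shows "linear_map K (V\<lparr>carrier := S\<rparr>) (W\<lparr>carrier := R\<rparr>) f"
proof -
  interpret S: module K "V\<lparr>carrier := S\<rparr>"
    by (rule submodule.submodule_is_module[OF S V.module_axioms])
  interpret R: module K "W\<lparr>carrier := R\<rparr>"
    by (rule submodule.submodule_is_module[OF R W.module_axioms])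
  show ?thesis
    using V.submoduleE(1)[OF S] assms(3)
    by unfold_locales (auto simp: map_add map_smult subset_iff)
qed

end

context module
begin

lemma submodule_abelian_subgroup: "submodule U R M \<Longrightarrow> abelian_subgroup U M"
  by (simp add: M.abelian_group_axioms abelian_subgroupI3 additive_subgroup.intro submodule.axioms(1))

lemma submodule_zero: "submodule U R M \<Longrightarrow> \<zero>\<^bsub>M\<^esub> \<in> U"
  by (simp add: submodule_def subgroup_def)

lemma submodule_mem_carrier: "submodule U R M \<Longrightarrow> x \<in> U \<Longrightarrow> x \<in> carrier M"
  using submoduleE(1) by blast

lemma submodule_Inter:
  assumes "\<And>U. U \<in> F \<Longrightarrow> submodule U R M" "F \<noteq> {}"
  shows "submodule (\<Inter>F) R M"
proof (rule submoduleI)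
  show "\<Inter>F \<subseteq> carrier M" using assms submoduleE(1) by blast
qed (use assms(1) in \<open>simp_all add: submodule_zero submoduleE\<close>)

lemma submodule_hull:
  assumes "S \<subseteq> carrier M"
  shows "submodule ((\<lambda>H. submodule H R M) hull S) R M"
  unfolding hull_def using assms carrier_is_submodule by (intro submodule_Inter) auto

lemma coset_mem_iff:
  assumes "submodule U R M" "x \<in> carrier M" "y \<in> carrier M"
  shows "y \<in> U +>\<^bsub>M\<^esub> x \<longleftrightarrow> y \<ominus>\<^bsub>M\<^esub> x \<in> U"
  using abelian_subgroup.a_rcos_module[OF submodule_abelian_subgroup[OF assms(1)] assms(2,3)]
  by (simp add: a_minus_def)

lemma coset_self: "submodule U R M \<Longrightarrow> x \<in> carrier M \<Longrightarrow> x \<in> U +>\<^bsub>M\<^esub> x"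
  by (simp add: abelian_subgroup.a_rcos_self submodule_abelian_subgroup)

lemma coset_subset: "submodule U R M \<Longrightarrow> x \<in> carrier M \<Longrightarrow> U +>\<^bsub>M\<^esub> x \<subseteq> carrier M"
  by (simp add: M.a_r_coset_subset_G submoduleE(1))

lemma coset_eq_iff:
  assumes "submodule U R M" "x \<in> carrier M" "y \<in> carrier M"
  shows "U +>\<^bsub>M\<^esub> x = U +>\<^bsub>M\<^esub> y \<longleftrightarrow> x \<ominus>\<^bsub>M\<^esub> y \<in> U"
  using coset_mem_iff[OF assms(1,3,2)] coset_self[OF assms(1,2)]
    abelian_subgroup.a_repr_independence'[OF submodule_abelian_subgroup[OF assms(1)] _ assms(3)]
  by auto

lemma coset_zero: "submodule U R M \<Longrightarrow> U +>\<^bsub>M\<^esub> \<zero>\<^bsub>M\<^esub> = U"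
  by (simp add: abelian_subgroup.a_rcos_const submodule_abelian_subgroup submodule_zero)

lemma coset_eq_zero_iff:
  assumes "submodule U R M" "x \<in> carrier M"
  shows "U +>\<^bsub>M\<^esub> x = U \<longleftrightarrow> x \<in> U"
  using coset_eq_iff[OF assms M.zero_closed] assms coset_zero[OF assms(1)]
  by (simp add: minus_zero)

lemma coset_smult:
  assumes U: "submodule U R M" and k: "k \<in> carrier R" and x: "x \<in> carrier M"
  shows "quot_smult M U k (U +>\<^bsub>M\<^esub> x) = U +>\<^bsub>M\<^esub> (k \<odot>\<^bsub>M\<^esub> x)"
proof -
  have "U +>\<^bsub>M\<^esub> (k \<odot>\<^bsub>M\<^esub> y) = U +>\<^bsub>M\<^esub> (k \<odot>\<^bsub>M\<^esub> x)" if y: "y \<in> U +>\<^bsub>M\<^esub> x" for y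
  proof -
    have yc: "y \<in> carrier M" using coset_subset[OF U x] y by auto
    have "k \<odot>\<^bsub>M\<^esub> y \<ominus>\<^bsub>M\<^esub> k \<odot>\<^bsub>M\<^esub> x = k \<odot>\<^bsub>M\<^esub> (y \<ominus>\<^bsub>M\<^esub> x)"
      using k x yc by (simp add: a_minus_def smult_r_distr smult_r_minus)
    also have "\<dots> \<in> U" using coset_mem_iff[OF U x yc] y k submoduleE(4)[OF U] by auto
    finally show ?thesis using coset_eq_iff[OF U] k x yc by auto
  qed
  moreover have "U +>\<^bsub>M\<^esub> x \<noteq> {}" using coset_self[OF U x] by auto
  ultimately show ?thesis
    unfolding quot_smult_def by (rule SUP_eq_const[rotated])
qed

lemma coset_add:
  "submodule U R M \<Longrightarrow> x \<in> carrier M \<Longrightarrow> y \<in> carrier M \<Longrightarrow>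
    (U +>\<^bsub>M\<^esub> x) <+>\<^bsub>M\<^esub> (U +>\<^bsub>M\<^esub> y) = U +>\<^bsub>M\<^esub> (x \<oplus>\<^bsub>M\<^esub> y)"
  by (simp add: abelian_subgroup.a_rcos_sum submodule_abelian_subgroup)

lemma quot_mod_carrier: "carrier (quot_mod M U) = (\<lambda>x. U +>\<^bsub>M\<^esub> x) ` carrier M"
  by (auto simp: quot_mod_def A_RCOSETS_def RCOSETS_def a_r_coset_def)

lemma quot_mod_add [simp]: "add (quot_mod M U) = set_add M"
  and quot_mod_zero [simp]: "zero (quot_mod M U) = U"
  and quot_mod_smult [simp]: "smult (quot_mod M U) = quot_smult M U"
  by (simp_all add: quot_mod_def)

lemma quot_mod_module:
  assumes U: "submodule U R M"
  shows "module R (quot_mod M U)"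
proof (rule moduleI)
  show "cring R" by (rule R.cring_axioms)
  show "abelian_group (quot_mod M U)"
  proof (rule abelian_groupI)
    show "\<exists>Y\<in>carrier (quot_mod M U). Y \<oplus>\<^bsub>quot_mod M U\<^esub> X = \<zero>\<^bsub>quot_mod M U\<^esub>"
      if X: "X \<in> carrier (quot_mod M U)" for X
    proof -
      obtain x where x: "x \<in> carrier M" "X = U +>\<^bsub>M\<^esub> x" using X by (auto simp: quot_mod_carrier)
      show ?thesis
        by (rule bexI[of _ "U +>\<^bsub>M\<^esub> (\<ominus>\<^bsub>M\<^esub> x)"])
          (use x in \<open>auto simp: quot_mod_carrier coset_add[OF U] M.l_neg coset_zero[OF U]\<close>)
    qed
    show "\<zero>\<^bsub>quot_mod M U\<^esub> \<in> carrier (quot_mod M U)"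
      using coset_zero[OF U] by (auto simp: quot_mod_carrier intro: image_eqI[of _ _ "\<zero>\<^bsub>M\<^esub>"])
    show "\<zero>\<^bsub>quot_mod M U\<^esub> \<oplus>\<^bsub>quot_mod M U\<^esub> X = X" if "X \<in> carrier (quot_mod M U)" for X
      using that coset_add[OF U M.zero_closed] by (auto simp: quot_mod_carrier coset_zero[OF U])
  qed (auto simp: quot_mod_carrier coset_add[OF U] M.a_ac)
qed (auto simp: quot_mod_carrier coset_smult[OF U] coset_add[OF U] smult_l_distr smult_r_distr
    smult_assoc1)

lemma quot_proj_linear:
  assumes U: "submodule U R M"
  shows "linear_map R M (quot_mod M U) (\<lambda>x. U +>\<^bsub>M\<^esub> x)"
proof -
  interpret Q: module R "quot_mod M U" by (rule quot_mod_module[OF U])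
  show ?thesis
    by unfold_locales (auto simp: quot_mod_carrier coset_smult[OF U] coset_add[OF U])
qed

end

text \<open>
  A linear map that vanishes on \<open>U\<close> is constant on every coset of \<open>U\<close>, so the image of a coset
  is a singleton. Both \<^const>\<open>pres_map\<close> and \<^const>\<open>homology_map\<close> are defined as the element of
  such a singleton.
\<close>

lemma (in linear_map)
  assumes U: "submodule U K V" and f0: "\<And>u. u \<in> U \<Longrightarrow> f u = \<zero>\<^bsub>W\<^esub>"
  shows quot_lift_coset: "x \<in> carrier V \<Longrightarrow> the_elem (f ` (U +>\<^bsub>V\<^esub> x)) = f x"
    and quot_lift_linear: "linear_map K (quot_mod V U) W (\<lambda>X. the_elem (f ` X))"
proof -
  show *: "the_elem (f ` (U +>\<^bsub>V\<^esub> x)) = f x" if x: "x \<in> carrier V" for x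
  proof -
    have "f y = f x" if y: "y \<in> U +>\<^bsub>V\<^esub> x" for y
    proof -
      have yc: "y \<in> carrier V" using V.coset_subset[OF U x] y by auto
      have "f y \<ominus>\<^bsub>W\<^esub> f x = \<zero>\<^bsub>W\<^esub>"
        using f0 V.coset_mem_iff[OF U x yc] y map_minus[OF yc x] by simp
      then show ?thesis using map_closed x yc by (simp add: W.minus_eq_zero_iff)
    qed
    moreover have "U +>\<^bsub>V\<^esub> x \<noteq> {}" using V.coset_self[OF U x] by auto
    ultimately show ?thesis by (rule the_elem_image_unique[rotated])
  qed
  interpret Q: module K "quot_mod V U" by (rule V.quot_mod_module[OF U])
  show "linear_map K (quot_mod V U) W (\<lambda>X. the_elem (f ` X))"
    by unfold_locales
      (auto simp: V.quot_mod_carrier V.coset_smult[OF U] V.coset_add[OF U] * map_closed map_add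
        map_smult)
qed

lemma coset_update_carrier: "U +>\<^bsub>V\<lparr>carrier := Z\<rparr>\<^esub> x = U +>\<^bsub>V\<^esub> x"
  by (simp add: a_r_coset_def r_coset_def)

text \<open>
  A homology space is a quotient of a space of cycles. Its elements are literally the cosets of
  cycles in the quotient of all chains, and this identity makes it a subspace of that quotient.
\<close>

lemma quot_mod_restrict:
  "quot_mod (V\<lparr>carrier := Z\<rparr>) U = (quot_mod V U)\<lparr>carrier := (\<lambda>x. U +>\<^bsub>V\<^esub> x) ` Z\<rparr>"
proof -
  have "quot_smult (V\<lparr>carrier := Z\<rparr>) U = quot_smult V U"
    by (intro ext) (simp add: quot_smult_def coset_update_carrier)
  moreover have "rcoset_mult (V\<lparr>carrier := Z\<rparr>) U = rcoset_mult V U"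
    by (intro ext) (simp add: rcoset_mult_def coset_update_carrier)
  moreover have "set_add (V\<lparr>carrier := Z\<rparr>) = set_add V"
    by (intro ext) (simp add: set_add_def set_mult_def)
  moreover have "a_rcosets\<^bsub>V\<lparr>carrier := Z\<rparr>\<^esub> U = (\<lambda>x. U +>\<^bsub>V\<^esub> x) ` Z"
    by (auto simp: A_RCOSETS_def RCOSETS_def a_r_coset_def r_coset_def)
  ultimately show ?thesis by (simp add: quot_mod_def coset_update_carrier)
qed

section \<open>Spaces given by generators and relations\<close>

context cring
begin

lemma free_carrier:
  "f \<in> carrier (free_vs R X) \<longleftrightarrow>
    (\<forall>x. f x \<in> carrier R) \<and> finite {x. f x \<noteq> \<zero>} \<and> {x. f x \<noteq> \<zero>} \<subseteq> X"
  by (auto simp: free_vs_def)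

lemma free_ops [simp]:
  "zero (free_vs R X) = (\<lambda>x. \<zero>)"
  "add (free_vs R X) f g = (\<lambda>x. f x \<oplus> g x)"
  "smult (free_vs R X) k f = (\<lambda>x. k \<otimes> f x)"
  by (simp_all add: free_vs_def)

lemma free_add_closed:
  assumes "f \<in> carrier (free_vs R X)" "g \<in> carrier (free_vs R X)"
  shows "(\<lambda>x. f x \<oplus> g x) \<in> carrier (free_vs R X)"
proof -
  have "{x. f x \<oplus> g x \<noteq> \<zero>} \<subseteq> {x. f x \<noteq> \<zero>} \<union> {x. g x \<noteq> \<zero>}" by auto
  moreover have "finite ({x. f x \<noteq> \<zero>} \<union> {x. g x \<noteq> \<zero>})" using assms by (simp add: free_carrier)
  ultimately have "finite {x. f x \<oplus> g x \<noteq> \<zero>}" by (rule finite_subset)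
  moreover have "{x. f x \<oplus> g x \<noteq> \<zero>} \<subseteq> X"
    using \<open>_ \<subseteq> _ \<union> _\<close> assms unfolding free_carrier by blast
  ultimately show ?thesis
    using assms by (simp add: free_carrier)
qed

lemma free_smult_closed:
  assumes "k \<in> carrier R" "f \<in> carrier (free_vs R X)"
  shows "(\<lambda>x. k \<otimes> f x) \<in> carrier (free_vs R X)"
proof -
  have "{x. k \<otimes> f x \<noteq> \<zero>} \<subseteq> {x. f x \<noteq> \<zero>}" using assms(1) by auto
  moreover have "finite {x. f x \<noteq> \<zero>}" using assms by (simp add: free_carrier)
  ultimately have "finite {x. k \<otimes> f x \<noteq> \<zero>}" by (rule finite_subset)
  moreover have "{x. k \<otimes> f x \<noteq> \<zero>} \<subseteq> X"
    using \<open>_ \<subseteq> {x. f x \<noteq> \<zero>}\<close> assms unfolding free_carrier by blast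
  ultimately show ?thesis
    using assms by (simp add: free_carrier)
qed

lemma free_module: "module R (free_vs R X)"
proof (rule moduleI)
  show "cring R" by (rule cring_axioms)
  show "abelian_group (free_vs R X)"
  proof (rule abelian_groupI)
    show "\<exists>g\<in>carrier (free_vs R X). g \<oplus>\<^bsub>free_vs R X\<^esub> f = \<zero>\<^bsub>free_vs R X\<^esub>"
      if f: "f \<in> carrier (free_vs R X)" for f
    proof
      show "(\<lambda>x. \<ominus> \<one> \<otimes> f x) \<in> carrier (free_vs R X)" using f by (intro free_smult_closed) auto
      show "(\<lambda>x. \<ominus> \<one> \<otimes> f x) \<oplus>\<^bsub>free_vs R X\<^esub> f = \<zero>\<^bsub>free_vs R X\<^esub>"
        using f by (simp add: free_carrier l_minus l_neg)
    qed
    show "f \<oplus>\<^bsub>free_vs R X\<^esub> g \<in> carrier (free_vs R X)"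
      if "f \<in> carrier (free_vs R X)" "g \<in> carrier (free_vs R X)" for f g
      using that by (simp add: free_add_closed)
  qed (auto simp: free_carrier a_ac)
  show "k \<odot>\<^bsub>free_vs R X\<^esub> f \<in> carrier (free_vs R X)"
    if "k \<in> carrier R" "f \<in> carrier (free_vs R X)" for k f
    using that by (simp add: free_smult_closed)
qed (auto simp: free_carrier l_distr r_distr m_assoc)

lemma free_gen_closed: "x \<in> X \<Longrightarrow> free_gen R x \<in> carrier (free_vs R X)"
  by (auto simp: free_carrier free_gen_def)

text \<open>
  Induction on a finite set containing the support of \<open>f\<close>, splitting off one coordinate at a time.
\<close>

lemma free_span:
  assumes U: "submodule U R (free_vs R X)" and gen: "\<And>x. x \<in> X \<Longrightarrow> free_gen R x \<in> U"
    and f: "f \<in> carrier (free_vs R X)"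
  shows "f \<in> U"
proof -
  interpret F: module R "free_vs R X" by (rule free_module)
  have "\<forall>f. f \<in> carrier (free_vs R X) \<longrightarrow> {x. f x \<noteq> \<zero>} \<subseteq> S \<longrightarrow> f \<in> U"
    if "finite S" for S
    using that
  proof induct
    case empty
    have "f = \<zero>\<^bsub>free_vs R X\<^esub>" if "{x. f x \<noteq> \<zero>} \<subseteq> {}" for f
      using that by auto
    then show ?case using F.submodule_zero[OF U] by metis
  next
    case (insert y S)
    show ?case
    proof (intro allI impI)
      fix f assume f: "f \<in> carrier (free_vs R X)" and S: "{x. f x \<noteq> \<zero>} \<subseteq> insert y S"
      show "f \<in> U"
      proof (cases "f y = \<zero>")
        case True
        then show ?thesis using insert(3) f S by (metis (mono_tags, lifting) mem_Collect_eq subset_insert)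
      next
        case False
        then have y: "y \<in> X" using f by (auto simp: free_carrier)
        define g where "g = f(y := \<zero>)"
        have "{x. g x \<noteq> \<zero>} \<subseteq> {x. f x \<noteq> \<zero>}" by (auto simp: g_def)
        then have "g \<in> carrier (free_vs R X)"
          using f by (auto simp: free_carrier g_def intro: finite_subset)
        moreover have "{x. g x \<noteq> \<zero>} \<subseteq> S" using S by (auto simp: g_def)
        ultimately have "g \<in> U" using insert(3) by blast
        moreover have "f y \<odot>\<^bsub>free_vs R X\<^esub> free_gen R y \<in> U"
          using f gen[OF y] F.submoduleE(4)[OF U] by (simp add: free_carrier)
        moreover have "f = g \<oplus>\<^bsub>free_vs R X\<^esub> (f y \<odot>\<^bsub>free_vs R X\<^esub> free_gen R y)"
          using f by (auto simp: g_def free_gen_def free_carrier)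
        ultimately show ?thesis using F.submoduleE(5)[OF U] by metis
      qed
    qed
  qed
  then show ?thesis using f by (auto simp: free_carrier)
qed

end

context module
begin

text \<open>
  The support of a sum can be smaller than the union of the supports. Replacing the support by an
  arbitrary finite set above it makes additivity a termwise statement.
\<close>

lemma lin_ext_superset:
  assumes "f \<in> carrier (free_vs R X)" "finite S" "{x. f x \<noteq> \<zero>} \<subseteq> S" "S \<subseteq> X"
    and \<phi>: "\<And>x. x \<in> X \<Longrightarrow> \<phi> x \<in> carrier M"
  shows "lin_ext R M \<phi> f = (\<Oplus>\<^bsub>M\<^esub>x\<in>S. f x \<odot>\<^bsub>M\<^esub> \<phi> x)"
  unfolding lin_ext_def
  using assms by (intro M.add.finprod_mono_neutral_cong_left) (auto simp: R.free_carrier)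

lemma lin_ext_linear:
  assumes \<phi>: "\<And>x. x \<in> X \<Longrightarrow> \<phi> x \<in> carrier M"
  shows "linear_map R (free_vs R X) M (lin_ext R M \<phi>)"
proof -
  interpret F: module R "free_vs R X" by (rule R.free_module)
  note sup = lin_ext_superset[OF _ _ _ _ \<phi>]
  show ?thesis
  proof unfold_locales
    fix f assume f: "f \<in> carrier (free_vs R X)"
    show "lin_ext R M \<phi> f \<in> carrier M"
      unfolding lin_ext_def using f \<phi> by (intro M.finsum_closed) (auto simp: R.free_carrier)
    fix g assume g: "g \<in> carrier (free_vs R X)"
    define S where "S = {x. f x \<noteq> \<zero>} \<union> {x. g x \<noteq> \<zero>}"
    have S: "finite S" "S \<subseteq> X" "{x. f x \<noteq> \<zero>} \<subseteq> S" "{x. g x \<noteq> \<zero>} \<subseteq> S" "{x. f x \<oplus> g x \<noteq> \<zero>} \<subseteq> S"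
      using f g by (auto simp: S_def R.free_carrier)
    have "lin_ext R M \<phi> (f \<oplus>\<^bsub>free_vs R X\<^esub> g) = (\<Oplus>\<^bsub>M\<^esub>x\<in>S. (f x \<oplus> g x) \<odot>\<^bsub>M\<^esub> \<phi> x)"
      using sup[OF F.M.a_closed[OF f g] S(1) _ S(2)] S(5) by simp
    also have "\<dots> = (\<Oplus>\<^bsub>M\<^esub>x\<in>S. f x \<odot>\<^bsub>M\<^esub> \<phi> x \<oplus>\<^bsub>M\<^esub> g x \<odot>\<^bsub>M\<^esub> \<phi> x)"
      using f g S \<phi> by (intro M.finsum_cong') (auto simp: smult_l_distr R.free_carrier)
    also have "\<dots> = (\<Oplus>\<^bsub>M\<^esub>x\<in>S. f x \<odot>\<^bsub>M\<^esub> \<phi> x) \<oplus>\<^bsub>M\<^esub> (\<Oplus>\<^bsub>M\<^esub>x\<in>S. g x \<odot>\<^bsub>M\<^esub> \<phi> x)"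
      using f g S \<phi> by (intro M.finsum_addf) (auto simp: R.free_carrier)
    finally show "lin_ext R M \<phi> (f \<oplus>\<^bsub>free_vs R X\<^esub> g) = lin_ext R M \<phi> f \<oplus>\<^bsub>M\<^esub> lin_ext R M \<phi> g"
      using sup[OF f S(1,3,2)] sup[OF g S(1,4,2)] by simp
  next
    fix k f assume k: "k \<in> carrier R" and f: "f \<in> carrier (free_vs R X)"
    define S where "S = {x. f x \<noteq> \<zero>}"
    have S: "finite S" "S \<subseteq> X" "{x. f x \<noteq> \<zero>} \<subseteq> S" "{x. k \<otimes> f x \<noteq> \<zero>} \<subseteq> S"
      using f k by (auto simp: S_def R.free_carrier)
    have "lin_ext R M \<phi> (k \<odot>\<^bsub>free_vs R X\<^esub> f) = (\<Oplus>\<^bsub>M\<^esub>x\<in>S. (k \<otimes> f x) \<odot>\<^bsub>M\<^esub> \<phi> x)"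
      using sup[OF F.smult_closed[OF k f] S(1) _ S(2)] S(4) by simp
    also have "\<dots> = (\<Oplus>\<^bsub>M\<^esub>x\<in>S. k \<odot>\<^bsub>M\<^esub> (f x \<odot>\<^bsub>M\<^esub> \<phi> x))"
      using f k S \<phi> by (intro M.finsum_cong') (auto simp: smult_assoc1 R.free_carrier)
    also have "\<dots> = k \<odot>\<^bsub>M\<^esub> (\<Oplus>\<^bsub>M\<^esub>x\<in>S. f x \<odot>\<^bsub>M\<^esub> \<phi> x)"
      using f k S \<phi> by (intro finsum_smult_ldistr[symmetric]) (auto simp: R.free_carrier)
    finally show "lin_ext R M \<phi> (k \<odot>\<^bsub>free_vs R X\<^esub> f) = k \<odot>\<^bsub>M\<^esub> lin_ext R M \<phi> f"
      using sup[OF f S(1,3,2)] by simp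
  qed
qed

lemma lin_ext_gen:
  assumes \<phi>: "\<And>x. x \<in> X \<Longrightarrow> \<phi> x \<in> carrier M" and x: "x \<in> X"
  shows "lin_ext R M \<phi> (free_gen R x) = \<phi> x"
proof -
  have "lin_ext R M \<phi> (free_gen R x) = (\<Oplus>\<^bsub>M\<^esub>y\<in>{x}. free_gen R x y \<odot>\<^bsub>M\<^esub> \<phi> y)"
    using x by (intro lin_ext_superset[OF R.free_gen_closed[OF x] _ _ _ \<phi>]) (auto simp: free_gen_def)
  also have "\<dots> = \<phi> x"
    using \<phi>[OF x] M.finsum_insert[of "{}" x "\<lambda>y. free_gen R x y \<odot>\<^bsub>M\<^esub> \<phi> y"]
    by (simp add: free_gen_def)
  finally show ?thesis .
qed

end

text \<open>
  The sides of the relations have to lie in the free space. If a difference \<open>l - r\<close> lay outside,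
  no submodule would contain it and the hull defining \<^const>\<open>rel_space\<close> would be an intersection
  of the empty family, that is, the whole type.
\<close>

locale presentation = cring R for R (structure) and X and Rel +
  assumes rels_closed: "(l, r) \<in> Rel \<Longrightarrow> l \<in> carrier (free_vs R X)"
    "(l, r) \<in> Rel \<Longrightarrow> r \<in> carrier (free_vs R X)"
begin

sublocale F: module R "free_vs R X" by (rule free_module)

lemma rel_space_submodule: "submodule (rel_space R X Rel) R (free_vs R X)"
  unfolding rel_space_def using rels_closed by (intro F.submodule_hull) auto

lemma pres_module: "module R (pres_vs R X Rel)"
  unfolding pres_vs_def by (rule F.quot_mod_module[OF rel_space_submodule])

sublocale P: module R "pres_vs R X Rel" by (rule pres_module)

lemma pres_proj_linear:
  "linear_map R (free_vs R X) (pres_vs R X Rel) (\<lambda>f. rel_space R X Rel +>\<^bsub>free_vs R X\<^esub> f)"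
  unfolding pres_vs_def by (rule F.quot_proj_linear[OF rel_space_submodule])

lemma pres_gen_closed: "x \<in> X \<Longrightarrow> pres_gen R X Rel x \<in> carrier (pres_vs R X Rel)"
  unfolding pres_gen_def by (rule linear_map.map_closed[OF pres_proj_linear free_gen_closed])

lemma pres_rel:
  assumes "(l, r) \<in> Rel"
  shows "rel_space R X Rel +>\<^bsub>free_vs R X\<^esub> l = rel_space R X Rel +>\<^bsub>free_vs R X\<^esub> r"
proof -
  have "l \<ominus>\<^bsub>free_vs R X\<^esub> r \<in> rel_space R X Rel"
    unfolding rel_space_def using assms by (intro hull_inc) auto
  then show ?thesis using F.coset_eq_iff[OF rel_space_submodule] rels_closed[OF assms] by simp
qed

lemma pres_span:
  assumes U: "submodule U R (pres_vs R X Rel)"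
    and gen: "\<And>x. x \<in> X \<Longrightarrow> pres_gen R X Rel x \<in> U"
    and z: "z \<in> carrier (pres_vs R X Rel)"
  shows "z \<in> U"
proof -
  obtain f where f: "f \<in> carrier (free_vs R X)" "z = rel_space R X Rel +>\<^bsub>free_vs R X\<^esub> f"
    using z by (auto simp: pres_vs_def F.quot_mod_carrier)
  have "f \<in> {f \<in> carrier (free_vs R X). rel_space R X Rel +>\<^bsub>free_vs R X\<^esub> f \<in> U}"
    using linear_map.preimage_submodule[OF pres_proj_linear U] _ f(1)
    by (rule free_span) (use gen free_gen_closed in \<open>auto simp: pres_gen_def\<close>)
  then show ?thesis using f by simp
qed

text \<open>
  The universal property of a presentation: the kernel of the linear extension of \<open>\<phi>\<close> is a
  submodule, so once it contains the differences of the relations it contains their hull.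
\<close>

lemma
  assumes W: "module R W" and \<phi>: "\<And>x. x \<in> X \<Longrightarrow> \<phi> x \<in> carrier W"
    and resp: "\<And>l r. (l, r) \<in> Rel \<Longrightarrow> lin_ext R W \<phi> l = lin_ext R W \<phi> r"
  shows pres_map_linear: "linear_map R (pres_vs R X Rel) W (pres_map R W \<phi>)"
    and pres_map_gen: "x \<in> X \<Longrightarrow> pres_map R W \<phi> (pres_gen R X Rel x) = \<phi> x"
proof -
  interpret W: module R W by fact
  interpret L: linear_map R "free_vs R X" W "lin_ext R W \<phi>"
    by (rule W.lin_ext_linear[OF \<phi>])
  have "rel_space R X Rel \<subseteq> a_kernel (free_vs R X) W (lin_ext R W \<phi>)"
    unfolding rel_space_def
  proof (rule hull_minimal[where S = "\<lambda>H. submodule H R (free_vs R X)", OF _ L.kernel_submodule], clarify)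
    fix l r assume lr: "(l, r) \<in> Rel"
    show "l \<ominus>\<^bsub>free_vs R X\<^esub> r \<in> a_kernel (free_vs R X) W (lin_ext R W \<phi>)"
      using rels_closed[OF lr] resp[OF lr] L.map_minus L.map_closed
      by (simp add: a_kernel_def' W.minus_eq_zero_iff)
  qed
  then have 0: "lin_ext R W \<phi> f = \<zero>\<^bsub>W\<^esub>" if "f \<in> rel_space R X Rel" for f
    using that by (auto simp: a_kernel_def')
  show "linear_map R (pres_vs R X Rel) W (pres_map R W \<phi>)"
    using L.quot_lift_linear[OF rel_space_submodule 0] unfolding pres_vs_def pres_map_def .
  show "pres_map R W \<phi> (pres_gen R X Rel x) = \<phi> x" if x: "x \<in> X"
    using L.quot_lift_coset[OF rel_space_submodule 0 free_gen_closed[OF x]] W.lin_ext_gen[OF \<phi> x]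
    unfolding pres_gen_def pres_map_def by simp
qed

lemma pres_linear_eqI:
  assumes f: "linear_map R (pres_vs R X Rel) W f" and g: "linear_map R (pres_vs R X Rel) W g"
    and eq: "\<And>x. x \<in> X \<Longrightarrow> f (pres_gen R X Rel x) = g (pres_gen R X Rel x)"
    and z: "z \<in> carrier (pres_vs R X Rel)"
  shows "f z = g z"
proof -
  interpret f: linear_map R "pres_vs R X Rel" W f by fact
  interpret g: linear_map R "pres_vs R X Rel" W g by fact
  have "submodule {z \<in> carrier (pres_vs R X Rel). f z = g z} R (pres_vs R X Rel)"
    by (rule P.submoduleI)
      (auto simp: f.map_zero g.map_zero f.map_neg g.map_neg f.map_add g.map_add f.map_smult
        g.map_smult)
  then have "z \<in> {z \<in> carrier (pres_vs R X Rel). f z = g z}"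
    by (rule pres_span) (use eq z pres_gen_closed in auto)
  then show ?thesis by simp
qed

end

section \<open>Multilinear maps out of the chain spaces\<close>

text \<open>
  The two summands of a chain space and the two operations of an algebra go together: \<open>\<otimes>\<close> with the
  product, \<open>\<circ>\<close> with the bracket. Indexing both by \<^typ>\<open>tensor_op\<close> lets one statement cover both
  and matches the symbols \<open>\<odot>\<close> and \<open>\<circledast>\<close> of the non-abelian tensor product.
\<close>

fun awb_op :: "('k, 'a) awb \<Rightarrow> tensor_op \<Rightarrow> 'a \<Rightarrow> 'a \<Rightarrow> 'a" where
  "awb_op A Odot = mult A"
| "awb_op A Ast = bracket A"

fun chain_word :: "tensor_op \<Rightarrow> 'a list \<Rightarrow> 'a chain_sym" where
  "chain_word Odot = Tens"
| "chain_word Ast = Circ"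

definition chain_kinds :: "nat \<Rightarrow> tensor_op set" where
  "chain_kinds n = (if n = 0 then {Odot} else UNIV)"

lemma tensor_op_UNIV: "(UNIV :: tensor_op set) = {Odot, Ast}"
  using tensor_op.exhaust by auto

lemma chain_syms_kinds: "chain_syms A n = (\<Union>s\<in>chain_kinds n. chain_word s ` words A (Suc n))"
  by (auto simp: chain_syms_def chain_kinds_def tensor_op_UNIV)

lemma chain_rels_kinds:
  "chain_rels K A n =
    (\<Union>s\<in>chain_kinds n. multilinear_rels K A (chain_syms A n) (Suc n) (chain_word s))"
  by (auto simp: chain_rels_def chain_kinds_def tensor_op_UNIV)

lemma chain_rels_add:
  "\<lbrakk>s \<in> chain_kinds n; xs \<in> words A (Suc n); i < Suc n; x \<in> carrier A; y \<in> carrier A\<rbrakk> \<Longrightarrow>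
    (free_gen K (chain_word s (xs[i := x \<oplus>\<^bsub>A\<^esub> y])),
     free_gen K (chain_word s (xs[i := x])) \<oplus>\<^bsub>free_vs K (chain_syms A n)\<^esub>
       free_gen K (chain_word s (xs[i := y]))) \<in> chain_rels K A n"
  unfolding chain_rels_kinds multilinear_rels_def
  by (rule UN_I, assumption, rule UnI1, intro CollectI exI conjI) (assumption | rule refl)+

lemma chain_rels_smult:
  "\<lbrakk>s \<in> chain_kinds n; xs \<in> words A (Suc n); i < Suc n; k \<in> carrier K; x \<in> carrier A\<rbrakk> \<Longrightarrow>
    (free_gen K (chain_word s (xs[i := k \<odot>\<^bsub>A\<^esub> x])),
     k \<odot>\<^bsub>free_vs K (chain_syms A n)\<^esub> free_gen K (chain_word s (xs[i := x]))) \<in> chain_rels K A n"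
  unfolding chain_rels_kinds multilinear_rels_def
  by (rule UN_I, assumption, rule UnI2, intro CollectI exI conjI) (assumption | rule refl)+

lemma words_update: "xs \<in> words A m \<Longrightarrow> x \<in> carrier A \<Longrightarrow> xs[i := x] \<in> words A m"
  using set_update_subset_insert[of xs i x] by (auto simp: words_def)

lemma word_in_chain_syms:
  "s \<in> chain_kinds n \<Longrightarrow> xs \<in> words A (Suc n) \<Longrightarrow> chain_word s xs \<in> chain_syms A n"
  by (auto simp: chain_syms_kinds)

text \<open>The chain complex is defined for records without further fields.\<close>

locale awb_record = awb K A for K :: "('k, 'z) ring_scheme" and A :: "('k, 'a) awb" (structure)
begin

lemma chain_presentation: "presentation K (chain_syms A n) (chain_rels K A n)"
proof -
  interpret F: module K "free_vs K (chain_syms A n)" by (rule K.free_module)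
  have gen: "free_gen K (chain_word s (xs[i := x])) \<in> carrier (free_vs K (chain_syms A n))"
    if "s \<in> chain_kinds n" "xs \<in> words A (Suc n)" "x \<in> carrier A" for s xs i x
    using that by (intro K.free_gen_closed word_in_chain_syms words_update)
  show ?thesis
  proof unfold_locales
    fix l r assume "(l, r) \<in> chain_rels K A n"
    then obtain s where s: "s \<in> chain_kinds n"
      and "(l, r) \<in> multilinear_rels K A (chain_syms A n) (Suc n) (chain_word s)"
      by (auto simp: chain_rels_kinds)
    then consider
      (add) xs i x y where "xs \<in> words A (Suc n)" "x \<in> carrier A" "y \<in> carrier A"
        "l = free_gen K (chain_word s (xs[i := x \<oplus> y]))"
        "r = free_gen K (chain_word s (xs[i := x])) \<oplus>\<^bsub>free_vs K (chain_syms A n)\<^esub>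
          free_gen K (chain_word s (xs[i := y]))"
    | (smult) xs i k x where "xs \<in> words A (Suc n)" "k \<in> carrier K" "x \<in> carrier A"
        "l = free_gen K (chain_word s (xs[i := k \<odot> x]))"
        "r = k \<odot>\<^bsub>free_vs K (chain_syms A n)\<^esub> free_gen K (chain_word s (xs[i := x]))"
      unfolding multilinear_rels_def by blast
    then have "l \<in> carrier (free_vs K (chain_syms A n)) \<and> r \<in> carrier (free_vs K (chain_syms A n))"
      using s by cases (simp_all add: gen F.M.a_closed F.smult_closed del: K.free_ops)
    then show "l \<in> carrier (free_vs K (chain_syms A n))" "r \<in> carrier (free_vs K (chain_syms A n))"
      by auto
  qed
qed

lemma chains_module: "module K (chains K A n)"
  unfolding chains_def by (rule presentation.pres_module[OF chain_presentation])

lemma chain_gen_closed: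
  "s \<in> chain_kinds n \<Longrightarrow> xs \<in> words A (Suc n) \<Longrightarrow>
    chain_gen K A n (chain_word s xs) \<in> carrier (chains K A n)"
  unfolding chains_def chain_gen_def
  by (intro presentation.pres_gen_closed[OF chain_presentation] word_in_chain_syms)

lemma chain_gen_multilinear:
  assumes s: "s \<in> chain_kinds n" and xs: "xs \<in> words A (Suc n)" and i: "i < Suc n"
    and x: "x \<in> carrier A"
  shows chain_gen_add: "y \<in> carrier A \<Longrightarrow> chain_gen K A n (chain_word s (xs[i := x \<oplus> y])) =
      chain_gen K A n (chain_word s (xs[i := x])) \<oplus>\<^bsub>chains K A n\<^esub>
      chain_gen K A n (chain_word s (xs[i := y]))"
    and chain_gen_smult: "k \<in> carrier K \<Longrightarrow> chain_gen K A n (chain_word s (xs[i := k \<odot> x])) =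
      k \<odot>\<^bsub>chains K A n\<^esub> chain_gen K A n (chain_word s (xs[i := x]))"
proof -
  interpret P: presentation K "chain_syms A n" "chain_rels K A n" by (rule chain_presentation)
  have gen: "free_gen K (chain_word s (xs[i := x])) \<in> carrier (free_vs K (chain_syms A n))"
    if "x \<in> carrier A" for x
    using that s xs by (intro K.free_gen_closed word_in_chain_syms words_update)
  note lin = linear_map.map_add[OF P.pres_proj_linear] linear_map.map_smult[OF P.pres_proj_linear]
  show "chain_gen K A n (chain_word s (xs[i := x \<oplus> y])) =
      chain_gen K A n (chain_word s (xs[i := x])) \<oplus>\<^bsub>chains K A n\<^esub>
      chain_gen K A n (chain_word s (xs[i := y]))" if y: "y \<in> carrier A"
    unfolding chains_def chain_gen_def pres_gen_def lin(1)[OF gen[OF x] gen[OF y], symmetric]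
    using s xs i x y by (intro P.pres_rel chain_rels_add)
  show "chain_gen K A n (chain_word s (xs[i := k \<odot> x])) =
      k \<odot>\<^bsub>chains K A n\<^esub> chain_gen K A n (chain_word s (xs[i := x]))" if k: "k \<in> carrier K"
    unfolding chains_def chain_gen_def pres_gen_def lin(2)[OF k gen[OF x], symmetric]
    using s xs i x k by (intro P.pres_rel chain_rels_smult)
qed

text \<open>
  The universal property of the chain spaces: linear maps out of them are multilinear families.
\<close>

lemma
  assumes W: "module K W"
    and closed: "\<And>s xs. s \<in> chain_kinds n \<Longrightarrow> xs \<in> words A (Suc n) \<Longrightarrow>
      \<phi> (chain_word s xs) \<in> carrier W"
    and add: "\<And>s xs i x y. \<lbrakk>s \<in> chain_kinds n; xs \<in> words A (Suc n); i < Suc n;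
      x \<in> carrier A; y \<in> carrier A\<rbrakk> \<Longrightarrow> \<phi> (chain_word s (xs[i := x \<oplus> y])) =
        \<phi> (chain_word s (xs[i := x])) \<oplus>\<^bsub>W\<^esub> \<phi> (chain_word s (xs[i := y]))"
    and smult: "\<And>s xs i k x. \<lbrakk>s \<in> chain_kinds n; xs \<in> words A (Suc n); i < Suc n;
      k \<in> carrier K; x \<in> carrier A\<rbrakk> \<Longrightarrow> \<phi> (chain_word s (xs[i := k \<odot> x])) =
        k \<odot>\<^bsub>W\<^esub> \<phi> (chain_word s (xs[i := x]))"
  shows chain_lift_linear: "linear_map K (chains K A n) W (pres_map K W \<phi>)"
    and chain_lift_gen: "\<And>s xs. s \<in> chain_kinds n \<Longrightarrow> xs \<in> words A (Suc n) \<Longrightarrow>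
      pres_map K W \<phi> (chain_gen K A n (chain_word s xs)) = \<phi> (chain_word s xs)"
proof -
  interpret P: presentation K "chain_syms A n" "chain_rels K A n" by (rule chain_presentation)
  interpret W: module K W by (rule W)
  have \<phi>: "\<phi> w \<in> carrier W" if "w \<in> chain_syms A n" for w
    using that closed by (auto simp: chain_syms_kinds)
  interpret L: linear_map K "free_vs K (chain_syms A n)" W "lin_ext K W \<phi>"
    by (rule W.lin_ext_linear[OF \<phi>])
  have gen: "free_gen K (chain_word s (xs[i := x])) \<in> carrier (free_vs K (chain_syms A n))"
    "lin_ext K W \<phi> (free_gen K (chain_word s (xs[i := x]))) = \<phi> (chain_word s (xs[i := x]))"
    if "s \<in> chain_kinds n" "xs \<in> words A (Suc n)" "x \<in> carrier A" for s xs i x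
    using that word_in_chain_syms[OF that(1) words_update[OF that(2,3)]]
    by (simp_all add: K.free_gen_closed W.lin_ext_gen[OF \<phi>])
  have resp: "lin_ext K W \<phi> l = lin_ext K W \<phi> r" if "(l, r) \<in> chain_rels K A n" for l r
  proof -
    obtain s where s: "s \<in> chain_kinds n"
      and "(l, r) \<in> multilinear_rels K A (chain_syms A n) (Suc n) (chain_word s)"
      using \<open>(l, r) \<in> chain_rels K A n\<close> by (auto simp: chain_rels_kinds)
    then consider
      (add) xs i x y where "xs \<in> words A (Suc n)" "i < Suc n" "x \<in> carrier A" "y \<in> carrier A"
        "l = free_gen K (chain_word s (xs[i := x \<oplus> y]))"
        "r = free_gen K (chain_word s (xs[i := x])) \<oplus>\<^bsub>free_vs K (chain_syms A n)\<^esub>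
          free_gen K (chain_word s (xs[i := y]))"
    | (smult) xs i k x where "xs \<in> words A (Suc n)" "i < Suc n" "k \<in> carrier K" "x \<in> carrier A"
        "l = free_gen K (chain_word s (xs[i := k \<odot> x]))"
        "r = k \<odot>\<^bsub>free_vs K (chain_syms A n)\<^esub> free_gen K (chain_word s (xs[i := x]))"
      unfolding multilinear_rels_def by blast
    then show ?thesis
      using s by cases (simp_all add: gen L.map_add L.map_smult add smult del: K.free_ops)
  qed
  show "linear_map K (chains K A n) W (pres_map K W \<phi>)"
    unfolding chains_def by (rule P.pres_map_linear[OF W \<phi> resp])
  show "pres_map K W \<phi> (chain_gen K A n (chain_word s xs)) = \<phi> (chain_word s xs)"
    if "s \<in> chain_kinds n" "xs \<in> words A (Suc n)" for s xs
    unfolding chain_gen_def using that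
    by (intro P.pres_map_gen[OF W \<phi> resp] word_in_chain_syms)
qed

lemma chain_linear_eqI:
  assumes f: "linear_map K (chains K A n) W f" and g: "linear_map K (chains K A n) W g"
    and eq: "\<And>s xs. s \<in> chain_kinds n \<Longrightarrow> xs \<in> words A (Suc n) \<Longrightarrow>
      f (chain_gen K A n (chain_word s xs)) = g (chain_gen K A n (chain_word s xs))"
    and z: "z \<in> carrier (chains K A n)"
  shows "f z = g z"
proof (rule presentation.pres_linear_eqI[OF chain_presentation f[unfolded chains_def]
      g[unfolded chains_def] _ z[unfolded chains_def]])
  fix w assume "w \<in> chain_syms A n"
  then show "f (pres_gen K (chain_syms A n) (chain_rels K A n) w) =
      g (pres_gen K (chain_syms A n) (chain_rels K A n) w)"
    using eq unfolding chain_gen_def chain_syms_kinds by blast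
qed

lemma chain_span:
  assumes U: "submodule U K (chains K A n)"
    and gen: "\<And>s xs. s \<in> chain_kinds n \<Longrightarrow> xs \<in> words A (Suc n) \<Longrightarrow>
      chain_gen K A n (chain_word s xs) \<in> U"
    and z: "z \<in> carrier (chains K A n)"
  shows "z \<in> U"
proof (rule presentation.pres_span[OF chain_presentation U[unfolded chains_def] _
      z[unfolded chains_def]])
  fix w assume "w \<in> chain_syms A n"
  then show "pres_gen K (chain_syms A n) (chain_rels K A n) w \<in> U"
    using gen unfolding chain_gen_def chain_syms_kinds by blast
qed

end

section \<open>First homology inside the cokernel of the second boundary\<close>

definition one_chains :: "('k, 'z) ring_scheme \<Rightarrow> ('k, 'a) awb \<Rightarrow> ('k, ('a chain_sym \<Rightarrow> 'k) set) module"
  where "one_chains K A = chains K A 1"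

definition one_chain :: "('k, 'z) ring_scheme \<Rightarrow> ('k, 'a) awb \<Rightarrow> tensor_op \<Rightarrow> 'a \<Rightarrow> 'a
    \<Rightarrow> ('a chain_sym \<Rightarrow> 'k) set"
  where "one_chain K A s a b = chain_gen K A 1 (chain_word s [a, b])"

definition one_boundaries :: "('k, 'z) ring_scheme \<Rightarrow> ('k, 'a) awb \<Rightarrow> ('a chain_sym \<Rightarrow> 'k) set set"
  where "one_boundaries K A = boundaries K A 1"

locale bilinear_family =
  fixes K :: "('k, 'z) ring_scheme" and A :: "('k, 'a) awb" (structure)
    and W :: "('k, 'w, 'r) module_scheme" and \<phi> :: "tensor_op \<Rightarrow> 'a \<Rightarrow> 'a \<Rightarrow> 'w"
  assumes closed: "\<lbrakk>a \<in> carrier A; b \<in> carrier A\<rbrakk> \<Longrightarrow> \<phi> s a b \<in> carrier W"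
    and add_left: "\<lbrakk>a \<in> carrier A; a' \<in> carrier A; b \<in> carrier A\<rbrakk> \<Longrightarrow>
      \<phi> s (a \<oplus> a') b = \<phi> s a b \<oplus>\<^bsub>W\<^esub> \<phi> s a' b"
    and add_right: "\<lbrakk>a \<in> carrier A; b \<in> carrier A; b' \<in> carrier A\<rbrakk> \<Longrightarrow>
      \<phi> s a (b \<oplus> b') = \<phi> s a b \<oplus>\<^bsub>W\<^esub> \<phi> s a b'"
    and smult_left: "\<lbrakk>k \<in> carrier K; a \<in> carrier A; b \<in> carrier A\<rbrakk> \<Longrightarrow>
      \<phi> s (k \<odot> a) b = k \<odot>\<^bsub>W\<^esub> \<phi> s a b"
    and smult_right: "\<lbrakk>k \<in> carrier K; a \<in> carrier A; b \<in> carrier A\<rbrakk> \<Longrightarrow>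
      \<phi> s a (k \<odot> b) = k \<odot>\<^bsub>W\<^esub> \<phi> s a b"

text \<open>
  A bilinear family is a linear map out of the space of 1-chains. The two further equations say that
  this map vanishes on \<open>d\<^sub>2(a \<otimes> b \<otimes> c) = ab \<otimes> c - a \<otimes> bc\<close> and on
  \<open>d\<^sub>2(a \<circ> b \<circ> c) = [a,c] \<otimes> b + a \<otimes> [b,c] - ab \<circ> c\<close>, so a bar family is a linear map out of the
  cokernel of \<open>d\<^sub>2\<close>. For the family of the two operations they are associativity and the
  compatibility of bracket and product.
\<close>

locale bar_family = bilinear_family +
  assumes assoc: "\<lbrakk>a \<in> carrier A; b \<in> carrier A; c \<in> carrier A\<rbrakk> \<Longrightarrow>
      \<phi> Odot (a \<otimes> b) c = \<phi> Odot a (b \<otimes> c)"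
    and deriv: "\<lbrakk>a \<in> carrier A; b \<in> carrier A; c \<in> carrier A\<rbrakk> \<Longrightarrow>
      \<phi> Ast (a \<otimes> b) c = \<phi> Odot (bracket A a c) b \<oplus>\<^bsub>W\<^esub> \<phi> Odot a (bracket A b c)"

lemma bilinear_family_comp:
  assumes \<phi>: "bilinear_family K A W \<phi>" and F: "linear_map K W W' F"
  shows "bilinear_family K A W' (\<lambda>s a b. F (\<phi> s a b))"
proof -
  interpret \<phi>: bilinear_family K A W \<phi> by fact
  interpret F: linear_map K W W' F by fact
  show ?thesis
    by unfold_locales
      (simp_all add: \<phi>.closed \<phi>.add_left \<phi>.add_right \<phi>.smult_left \<phi>.smult_right
        F.map_closed F.map_add F.map_smult)
qed

lemma words_1E: "xs \<in> words A (Suc 0) \<Longrightarrow> \<exists>a. xs = [a] \<and> a \<in> carrier A"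
  by (auto simp: words_def length_Suc_conv)

lemma words_2E: "xs \<in> words A (Suc (Suc 0)) \<Longrightarrow> \<exists>a b. xs = [a, b] \<and> a \<in> carrier A \<and> b \<in> carrier A"
  by (auto simp: words_def length_Suc_conv)

lemma words_3E: "xs \<in> words A (Suc (Suc (Suc 0))) \<Longrightarrow>
    \<exists>a b c. xs = [a, b, c] \<and> a \<in> carrier A \<and> b \<in> carrier A \<and> c \<in> carrier A"
  by (auto simp: words_def length_Suc_conv)

lemma word_mem:
  "a \<in> carrier A \<Longrightarrow> [a] \<in> words A (Suc 0)"
  "a \<in> carrier A \<Longrightarrow> b \<in> carrier A \<Longrightarrow> [a, b] \<in> words A (Suc (Suc 0))"
  "a \<in> carrier A \<Longrightarrow> b \<in> carrier A \<Longrightarrow> c \<in> carrier A \<Longrightarrow> [a, b, c] \<in> words A (Suc (Suc (Suc 0)))"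
  by (simp_all add: words_def)

lemma chain_kinds_simps: "s \<in> chain_kinds (Suc n)" "s \<in> chain_kinds 0 \<longleftrightarrow> s = Odot"
  by (simp_all add: chain_kinds_def)

context awb_record
begin

lemma awb_op_closed: "a \<in> carrier A \<Longrightarrow> b \<in> carrier A \<Longrightarrow> awb_op A s a b \<in> carrier A"
  by (cases s) (simp_all add: mult_closed bracket_closed)

lemma awb_op_bilinear: "bilinear_family K A A (awb_op A)"
proof
  fix s a b assume "a \<in> carrier A" "b \<in> carrier A"
  then show "awb_op A s a b \<in> carrier A" by (rule awb_op_closed)
next
  fix s a a' b assume "a \<in> carrier A" "a' \<in> carrier A" "b \<in> carrier A"
  then show "awb_op A s (a \<oplus> a') b = awb_op A s a b \<oplus> awb_op A s a' b"
    by (cases s) (simp_all add: mult_add_left bracket_add_left)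
next
  fix s a b b' assume "a \<in> carrier A" "b \<in> carrier A" "b' \<in> carrier A"
  then show "awb_op A s a (b \<oplus> b') = awb_op A s a b \<oplus> awb_op A s a b'"
    by (cases s) (simp_all add: mult_add_right bracket_add_right)
next
  fix s k a b assume "k \<in> carrier K" "a \<in> carrier A" "b \<in> carrier A"
  then show "awb_op A s (k \<odot> a) b = k \<odot> awb_op A s a b" "awb_op A s a (k \<odot> b) = k \<odot> awb_op A s a b"
    by (cases s; simp add: mult_smult_left bracket_smult_left mult_smult_right bracket_smult_right)+
qed

lemma awb_op_bar_family: "bar_family K A A (awb_op A)"
  using awb_op_bilinear
  by (intro bar_family.intro bar_family_axioms.intro) (simp_all add: mult_assoc bracket_mult)

lemma one_chains_module: "module K (one_chains K A)"
  unfolding one_chains_def by (rule chains_module)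

lemma one_chain_bilinear: "bilinear_family K A (one_chains K A) (one_chain K A)"
proof
  fix s a b assume a: "a \<in> carrier A" and b: "b \<in> carrier A"
  show "one_chain K A s a b \<in> carrier (one_chains K A)"
    unfolding one_chain_def one_chains_def
    using a b by (intro chain_gen_closed) (simp_all add: chain_kinds_simps word_mem)
  {
    fix a' assume a': "a' \<in> carrier A"
    show "one_chain K A s (a \<oplus> a') b = one_chain K A s a b \<oplus>\<^bsub>one_chains K A\<^esub> one_chain K A s a' b"
      using chain_gen_add[of s 1 "[a, b]" 0 a a'] a a' b
      by (simp add: one_chain_def one_chains_def chain_kinds_simps word_mem)
  }
  {
    fix b' assume b': "b' \<in> carrier A"
    show "one_chain K A s a (b \<oplus> b') = one_chain K A s a b \<oplus>\<^bsub>one_chains K A\<^esub> one_chain K A s a b'"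
      using chain_gen_add[of s 1 "[a, b]" 1 b b'] a b' b
      by (simp add: one_chain_def one_chains_def chain_kinds_simps word_mem)
  }
next
  fix s k a b assume k: "k \<in> carrier K" and a: "a \<in> carrier A" and b: "b \<in> carrier A"
  show "one_chain K A s (k \<odot> a) b = k \<odot>\<^bsub>one_chains K A\<^esub> one_chain K A s a b"
    using chain_gen_smult[of s 1 "[a, b]" 0 a k] a k b
    by (simp add: one_chain_def one_chains_def chain_kinds_simps word_mem)
  show "one_chain K A s a (k \<odot> b) = k \<odot>\<^bsub>one_chains K A\<^esub> one_chain K A s a b"
    using chain_gen_smult[of s 1 "[a, b]" 1 b k] a k b
    by (simp add: one_chain_def one_chains_def chain_kinds_simps word_mem)
qed

lemma one_chains_span:
  assumes U: "submodule U K (one_chains K A)"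
    and gen: "\<And>s a b. a \<in> carrier A \<Longrightarrow> b \<in> carrier A \<Longrightarrow> one_chain K A s a b \<in> U"
    and z: "z \<in> carrier (one_chains K A)"
  shows "z \<in> U"
  using U[unfolded one_chains_def] _ z[unfolded one_chains_def]
proof (rule chain_span)
  fix s xs assume "xs \<in> words A (Suc 1)"
  then show "chain_gen K A 1 (chain_word s xs) \<in> U"
    using gen words_2E[of xs A] by (auto simp: one_chain_def)
qed

lemma one_chains_eqI:
  assumes f: "linear_map K (one_chains K A) W f" and g: "linear_map K (one_chains K A) W g"
    and eq: "\<And>s a b. a \<in> carrier A \<Longrightarrow> b \<in> carrier A \<Longrightarrow>
      f (one_chain K A s a b) = g (one_chain K A s a b)"
    and z: "z \<in> carrier (one_chains K A)"
  shows "f z = g z"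
  using f[unfolded one_chains_def] g[unfolded one_chains_def] _ z[unfolded one_chains_def]
proof (rule chain_linear_eqI)
  fix s xs assume "xs \<in> words A (Suc 1)"
  then show "f (chain_gen K A 1 (chain_word s xs)) = g (chain_gen K A 1 (chain_word s xs))"
    using eq words_2E[of xs A] by (auto simp: one_chain_def)
qed

lemma one_chains_lift:
  assumes W: "module K W" and "bilinear_family K A W \<phi>"
    and val: "\<And>s a b. a \<in> carrier A \<Longrightarrow> b \<in> carrier A \<Longrightarrow> v (chain_word s [a, b]) = \<phi> s a b"
  shows one_chains_lift_linear: "linear_map K (one_chains K A) W (pres_map K W v)"
    and one_chains_lift_gen: "a \<in> carrier A \<Longrightarrow> b \<in> carrier A \<Longrightarrow>
      pres_map K W v (one_chain K A s a b) = \<phi> s a b"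
proof -
  interpret \<phi>: bilinear_family K A W \<phi> by fact
  have closed: "v (chain_word s xs) \<in> carrier W" if "xs \<in> words A (Suc 1)" for s xs
    using words_2E[of xs A] that by (auto simp: val \<phi>.closed)
  have add: "v (chain_word s (xs[i := x \<oplus> y])) =
      v (chain_word s (xs[i := x])) \<oplus>\<^bsub>W\<^esub> v (chain_word s (xs[i := y]))"
    if xs: "xs \<in> words A (Suc 1)" and i: "i < Suc 1" and x: "x \<in> carrier A" and y: "y \<in> carrier A"
    for s xs i x y
  proof -
    obtain a b where ab: "xs = [a, b]" "a \<in> carrier A" "b \<in> carrier A"
      using words_2E[of xs A] xs by auto
    have "i = 0 \<or> i = 1" using i by auto
    then show ?thesis using ab x y by (auto simp: val \<phi>.add_left \<phi>.add_right)
  qed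
  have smult: "v (chain_word s (xs[i := k \<odot> x])) = k \<odot>\<^bsub>W\<^esub> v (chain_word s (xs[i := x]))"
    if xs: "xs \<in> words A (Suc 1)" and i: "i < Suc 1" and k: "k \<in> carrier K" and x: "x \<in> carrier A"
    for s xs i k x
  proof -
    obtain a b where ab: "xs = [a, b]" "a \<in> carrier A" "b \<in> carrier A"
      using words_2E[of xs A] xs by auto
    have "i = 0 \<or> i = 1" using i by auto
    then show ?thesis using ab x k by (auto simp: val \<phi>.smult_left \<phi>.smult_right)
  qed
  show "linear_map K (one_chains K A) W (pres_map K W v)"
    unfolding one_chains_def by (rule chain_lift_linear[OF W closed add smult])
  show "pres_map K W v (one_chain K A s a b) = \<phi> s a b" if "a \<in> carrier A" "b \<in> carrier A"
    unfolding one_chain_def val[OF that, symmetric]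
    by (rule chain_lift_gen[OF W closed add smult]) (use that in \<open>simp_all add: chain_kinds_simps word_mem\<close>)
qed

lemma one_chains_lift_exists:
  assumes W: "module K W" and \<phi>: "bilinear_family K A W \<phi>"
  shows "\<exists>F. linear_map K (one_chains K A) W F \<and>
    (\<forall>s. \<forall>a\<in>carrier A. \<forall>b\<in>carrier A. F (one_chain K A s a b) = \<phi> s a b)"
proof -
  define v where "v w = (case w of Tens xs \<Rightarrow> \<phi> Odot (xs ! 0) (xs ! 1) | Circ xs \<Rightarrow> \<phi> Ast (xs ! 0) (xs ! 1))" for w
  have "v (chain_word s [a, b]) = \<phi> s a b" for s a b
    by (cases s) (simp_all add: v_def)
  then show ?thesis
    using one_chains_lift_linear[OF W \<phi>] one_chains_lift_gen[OF W \<phi>] by blast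
qed

end

text \<open>
  The map \<open>a \<otimes> b \<mapsto> ab\<close>, \<open>a \<circ> b \<mapsto> [a,b]\<close> is the boundary in degree 1, except that it takes values
  in the algebra and not in the presented copy of it that serves as the space of 0-chains.
\<close>

fun word_op :: "('k, 'a) awb \<Rightarrow> 'a chain_sym \<Rightarrow> 'a" where
  "word_op A (Tens xs) = awb_op A Odot (xs ! 0) (xs ! 1)"
| "word_op A (Circ xs) = awb_op A Ast (xs ! 0) (xs ! 1)"

definition one_diff :: "('k, 'z) ring_scheme \<Rightarrow> ('k, 'a) awb \<Rightarrow> ('a chain_sym \<Rightarrow> 'k) set \<Rightarrow> 'a"
  where "one_diff K A = pres_map K A (word_op A)"

text \<open>
  The boundaries of the generators of degree 2.
\<close>

fun rel_chain :: "('k, 'z) ring_scheme \<Rightarrow> ('k, 'a) awb \<Rightarrow> tensor_op \<Rightarrow> 'a \<Rightarrow> 'a \<Rightarrow> 'a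
    \<Rightarrow> ('a chain_sym \<Rightarrow> 'k) set" where
  "rel_chain K A Odot a b c =
    one_chain K A Odot (a \<otimes>\<^bsub>A\<^esub> b) c \<ominus>\<^bsub>one_chains K A\<^esub> one_chain K A Odot a (b \<otimes>\<^bsub>A\<^esub> c)"
| "rel_chain K A Ast a b c =
    (one_chain K A Odot (bracket A a c) b \<oplus>\<^bsub>one_chains K A\<^esub> one_chain K A Odot a (bracket A b c))
      \<ominus>\<^bsub>one_chains K A\<^esub> one_chain K A Ast (a \<otimes>\<^bsub>A\<^esub> b) c"

context awb_record
begin

lemma one_diff_linear: "linear_map K (one_chains K A) A (one_diff K A)"
  and one_diff_gen: "a \<in> carrier A \<Longrightarrow> b \<in> carrier A \<Longrightarrow>
    one_diff K A (one_chain K A s a b) = awb_op A s a b"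
proof -
  have val: "word_op A (chain_word s [a, b]) = awb_op A s a b" for s a b
    by (cases s) simp_all
  show "linear_map K (one_chains K A) A (one_diff K A)"
    unfolding one_diff_def
    by (rule one_chains_lift_linear[OF A.module_axioms awb_op_bilinear val])
  show "one_diff K A (one_chain K A s a b) = awb_op A s a b"
    if "a \<in> carrier A" "b \<in> carrier A"
    unfolding one_diff_def
    by (rule one_chains_lift_gen[OF A.module_axioms awb_op_bilinear val that])
qed

lemma zero_chain_linear: "linear_map K A (chains K A 0) (\<lambda>a. chain_gen K A 0 (Tens [a]))"
proof -
  interpret C: module K "chains K A 0" by (rule chains_module)
  have "s = Odot \<Longrightarrow> chain_word s = Tens" for s by simp
  then show ?thesis
    using chain_gen_add[of Odot 0 "[x]" 0 x for x] chain_gen_smult[of Odot 0 "[x]" 0 x for x]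
      chain_gen_closed[of Odot 0]
    by unfold_locales (auto simp: chain_kinds_simps word_mem)
qed

text \<open>
  The space of 0-chains is presented by words of length 1, and reading off the letter is a linear
  inverse of \<open>a \<mapsto> [a]\<close>.
\<close>

lemma zero_chain_inj:
  assumes a: "a \<in> carrier A" and 0: "chain_gen K A 0 (Tens [a]) = \<zero>\<^bsub>chains K A 0\<^esub>"
  shows "a = \<zero>"
proof -
  define v where "v w = (case w of Tens xs \<Rightarrow> xs ! 0 | Circ xs \<Rightarrow> xs ! 0)" for w :: "'a chain_sym"
  have val: "v (chain_word s [a]) = a" for s a
    by (cases s) (simp_all add: v_def)
  have closed: "v (chain_word s xs) \<in> carrier A" if "xs \<in> words A (Suc 0)" for s xs
    using words_1E[OF that] by (auto simp: val)
  have add: "v (chain_word s (xs[i := x \<oplus> y])) = v (chain_word s (xs[i := x])) \<oplus> v (chain_word s (xs[i := y]))"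
    if xs: "xs \<in> words A (Suc 0)" and i: "i < Suc 0" for s xs i x y
    using words_1E[OF xs] i by (auto simp: val)
  have smult: "v (chain_word s (xs[i := k \<odot> x])) = k \<odot> v (chain_word s (xs[i := x]))"
    if xs: "xs \<in> words A (Suc 0)" and i: "i < Suc 0" for s xs i k x
    using words_1E[OF xs] i by (auto simp: val)
  interpret ev: linear_map K "chains K A 0" A "pres_map K A v"
    by (rule chain_lift_linear[OF A.module_axioms closed add smult])
  have "pres_map K A v (chain_gen K A 0 (chain_word Odot [a])) = v (chain_word Odot [a])"
    by (rule chain_lift_gen[OF A.module_axioms closed add smult])
      (use a in \<open>simp_all add: chain_kinds_simps word_mem\<close>)
  then show ?thesis using ev.map_zero 0 val[of Odot] by simp
qed

lemma boundary_sym_1: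
  assumes "a \<in> carrier A" "b \<in> carrier A"
  shows "boundary_sym K A 1 (chain_word s [a, b]) = chain_gen K A 0 (Tens [awb_op A s a b])"
proof -
  interpret C: module K "chains K A 0" by (rule chains_module)
  have "chain_gen K A 0 (Tens [awb_op A s a b]) \<in> carrier (chains K A 0)" for s
    by (rule linear_map.map_closed[OF zero_chain_linear awb_op_closed[OF assms]])
  from this[of Odot] this[of Ast] show ?thesis
    by (cases s) (simp_all add: contract_def lessThan_Suc)
qed

lemma boundary_1_eq:
  assumes "z \<in> carrier (one_chains K A)"
  shows "boundary K A 1 z = chain_gen K A 0 (Tens [one_diff K A z])"
proof (rule one_chains_eqI[OF _ _ _ assms])
  note \<phi> = bilinear_family_comp[OF awb_op_bilinear zero_chain_linear]
  show "linear_map K (one_chains K A) (chains K A 0) (boundary K A 1)"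
    using one_chains_lift_linear[OF chains_module \<phi> boundary_sym_1]
    by (simp add: boundary_def)
  show "linear_map K (one_chains K A) (chains K A 0) (\<lambda>z. chain_gen K A 0 (Tens [one_diff K A z]))"
    by (rule linear_map.comp[OF one_diff_linear zero_chain_linear])
  show "boundary K A 1 (one_chain K A s a b) = chain_gen K A 0 (Tens [one_diff K A (one_chain K A s a b)])"
    if "a \<in> carrier A" "b \<in> carrier A" for s a b
    using one_chains_lift_gen[OF chains_module \<phi> boundary_sym_1 that] that
    by (simp add: boundary_def one_diff_gen)
qed

lemma cycles_1_eq:
  "a_kernel (chains K A 1) (chains K A 0) (boundary K A 1) = a_kernel (one_chains K A) A (one_diff K A)"
proof -
  interpret d: linear_map K "one_chains K A" A "one_diff K A" by (rule one_diff_linear)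
  show ?thesis
    unfolding a_kernel_def' one_chains_def[symmetric]
    using linear_map.map_zero[OF zero_chain_linear] zero_chain_inj boundary_1_eq d.map_closed
    by (auto simp del: One_nat_def)
qed

lemma boundary_sym_2:
  assumes "a \<in> carrier A" "b \<in> carrier A" "c \<in> carrier A"
  shows "boundary_sym K A 2 (chain_word s [a, b, c]) = rel_chain K A s a b c"
proof -
  interpret C: module K "one_chains K A" by (rule one_chains_module)
  interpret t: bilinear_family K A "one_chains K A" "one_chain K A" by (rule one_chain_bilinear)
  have two: "{..<2::nat} = {0, Suc 0}" "{..<Suc 0} = {0}" by auto
  have Tens: "chain_gen K A (Suc 0) (Tens [x, y]) = one_chain K A Odot x y"
    and Circ: "chain_gen K A (Suc 0) (Circ [x, y]) = one_chain K A Ast x y" for x y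
    by (simp_all add: one_chain_def)
  have C: "chains K A (Suc 0) = one_chains K A" by (simp add: one_chains_def)
  show ?thesis
    using assms
    by (cases s)
      (simp_all add: two contract_def Tens Circ C t.closed mult_closed bracket_closed a_minus_def
        C.smult_l_minus C.M.a_ac)
qed

lemma rel_chain_closed:
  assumes "a \<in> carrier A" "b \<in> carrier A" "c \<in> carrier A"
  shows "rel_chain K A s a b c \<in> carrier (one_chains K A)"
proof -
  interpret C: module K "one_chains K A" by (rule one_chains_module)
  interpret t: bilinear_family K A "one_chains K A" "one_chain K A" by (rule one_chain_bilinear)
  show ?thesis
    using assms by (cases s) (simp_all add: t.closed mult_closed bracket_closed)
qed

text \<open>
  By bilinearity of the operations and of the generators of degree 1, used to see that
  the boundary in degree 2 is well defined.
\<close>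

lemma rel_chain_trilinear:
  assumes "a \<in> carrier A" "b \<in> carrier A" "c \<in> carrier A" "x \<in> carrier A"
  shows "rel_chain K A s (a \<oplus> x) b c = rel_chain K A s a b c \<oplus>\<^bsub>one_chains K A\<^esub> rel_chain K A s x b c"
    "rel_chain K A s a (b \<oplus> x) c = rel_chain K A s a b c \<oplus>\<^bsub>one_chains K A\<^esub> rel_chain K A s a x c"
    "rel_chain K A s a b (c \<oplus> x) = rel_chain K A s a b c \<oplus>\<^bsub>one_chains K A\<^esub> rel_chain K A s a b x"
    "k \<in> carrier K \<Longrightarrow> rel_chain K A s (k \<odot> a) b c = k \<odot>\<^bsub>one_chains K A\<^esub> rel_chain K A s a b c"
    "k \<in> carrier K \<Longrightarrow> rel_chain K A s a (k \<odot> b) c = k \<odot>\<^bsub>one_chains K A\<^esub> rel_chain K A s a b c"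
    "k \<in> carrier K \<Longrightarrow> rel_chain K A s a b (k \<odot> c) = k \<odot>\<^bsub>one_chains K A\<^esub> rel_chain K A s a b c"
proof -
  interpret C: module K "one_chains K A" by (rule one_chains_module)
  interpret t: bilinear_family K A "one_chains K A" "one_chain K A" by (rule one_chain_bilinear)
  note add = mult_add_left mult_add_right bracket_add_left bracket_add_right t.add_left t.add_right
    t.closed mult_closed bracket_closed a_minus_def C.M.minus_add C.M.a_ac
  note smult = mult_smult_left mult_smult_right bracket_smult_left bracket_smult_right t.smult_left
    t.smult_right t.closed mult_closed bracket_closed a_minus_def C.smult_r_distr C.smult_r_minus
  show "rel_chain K A s (a \<oplus> x) b c = rel_chain K A s a b c \<oplus>\<^bsub>one_chains K A\<^esub> rel_chain K A s x b c"
    using assms by (cases s) (simp_all add: add)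
  show "rel_chain K A s a (b \<oplus> x) c = rel_chain K A s a b c \<oplus>\<^bsub>one_chains K A\<^esub> rel_chain K A s a x c"
    using assms by (cases s) (simp_all add: add)
  show "rel_chain K A s a b (c \<oplus> x) = rel_chain K A s a b c \<oplus>\<^bsub>one_chains K A\<^esub> rel_chain K A s a b x"
    using assms by (cases s) (simp_all add: add)
  show "rel_chain K A s (k \<odot> a) b c = k \<odot>\<^bsub>one_chains K A\<^esub> rel_chain K A s a b c" if "k \<in> carrier K"
    using assms that by (cases s) (simp_all add: smult)
  show "rel_chain K A s a (k \<odot> b) c = k \<odot>\<^bsub>one_chains K A\<^esub> rel_chain K A s a b c" if "k \<in> carrier K"
    using assms that by (cases s) (simp_all add: smult)
  show "rel_chain K A s a b (k \<odot> c) = k \<odot>\<^bsub>one_chains K A\<^esub> rel_chain K A s a b c" if "k \<in> carrier K"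
    using assms that by (cases s) (simp_all add: smult)
qed

lemma boundary_2:
  shows boundary_2_linear: "linear_map K (chains K A 2) (one_chains K A) (boundary K A 2)"
    and boundary_2_gen: "\<lbrakk>a \<in> carrier A; b \<in> carrier A; c \<in> carrier A\<rbrakk> \<Longrightarrow>
      boundary K A 2 (chain_gen K A 2 (chain_word s [a, b, c])) = rel_chain K A s a b c"
proof -
  let ?v = "boundary_sym K A 2"
  have closed: "?v (chain_word s xs) \<in> carrier (one_chains K A)" if "xs \<in> words A (Suc 2)" for s xs
    using words_3E[of xs A] that by (auto simp: numeral_2_eq_2[symmetric] boundary_sym_2 rel_chain_closed)
  have add: "?v (chain_word s (xs[i := x \<oplus> y])) =
      ?v (chain_word s (xs[i := x])) \<oplus>\<^bsub>one_chains K A\<^esub> ?v (chain_word s (xs[i := y]))"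
    if xs: "xs \<in> words A (Suc 2)" and i: "i < Suc 2" and x: "x \<in> carrier A" and y: "y \<in> carrier A"
    for s xs i x y
  proof -
    obtain a b c where abc: "xs = [a, b, c]" "a \<in> carrier A" "b \<in> carrier A" "c \<in> carrier A"
      using words_3E[of xs A] xs by (auto simp: numeral_2_eq_2)
    have "i = 0 \<or> i = 1 \<or> i = 2" using i by linarith
    then show ?thesis
      using abc x y
      by (elim disjE) (simp_all add: boundary_sym_2 rel_chain_trilinear)
  qed
  have smult: "?v (chain_word s (xs[i := k \<odot> x])) =
      k \<odot>\<^bsub>one_chains K A\<^esub> ?v (chain_word s (xs[i := x]))"
    if xs: "xs \<in> words A (Suc 2)" and i: "i < Suc 2" and k: "k \<in> carrier K" and x: "x \<in> carrier A"
    for s xs i k x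
  proof -
    obtain a b c where abc: "xs = [a, b, c]" "a \<in> carrier A" "b \<in> carrier A" "c \<in> carrier A"
      using words_3E[of xs A] xs by (auto simp: numeral_2_eq_2)
    have "i = 0 \<or> i = 1 \<or> i = 2" using i by linarith
    then show ?thesis
      using abc x k
      by (elim disjE) (simp_all add: boundary_sym_2 rel_chain_trilinear[where x = x])
  qed
  have one: "boundary K A 2 = pres_map K (one_chains K A) ?v"
    by (simp add: boundary_def one_chains_def)
  show "linear_map K (chains K A 2) (one_chains K A) (boundary K A 2)"
    unfolding one by (rule chain_lift_linear[OF one_chains_module closed add smult])
  show "boundary K A 2 (chain_gen K A 2 (chain_word s [a, b, c])) = rel_chain K A s a b c"
    if abc: "a \<in> carrier A" "b \<in> carrier A" "c \<in> carrier A"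
    unfolding one boundary_sym_2[OF abc, symmetric]
    by (rule chain_lift_gen[OF one_chains_module closed add smult])
      (use abc in \<open>simp_all add: numeral_2_eq_2 chain_kinds_simps word_mem\<close>)
qed

lemma one_boundaries_eq: "one_boundaries K A = boundary K A 2 ` carrier (chains K A 2)"
  by (simp add: one_boundaries_def boundaries_def numeral_2_eq_2)

lemma one_boundaries_submodule: "submodule (one_boundaries K A) K (one_chains K A)"
  unfolding one_boundaries_eq by (rule linear_map.image_submodule[OF boundary_2_linear])

lemma rel_chain_boundary:
  assumes "a \<in> carrier A" "b \<in> carrier A" "c \<in> carrier A"
  shows "rel_chain K A s a b c \<in> one_boundaries K A"
  unfolding one_boundaries_eq boundary_2_gen[OF assms, symmetric]
  using assms by (intro imageI chain_gen_closed) (simp_all add: numeral_2_eq_2 chain_kinds_simps word_mem)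

lemma one_boundaries_vanish:
  assumes F: "linear_map K (one_chains K A) W F"
    and rel: "\<And>s a b c. \<lbrakk>a \<in> carrier A; b \<in> carrier A; c \<in> carrier A\<rbrakk> \<Longrightarrow>
      F (rel_chain K A s a b c) = \<zero>\<^bsub>W\<^esub>"
    and z: "z \<in> one_boundaries K A"
  shows "F z = \<zero>\<^bsub>W\<^esub>"
proof -
  interpret FB: linear_map K "chains K A 2" W "\<lambda>z. F (boundary K A 2 z)"
    by (rule linear_map.comp[OF boundary_2_linear F])
  obtain y where y: "y \<in> carrier (chains K A 2)" "z = boundary K A 2 y"
    using z by (auto simp: one_boundaries_eq)
  have "y \<in> a_kernel (chains K A 2) W (\<lambda>z. F (boundary K A 2 z))"
    using FB.kernel_submodule _ y(1)
  proof (rule chain_span)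
    fix s xs assume s: "s \<in> chain_kinds 2" and xs: "xs \<in> words A (Suc 2)"
    then obtain a b c where "xs = [a, b, c]" "a \<in> carrier A" "b \<in> carrier A" "c \<in> carrier A"
      using words_3E[of xs A] by (auto simp: numeral_2_eq_2)
    then show "chain_gen K A 2 (chain_word s xs) \<in> a_kernel (chains K A 2) W (\<lambda>z. F (boundary K A 2 z))"
      using chain_gen_closed[OF s xs] by (simp add: a_kernel_def' boundary_2_gen rel)
  qed
  then show ?thesis using y by (simp add: a_kernel_def')
qed

lemma rel_chain_bar_family:
  assumes W: "module K W" and \<phi>: "bar_family K A W \<phi>" and F: "linear_map K (one_chains K A) W F"
    and val: "\<And>s a b. a \<in> carrier A \<Longrightarrow> b \<in> carrier A \<Longrightarrow> F (one_chain K A s a b) = \<phi> s a b"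
    and abc: "a \<in> carrier A" "b \<in> carrier A" "c \<in> carrier A"
  shows "F (rel_chain K A s a b c) = \<zero>\<^bsub>W\<^esub>"
proof -
  interpret W: module K W by fact
  interpret \<phi>: bar_family K A W \<phi> by fact
  interpret F: linear_map K "one_chains K A" W F by fact
  interpret t: bilinear_family K A "one_chains K A" "one_chain K A" by (rule one_chain_bilinear)
  show ?thesis
    using abc
    by (cases s)
      (simp_all add: F.map_minus F.map_add val t.closed \<phi>.closed mult_closed bracket_closed
        W.minus_eq_zero_iff \<phi>.assoc \<phi>.deriv)
qed

end

text \<open>
  The cokernel \<open>T(A)\<close> of \<open>d\<^sub>2\<close>. Unlike first homology, which is the kernel of the induced map
  \<open>T(A) \<rightarrow> A\<close>, it has a presentation and therefore a universal property.
\<close>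

definition one_coker :: "('k, 'z) ring_scheme \<Rightarrow> ('k, 'a) awb \<Rightarrow> ('k, ('a chain_sym \<Rightarrow> 'k) set set) module"
  where "one_coker K A = quot_mod (one_chains K A) (one_boundaries K A)"

text \<open>
  The classes of \<open>a \<otimes> b\<close> and \<open>a \<circ> b\<close> in \<open>T(A)\<close>.
\<close>

definition bar :: "('k, 'z) ring_scheme \<Rightarrow> ('k, 'a) awb \<Rightarrow> tensor_op \<Rightarrow> 'a \<Rightarrow> 'a
    \<Rightarrow> ('a chain_sym \<Rightarrow> 'k) set set"
  where "bar K A s a b = one_boundaries K A +>\<^bsub>one_chains K A\<^esub> one_chain K A s a b"

definition coker_diff :: "('k, 'z) ring_scheme \<Rightarrow> ('k, 'a) awb \<Rightarrow> ('a chain_sym \<Rightarrow> 'k) set set \<Rightarrow> 'a"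
  where "coker_diff K A X = the_elem (one_diff K A ` X)"

lemma (in bilinear_family) zero_left:
  assumes "module K A" "module K W" "b \<in> carrier A"
  shows "\<phi> s \<zero> b = \<zero>\<^bsub>W\<^esub>"
proof -
  interpret A: module K A by fact
  interpret W: module K W by fact
  show ?thesis
    using smult_left[of "\<zero>\<^bsub>K\<^esub>" "\<zero>" b s] closed[of "\<zero>" b s] assms(3) by simp
qed

lemma (in bilinear_family) zero_right:
  assumes "module K A" "module K W" "a \<in> carrier A"
  shows "\<phi> s a \<zero> = \<zero>\<^bsub>W\<^esub>"
proof -
  interpret A: module K A by fact
  interpret W: module K W by fact
  show ?thesis
    using smult_right[of "\<zero>\<^bsub>K\<^esub>" a "\<zero>" s] closed[of a "\<zero>" s] assms(3) by simp
qed

lemma bar_family_comp: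
  assumes \<phi>: "bar_family K A W \<phi>" and F: "linear_map K W W' F" and A: "awb_record K A"
  shows "bar_family K A W' (\<lambda>s a b. F (\<phi> s a b))"
proof -
  interpret A: awb_record K A by fact
  interpret \<phi>: bar_family K A W \<phi> by fact
  interpret F: linear_map K W W' F by fact
  interpret B: bilinear_family K A W' "\<lambda>s a b. F (\<phi> s a b)"
    by (rule bilinear_family_comp[OF \<phi>.bilinear_family_axioms F])
  show ?thesis
    by unfold_locales
      (simp_all add: \<phi>.assoc \<phi>.deriv \<phi>.closed F.map_add A.mult_closed A.bracket_closed)
qed

context awb_record
begin

lemma one_coker_module: "module K (one_coker K A)"
  unfolding one_coker_def
  by (rule module.quot_mod_module[OF one_chains_module one_boundaries_submodule])

lemma one_coker_proj_linear:
  "linear_map K (one_chains K A) (one_coker K A)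
    (\<lambda>z. one_boundaries K A +>\<^bsub>one_chains K A\<^esub> z)"
  unfolding one_coker_def
  by (rule module.quot_proj_linear[OF one_chains_module one_boundaries_submodule])

lemma one_coker_carrier:
  "carrier (one_coker K A) =
    (\<lambda>z. one_boundaries K A +>\<^bsub>one_chains K A\<^esub> z) ` carrier (one_chains K A)"
  unfolding one_coker_def by (rule module.quot_mod_carrier[OF one_chains_module])

lemma bar_bar_family: "bar_family K A (one_coker K A) (bar K A)"
proof -
  interpret C: module K "one_chains K A" by (rule one_chains_module)
  interpret t: bilinear_family K A "one_chains K A" "one_chain K A" by (rule one_chain_bilinear)
  interpret p: linear_map K "one_chains K A" "one_coker K A"
    "\<lambda>z. one_boundaries K A +>\<^bsub>one_chains K A\<^esub> z"
    by (rule one_coker_proj_linear)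
  interpret B: bilinear_family K A "one_coker K A" "bar K A"
    using bilinear_family_comp[OF t.bilinear_family_axioms p.linear_map_axioms]
    by (simp add: bar_def[abs_def])
  show ?thesis
  proof
    fix a b c assume abc: "a \<in> carrier A" "b \<in> carrier A" "c \<in> carrier A"
    note eq = C.coset_eq_iff[OF one_boundaries_submodule]
    show "bar K A Odot (a \<otimes> b) c = bar K A Odot a (b \<otimes> c)"
      using rel_chain_boundary[OF abc, of Odot] abc
      by (simp add: bar_def eq t.closed mult_closed)
    have "bar K A Odot (bracket A a c) b \<oplus>\<^bsub>one_coker K A\<^esub> bar K A Odot a (bracket A b c) =
      one_boundaries K A +>\<^bsub>one_chains K A\<^esub>
        (one_chain K A Odot (bracket A a c) b \<oplus>\<^bsub>one_chains K A\<^esub> one_chain K A Odot a (bracket A b c))"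
      using abc by (simp add: bar_def p.map_add t.closed bracket_closed)
    also have "\<dots> = bar K A Ast (a \<otimes> b) c"
      using rel_chain_boundary[OF abc, of Ast] abc
      unfolding bar_def by (subst eq) (simp_all add: t.closed mult_closed bracket_closed)
    finally show "bar K A Ast (a \<otimes> b) c =
        bar K A Odot (bracket A a c) b \<oplus>\<^bsub>one_coker K A\<^esub> bar K A Odot a (bracket A b c)" by simp
  qed
qed

lemma bar_closed: "a \<in> carrier A \<Longrightarrow> b \<in> carrier A \<Longrightarrow> bar K A s a b \<in> carrier (one_coker K A)"
  by (rule bilinear_family.closed[OF bar_family.axioms(1)[OF bar_bar_family]])

lemma one_coker_span:
  assumes U: "submodule U K (one_coker K A)"
    and gen: "\<And>s a b. a \<in> carrier A \<Longrightarrow> b \<in> carrier A \<Longrightarrow> bar K A s a b \<in> U"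
    and X: "X \<in> carrier (one_coker K A)"
  shows "X \<in> U"
proof -
  interpret t: bilinear_family K A "one_chains K A" "one_chain K A" by (rule one_chain_bilinear)
  obtain z where z: "z \<in> carrier (one_chains K A)" "X = one_boundaries K A +>\<^bsub>one_chains K A\<^esub> z"
    using X by (auto simp: one_coker_carrier)
  have "z \<in> {z \<in> carrier (one_chains K A). one_boundaries K A +>\<^bsub>one_chains K A\<^esub> z \<in> U}"
    using linear_map.preimage_submodule[OF one_coker_proj_linear U] _ z(1)
    by (rule one_chains_span) (use gen t.closed in \<open>auto simp: bar_def\<close>)
  then show ?thesis using z by simp
qed

lemma one_coker_eqI:
  assumes f: "linear_map K (one_coker K A) W f" and g: "linear_map K (one_coker K A) W g"
    and eq: "\<And>s a b. a \<in> carrier A \<Longrightarrow> b \<in> carrier A \<Longrightarrow> f (bar K A s a b) = g (bar K A s a b)"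
    and X: "X \<in> carrier (one_coker K A)"
  shows "f X = g X"
proof -
  obtain z where z: "z \<in> carrier (one_chains K A)" "X = one_boundaries K A +>\<^bsub>one_chains K A\<^esub> z"
    using X by (auto simp: one_coker_carrier)
  have "f (one_boundaries K A +>\<^bsub>one_chains K A\<^esub> z) = g (one_boundaries K A +>\<^bsub>one_chains K A\<^esub> z)"
    using linear_map.comp[OF one_coker_proj_linear f] linear_map.comp[OF one_coker_proj_linear g] _ z(1)
    by (rule one_chains_eqI) (use eq in \<open>simp add: bar_def\<close>)
  then show ?thesis using z by simp
qed

lemma
  assumes W: "module K W" and \<phi>: "bar_family K A W \<phi>" and F: "linear_map K (one_chains K A) W F"
    and val: "\<And>s a b. a \<in> carrier A \<Longrightarrow> b \<in> carrier A \<Longrightarrow> F (one_chain K A s a b) = \<phi> s a b"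
  shows one_coker_lift_linear: "linear_map K (one_coker K A) W (\<lambda>X. the_elem (F ` X))"
    and one_coker_lift_coset: "z \<in> carrier (one_chains K A) \<Longrightarrow>
      the_elem (F ` (one_boundaries K A +>\<^bsub>one_chains K A\<^esub> z)) = F z"
    and one_coker_lift_bar: "a \<in> carrier A \<Longrightarrow> b \<in> carrier A \<Longrightarrow> the_elem (F ` bar K A s a b) = \<phi> s a b"
proof -
  interpret F: linear_map K "one_chains K A" W F by fact
  interpret t: bilinear_family K A "one_chains K A" "one_chain K A" by (rule one_chain_bilinear)
  have 0: "F z = \<zero>\<^bsub>W\<^esub>" if "z \<in> one_boundaries K A" for z
    by (rule one_boundaries_vanish[OF F rel_chain_bar_family[OF W \<phi> F val] that])
  show "linear_map K (one_coker K A) W (\<lambda>X. the_elem (F ` X))"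
    unfolding one_coker_def by (rule F.quot_lift_linear[OF one_boundaries_submodule 0])
  show *: "the_elem (F ` (one_boundaries K A +>\<^bsub>one_chains K A\<^esub> z)) = F z"
    if "z \<in> carrier (one_chains K A)" for z
    by (rule F.quot_lift_coset[OF one_boundaries_submodule 0 that])
  show "the_elem (F ` bar K A s a b) = \<phi> s a b" if "a \<in> carrier A" "b \<in> carrier A"
    using *[OF t.closed[OF that]] val[OF that] by (simp add: bar_def)
qed

lemma one_coker_lift_exists:
  assumes W: "module K W" and \<phi>: "bar_family K A W \<phi>"
  shows "\<exists>F. linear_map K (one_coker K A) W F \<and>
    (\<forall>s. \<forall>a\<in>carrier A. \<forall>b\<in>carrier A. F (bar K A s a b) = \<phi> s a b)"
proof -
  obtain F where F: "linear_map K (one_chains K A) W F"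
      "\<And>s a b. a \<in> carrier A \<Longrightarrow> b \<in> carrier A \<Longrightarrow> F (one_chain K A s a b) = \<phi> s a b"
    using one_chains_lift_exists[OF W bar_family.axioms(1)[OF \<phi>]] by blast
  show ?thesis
    using one_coker_lift_linear[OF W \<phi> F] one_coker_lift_bar[OF W \<phi> F] by blast
qed

lemma coker_diff_linear: "linear_map K (one_coker K A) A (coker_diff K A)"
  using one_coker_lift_linear[OF A.module_axioms awb_op_bar_family one_diff_linear one_diff_gen]
  by (simp add: coker_diff_def[abs_def])

lemma coker_diff_bar:
  "a \<in> carrier A \<Longrightarrow> b \<in> carrier A \<Longrightarrow> coker_diff K A (bar K A s a b) = awb_op A s a b"
  unfolding coker_diff_def
  by (rule one_coker_lift_bar[OF A.module_axioms awb_op_bar_family one_diff_linear one_diff_gen])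

lemma homology_1_eq:
  "homology K A 1 = (one_coker K A)\<lparr>carrier := a_kernel (one_coker K A) A (coker_diff K A)\<rparr>"
proof -
  have d: "coker_diff K A (one_boundaries K A +>\<^bsub>one_chains K A\<^esub> z) = one_diff K A z"
    if "z \<in> carrier (one_chains K A)" for z
    unfolding coker_diff_def
    by (rule one_coker_lift_coset[OF A.module_axioms awb_op_bar_family one_diff_linear one_diff_gen that])
  have "homology K A 1 = quot_mod ((one_chains K A)\<lparr>carrier := a_kernel (one_chains K A) A (one_diff K A)\<rparr>)
      (one_boundaries K A)"
    using cycles_1_eq
    by (simp add: homology_def cycles_def one_boundaries_def one_chains_def)
  also have "\<dots> = (one_coker K A)\<lparr>carrier :=
      (\<lambda>z. one_boundaries K A +>\<^bsub>one_chains K A\<^esub> z) ` a_kernel (one_chains K A) A (one_diff K A)\<rparr>"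
    by (simp add: quot_mod_restrict one_coker_def)
  also have "(\<lambda>z. one_boundaries K A +>\<^bsub>one_chains K A\<^esub> z) ` a_kernel (one_chains K A) A (one_diff K A) =
      a_kernel (one_coker K A) A (coker_diff K A)"
    by (auto simp: a_kernel_def' one_coker_carrier d)
  finally show ?thesis .
qed

end

section \<open>The quotient by a two-sided ideal\<close>

locale awb_with_ideal = awb_record K A for K :: "('k, 'z) ring_scheme" and A :: "('k, 'a) awb" (structure) +
  fixes M :: "'a set"
  assumes ideal: "awb_ideal K A M"
begin

abbreviation Q where "Q \<equiv> awb_quot A M"
abbreviation q where "q \<equiv> \<lambda>a. M +> a"

lemma ideal_submodule: "submodule M K A"
  using ideal by (rule awb_ideal.axioms(1))

lemma ideal_mem_carrier: "m \<in> M \<Longrightarrow> m \<in> carrier A"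
  by (rule A.submodule_mem_carrier[OF ideal_submodule])

lemma ideal_op_left: "a \<in> carrier A \<Longrightarrow> m \<in> M \<Longrightarrow> awb_op A s a m \<in> M"
  by (cases s) (simp_all add: awb_ideal.ideal_mult_left[OF ideal] awb_ideal.ideal_bracket_left[OF ideal])

lemma ideal_op_right: "a \<in> carrier A \<Longrightarrow> m \<in> M \<Longrightarrow> awb_op A s m a \<in> M"
  by (cases s) (simp_all add: awb_ideal.ideal_mult_right[OF ideal] awb_ideal.ideal_bracket_right[OF ideal])

lemma quot_fields:
  "carrier Q = carrier (quot_mod A M)" "add Q = set_add A" "zero Q = M" "smult Q = quot_smult A M"
  by (simp_all add: awb_quot_def quot_mod_def)

lemma quot_carrier: "carrier Q = q ` carrier A"
  by (simp add: quot_fields A.quot_mod_carrier)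

lemma quot_module: "module K Q"
  using A.quot_mod_module[OF ideal_submodule]
  by (subst module_cong[where V = "quot_mod A M"]) (simp_all add: quot_fields)

text \<open>
  The operations of the quotient are unions over all representatives \<open>x\<close>, \<open>y\<close>. They do not depend
  on the representatives because \<open>x \<star> y - a \<star> b = (x - a) \<star> y + a \<star> (y - b)\<close> lies in the ideal for
  either operation \<open>\<star>\<close>.
\<close>

lemma quot_op:
  assumes a: "a \<in> carrier A" and b: "b \<in> carrier A"
  shows "awb_op Q s (q a) (q b) = q (awb_op A s a b)"
proof -
  interpret op: bilinear_family K A A "awb_op A" by (rule awb_op_bilinear)
  have eq: "q (awb_op A s x y) = q (awb_op A s a b)" if x: "x \<in> q a" and y: "y \<in> q b" for x y
  proof -
    note cl = A.coset_subset[OF ideal_submodule]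
    have xc: "x \<in> carrier A" and yc: "y \<in> carrier A" using cl[OF a] cl[OF b] x y by auto
    have dx: "x \<ominus> a \<in> M" and dy: "y \<ominus> b \<in> M"
      using A.coset_mem_iff[OF ideal_submodule] x y xc yc a b by auto
    have neg: "awb_op A s (\<ominus> a) y = \<ominus> awb_op A s a y" "awb_op A s a (\<ominus> b) = \<ominus> awb_op A s a b"
      using op.add_left[of "\<ominus> a" a y s] op.add_right[of a "\<ominus> b" b s] a b yc
        op.zero_left[OF A.module_axioms A.module_axioms yc, of s]
        op.zero_right[OF A.module_axioms A.module_axioms a, of s]
      by (simp_all add: A.M.l_neg A.M.minus_equality awb_op_closed)
    have "awb_op A s x y \<ominus> awb_op A s a b = awb_op A s (x \<ominus> a) y \<oplus> awb_op A s a (y \<ominus> b)"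
      using a b xc yc
      by (simp add: a_minus_def op.add_left op.add_right neg awb_op_closed A.M.a_assoc A.M.r_neg2
          A.M.r_neg1)
    also have "\<dots> \<in> M"
      using A.submoduleE(5)[OF ideal_submodule ideal_op_right[OF yc dx] ideal_op_left[OF a dy]] .
    finally show ?thesis
      using A.coset_eq_iff[OF ideal_submodule] a b xc yc by (simp add: awb_op_closed)
  qed
  have ne: "q a \<noteq> {}" "q b \<noteq> {}" using A.coset_self[OF ideal_submodule] a b by auto
  have "awb_op Q s (q a) (q b) = (\<Union>x\<in>q a. \<Union>y\<in>q b. q (awb_op A s x y))"
    by (cases s) (simp_all add: awb_quot_def rcoset_mult_def)
  also have "\<dots> = q (awb_op A s a b)"
    using ne eq by (intro SUP_eq_const) blast+
  finally show ?thesis .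
qed

lemmas quot_mult = quot_op[of _ _ Odot, simplified]
lemmas quot_bracket = quot_op[of _ _ Ast, simplified]

lemma quot_proj_linear: "linear_map K A Q q"
proof -
  interpret Q: module K Q by (rule quot_module)
  show ?thesis
    by unfold_locales
      (auto simp: quot_carrier quot_fields A.coset_add[OF ideal_submodule]
        A.coset_smult[OF ideal_submodule])
qed

lemma quot_awb: "awb_record K Q"
proof -
  interpret Q: module K Q by (rule quot_module)
  interpret q: linear_map K A Q q by (rule quot_proj_linear)
  note simps = quot_mult quot_bracket q.map_add[symmetric] q.map_smult[symmetric] mult_closed
    bracket_closed
  have Qcl: "X \<otimes>\<^bsub>Q\<^esub> Y \<in> carrier Q" "bracket Q X Y \<in> carrier Q" if "X \<in> carrier Q" "Y \<in> carrier Q" for X Y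
    using that by (auto simp: quot_carrier simps)
  show ?thesis
    unfolding awb_record_def
  proof
    fix X Y Z assume "X \<in> carrier Q" "Y \<in> carrier Q" "Z \<in> carrier Q"
    then obtain x y z where xyz: "x \<in> carrier A" "y \<in> carrier A" "z \<in> carrier A"
      and XYZ: "X = q x" "Y = q y" "Z = q z"
      by (auto simp: quot_carrier)
    show "(X \<otimes>\<^bsub>Q\<^esub> Y) \<otimes>\<^bsub>Q\<^esub> Z = X \<otimes>\<^bsub>Q\<^esub> (Y \<otimes>\<^bsub>Q\<^esub> Z)"
      unfolding XYZ using xyz by (simp add: simps mult_assoc)
    show "(X \<oplus>\<^bsub>Q\<^esub> Y) \<otimes>\<^bsub>Q\<^esub> Z = X \<otimes>\<^bsub>Q\<^esub> Z \<oplus>\<^bsub>Q\<^esub> Y \<otimes>\<^bsub>Q\<^esub> Z"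
      unfolding XYZ using xyz by (simp add: simps mult_add_left)
    show "X \<otimes>\<^bsub>Q\<^esub> (Y \<oplus>\<^bsub>Q\<^esub> Z) = X \<otimes>\<^bsub>Q\<^esub> Y \<oplus>\<^bsub>Q\<^esub> X \<otimes>\<^bsub>Q\<^esub> Z"
      unfolding XYZ using xyz by (simp add: simps mult_add_right)
    show "bracket Q (X \<oplus>\<^bsub>Q\<^esub> Y) Z = bracket Q X Z \<oplus>\<^bsub>Q\<^esub> bracket Q Y Z"
      unfolding XYZ using xyz by (simp add: simps bracket_add_left)
    show "bracket Q X (Y \<oplus>\<^bsub>Q\<^esub> Z) = bracket Q X Y \<oplus>\<^bsub>Q\<^esub> bracket Q X Z"
      unfolding XYZ using xyz by (simp add: simps bracket_add_right)
    show "bracket Q (X \<otimes>\<^bsub>Q\<^esub> Y) Z = bracket Q X Z \<otimes>\<^bsub>Q\<^esub> Y \<oplus>\<^bsub>Q\<^esub> X \<otimes>\<^bsub>Q\<^esub> bracket Q Y Z"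
      unfolding XYZ using xyz by (simp add: simps bracket_mult)
  next
    fix k X Y assume k: "k \<in> carrier K" and "X \<in> carrier Q" "Y \<in> carrier Q"
    then obtain x y where xy: "x \<in> carrier A" "y \<in> carrier A" and XY: "X = q x" "Y = q y"
      by (auto simp: quot_carrier)
    show "(k \<odot>\<^bsub>Q\<^esub> X) \<otimes>\<^bsub>Q\<^esub> Y = k \<odot>\<^bsub>Q\<^esub> (X \<otimes>\<^bsub>Q\<^esub> Y)"
      unfolding XY using xy k by (simp add: simps mult_smult_left)
    show "X \<otimes>\<^bsub>Q\<^esub> (k \<odot>\<^bsub>Q\<^esub> Y) = k \<odot>\<^bsub>Q\<^esub> (X \<otimes>\<^bsub>Q\<^esub> Y)"
      unfolding XY using xy k by (simp add: simps mult_smult_right)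
    show "bracket Q (k \<odot>\<^bsub>Q\<^esub> X) Y = k \<odot>\<^bsub>Q\<^esub> bracket Q X Y"
      unfolding XY using xy k by (simp add: simps bracket_smult_left)
    show "bracket Q X (k \<odot>\<^bsub>Q\<^esub> Y) = k \<odot>\<^bsub>Q\<^esub> bracket Q X Y"
      unfolding XY using xy k by (simp add: simps bracket_smult_right)
  qed (simp_all add: Qcl)
qed

lemma bilinear_family_pullback:
  assumes "bilinear_family K Q W \<phi>"
  shows "bilinear_family K A W (\<lambda>s a b. \<phi> s (q a) (q b))"
proof -
  interpret \<phi>: bilinear_family K Q W \<phi> by fact
  interpret q: linear_map K A Q q by (rule quot_proj_linear)
  show ?thesis
    by unfold_locales
      (simp_all add: q.map_closed q.map_add q.map_smult \<phi>.closed \<phi>.add_left \<phi>.add_right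
        \<phi>.smult_left \<phi>.smult_right)
qed

lemma bar_family_pullback:
  assumes "bar_family K Q W \<phi>"
  shows "bar_family K A W (\<lambda>s a b. \<phi> s (q a) (q b))"
proof -
  interpret \<phi>: bar_family K Q W \<phi> by fact
  interpret q: linear_map K A Q q by (rule quot_proj_linear)
  interpret B: bilinear_family K A W "\<lambda>s a b. \<phi> s (q a) (q b)"
    by (rule bilinear_family_pullback[OF \<phi>.bilinear_family_axioms])
  show ?thesis
    by unfold_locales
      (simp_all add: q.map_closed quot_mult[symmetric] quot_bracket[symmetric] \<phi>.assoc \<phi>.deriv)
qed

text \<open>
  The formula for the map induced in first homology makes sense for the coset of any 1-chain, and
  so defines a map \<open>T(A) \<rightarrow> T(A/M)\<close> between the cokernels.
\<close>

definition coker_proj :: "('a chain_sym \<Rightarrow> 'k) set set \<Rightarrow> ('a set chain_sym \<Rightarrow> 'k) set set"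
  where "coker_proj = homology_map K Q q 1"

lemma coker_proj_linear: "linear_map K (one_coker K A) (one_coker K Q) coker_proj"
  and coker_proj_bar: "a \<in> carrier A \<Longrightarrow> b \<in> carrier A \<Longrightarrow>
    coker_proj (bar K A s a b) = bar K Q s (q a) (q b)"
proof -
  interpret Q: awb_record K Q by (rule quot_awb)
  let ?p = "chain_map K Q q 1" and ?F = "\<lambda>z. one_boundaries K Q +>\<^bsub>one_chains K Q\<^esub> chain_map K Q q 1 z"
  note \<phi> = bilinear_family_pullback[OF Q.one_chain_bilinear]
  have p: "?p = pres_map K (one_chains K Q) (\<lambda>w. chain_gen K Q 1 (map_chain_sym q w))"
    by (simp add: chain_map_def one_chains_def)
  have val: "chain_gen K Q 1 (map_chain_sym q (chain_word s [a, b])) = one_chain K Q s (q a) (q b)" for s a b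
    by (cases s) (simp_all add: one_chain_def)
  have p_lin: "linear_map K (one_chains K A) (one_chains K Q) ?p"
    unfolding p by (rule one_chains_lift_linear[OF Q.one_chains_module \<phi> val])
  have p_gen: "?p (one_chain K A s a b) = one_chain K Q s (q a) (q b)"
    if "a \<in> carrier A" "b \<in> carrier A" for s a b
    unfolding p by (rule one_chains_lift_gen[OF Q.one_chains_module \<phi> val that])
  have F_gen: "?F (one_chain K A s a b) = bar K Q s (q a) (q b)"
    if "a \<in> carrier A" "b \<in> carrier A" for s a b
    by (simp only: p_gen[OF that] bar_def)
  note F = Q.one_coker_module bar_family_pullback[OF Q.bar_bar_family]
    linear_map.comp[OF p_lin Q.one_coker_proj_linear] F_gen
  have eq: "coker_proj = (\<lambda>X. the_elem (?F ` X))"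
    unfolding coker_proj_def homology_map_def[abs_def] cycles_def coset_update_carrier
      one_boundaries_def one_chains_def ..
  show "linear_map K (one_coker K A) (one_coker K Q) coker_proj"
    unfolding eq by (rule one_coker_lift_linear[OF F])
  show "coker_proj (bar K A s a b) = bar K Q s (q a) (q b)"
    if "a \<in> carrier A" "b \<in> carrier A"
    unfolding eq by (rule one_coker_lift_bar[OF F that])
qed

lemma coker_proj_surj: "coker_proj ` carrier (one_coker K A) = carrier (one_coker K Q)"
proof
  interpret Q: awb_record K Q by (rule quot_awb)
  interpret p: linear_map K "one_coker K A" "one_coker K Q" coker_proj by (rule coker_proj_linear)
  show "coker_proj ` carrier (one_coker K A) \<subseteq> carrier (one_coker K Q)"
    using p.map_closed by blast
  show "carrier (one_coker K Q) \<subseteq> coker_proj ` carrier (one_coker K A)"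
  proof (rule subsetI, rule Q.one_coker_span[OF p.image_submodule])
    fix s X Y assume "X \<in> carrier Q" "Y \<in> carrier Q"
    then show "bar K Q s X Y \<in> coker_proj ` carrier (one_coker K A)"
      using bar_closed coker_proj_bar[symmetric] by (auto simp: quot_carrier)
  qed
qed

lemma coker_diff_proj:
  assumes "X \<in> carrier (one_coker K A)"
  shows "coker_diff K Q (coker_proj X) = q (coker_diff K A X)"
proof (rule one_coker_eqI[OF _ _ _ assms])
  interpret Q: awb_record K Q by (rule quot_awb)
  interpret q: linear_map K A Q q by (rule quot_proj_linear)
  show "linear_map K (one_coker K A) Q (\<lambda>X. coker_diff K Q (coker_proj X))"
    by (rule linear_map.comp[OF coker_proj_linear Q.coker_diff_linear])
  show "linear_map K (one_coker K A) Q (\<lambda>X. q (coker_diff K A X))"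
    by (rule linear_map.comp[OF coker_diff_linear quot_proj_linear])
  show "coker_diff K Q (coker_proj (bar K A s a b)) = q (coker_diff K A (bar K A s a b))"
    if "a \<in> carrier A" "b \<in> carrier A" for s a b
    using that by (simp add: coker_proj_bar coker_diff_bar Q.coker_diff_bar q.map_closed quot_op)
qed

end

section \<open>The non-abelian tensor product of an ideal with the algebra\<close>

context awb_with_ideal
begin

abbreviation MA where "MA \<equiv> A\<lparr>carrier := M\<rparr>"

lemma ideal_module: "module K MA"
  by (rule submodule.submodule_is_module[OF ideal_submodule A.module_axioms])

text \<open>
  A bar family \<open>\<phi>\<close> on \<open>A\<close> gives values to all four families of symbols: \<open>m \<star> a\<close> and \<open>a \<star> m\<close> are
  treated as the generators of \<open>T(A)\<close> with the same entries.
\<close>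

fun sym_val :: "(tensor_op \<Rightarrow> 'a \<Rightarrow> 'a \<Rightarrow> 'w) \<Rightarrow> ('a, 'a) tensor_sym \<Rightarrow> 'w" where
  "sym_val \<phi> (MN s m a) = \<phi> s m a"
| "sym_val \<phi> (NM s a m) = \<phi> s a m"

abbreviation syms where "syms \<equiv> tensor_syms MA A"
abbreviation rels where "rels \<equiv> tensor_rels K MA A (own_action A) (own_action A)"

lemma MN_mem: "m \<in> M \<Longrightarrow> a \<in> carrier A \<Longrightarrow> MN s m a \<in> syms"
  and NM_mem: "m \<in> M \<Longrightarrow> a \<in> carrier A \<Longrightarrow> NM s a m \<in> syms"
  by (auto simp: tensor_syms_def)

lemma syms_cases:
  assumes "g \<in> syms"
  obtains (MN) s m a where "m \<in> M" "a \<in> carrier A" "g = MN s m a"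
  | (NM) s m a where "m \<in> M" "a \<in> carrier A" "g = NM s a m"
  using assms by (auto simp: tensor_syms_def)

lemma sym_M_own: "sym_M (own_action A) g = sym_val (awb_op A) g"
  and sym_N_own: "sym_N (own_action A) g = sym_val (awb_op A) g"
  by (cases g; rename_tac s x y; case_tac s; simp add: own_action_def)+

lemma bilinear_rels_respected:
  assumes L: "linear_map K F W L" and \<phi>: "bilinear_family K A W \<phi>"
    and PA: "carrier P \<subseteq> carrier A" "add P = add A" "smult P = smult A"
    and RA: "carrier R \<subseteq> carrier A" "add R = add A" "smult R = smult A"
    and P: "module K P" and R: "module K R"
    and pq: "\<And>s p q. p \<in> carrier P \<Longrightarrow> q \<in> carrier R \<Longrightarrow>
      pq s p q \<in> carrier F \<and> L (pq s p q) = \<phi> s p q"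
    and lr: "(l, r) \<in> bilinear_rels K F P R pq"
  shows "l \<in> carrier F \<and> r \<in> carrier F \<and> L l = L r"
proof -
  interpret L: linear_map K F W L by fact
  interpret \<phi>: bilinear_family K A W \<phi> by fact
  interpret P: module K P by fact
  interpret R: module K R by fact
  have cl: "pq s p q \<in> carrier F" and val: "L (pq s p q) = \<phi> s p q"
    if "p \<in> carrier P" "q \<in> carrier R" for s p q
    using pq[OF that] by auto
  have PA': "p \<in> carrier A" if "p \<in> carrier P" for p using that PA(1) by auto
  have RA': "q \<in> carrier A" if "q \<in> carrier R" for q using that RA(1) by auto
  note closed = P.smult_closed R.smult_closed P.M.a_closed R.M.a_closed
  note simps = cl val L.map_add L.map_smult
  show ?thesis
    using lr unfolding bilinear_rels_def
  proof (elim UnE CollectE exE conjE, goal_cases)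
    case (1 k s p q)
    then show ?case
      using P.smult_closed[OF 1(2,3)] by (simp add: simps) (simp add: PA PA' RA' \<phi>.smult_left)
  next
    case (2 k s p q)
    then show ?case
      using R.smult_closed[OF 2(2,4)] by (simp add: simps) (simp add: RA PA' RA' \<phi>.smult_right)
  next
    case (3 s p p' q)
    then show ?case
      using P.M.a_closed[OF 3(2,3)] by (simp add: simps) (simp add: PA PA' RA' \<phi>.add_left)
  next
    case (4 s p q q')
    then show ?case
      using R.M.a_closed[OF 4(3,4)] by (simp add: simps) (simp add: RA PA' RA' \<phi>.add_right)
  qed
qed

text \<open>
  All products and brackets are those of \<open>A\<close>, so each of the six relations is an instance of one of
  the two axioms of a bar family, up to the order of the summands. The algebras \<open>P\<close> and \<open>R\<close> are the
  ideal and \<open>A\<close> in either order.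
\<close>

lemma action_rels_respected:
  assumes L: "linear_map K F W L" and \<phi>: "bar_family K A W \<phi>"
    and PA: "carrier P \<subseteq> carrier A" "mult P = mult A" "bracket P = bracket A"
    and RA: "carrier R \<subseteq> carrier A"
    and opP: "\<And>s p p'. p \<in> carrier P \<Longrightarrow> p' \<in> carrier P \<Longrightarrow> awb_op A s p p' \<in> carrier P"
    and opR: "\<And>s p q. p \<in> carrier P \<Longrightarrow> q \<in> carrier R \<Longrightarrow>
      awb_op A s p q \<in> carrier R \<and> awb_op A s q p \<in> carrier R"
    and pq: "\<And>s p q. p \<in> carrier P \<Longrightarrow> q \<in> carrier R \<Longrightarrow>
      pq s p q \<in> carrier F \<and> L (pq s p q) = \<phi> s p q"
    and qp: "\<And>s p q. p \<in> carrier P \<Longrightarrow> q \<in> carrier R \<Longrightarrow>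
      qp s q p \<in> carrier F \<and> L (qp s q p) = \<phi> s q p"
    and lr: "(l, r) \<in> action_rels F P R (own_action A) pq qp"
  shows "l \<in> carrier F \<and> r \<in> carrier F \<and> L l = L r"
proof -
  interpret L: linear_map K F W L by fact
  interpret \<phi>: bar_family K A W \<phi> by fact
  obtain p\<^sub>1 p\<^sub>2 q where p1: "p\<^sub>1 \<in> carrier P" and p2: "p\<^sub>2 \<in> carrier P" and q: "q \<in> carrier R"
    and lr: "(l, r) \<in>
      {(pq Odot (p\<^sub>1 \<otimes> p\<^sub>2) q, pq Odot p\<^sub>1 (p\<^sub>2 \<otimes> q)),
       (qp Odot q (p\<^sub>1 \<otimes> p\<^sub>2), qp Odot (q \<otimes> p\<^sub>1) p\<^sub>2),
       (pq Ast (p\<^sub>1 \<otimes> p\<^sub>2) q,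
         pq Odot p\<^sub>1 (bracket A p\<^sub>2 q) \<oplus>\<^bsub>F\<^esub> qp Odot (bracket A p\<^sub>1 q) p\<^sub>2),
       (qp Ast (p\<^sub>1 \<otimes> q) p\<^sub>2,
         pq Odot p\<^sub>1 (bracket A q p\<^sub>2) \<oplus>\<^bsub>F\<^esub> pq Odot (bracket A p\<^sub>1 p\<^sub>2) q),
       (qp Ast (q \<otimes> p\<^sub>1) p\<^sub>2,
         qp Odot (bracket A q p\<^sub>2) p\<^sub>1 \<oplus>\<^bsub>F\<^esub> qp Odot q (bracket A p\<^sub>1 p\<^sub>2)),
       (qp Odot (p\<^sub>1 \<otimes> q) p\<^sub>2, pq Odot p\<^sub>1 (q \<otimes> p\<^sub>2))}"
    using lr by (auto simp: action_rels_def own_action_def PA)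
  have ops: "p\<^sub>1 \<otimes> p\<^sub>2 \<in> carrier P" "bracket A p\<^sub>1 p\<^sub>2 \<in> carrier P"
    "p\<^sub>1 \<otimes> q \<in> carrier R" "bracket A p\<^sub>1 q \<in> carrier R" "q \<otimes> p\<^sub>1 \<in> carrier R" "bracket A q p\<^sub>1 \<in> carrier R"
    "p\<^sub>2 \<otimes> q \<in> carrier R" "bracket A p\<^sub>2 q \<in> carrier R" "q \<otimes> p\<^sub>2 \<in> carrier R" "bracket A q p\<^sub>2 \<in> carrier R"
    using opP[OF p1 p2, of Odot] opP[OF p1 p2, of Ast] opR[OF p1 q, of Odot] opR[OF p1 q, of Ast]
      opR[OF p2 q, of Odot] opR[OF p2 q, of Ast]
    by simp_all
  have carr: "p\<^sub>1 \<in> carrier A" "p\<^sub>2 \<in> carrier A" "q \<in> carrier A"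
    using p1 p2 q PA RA by auto
  have "\<phi> Odot (bracket A p\<^sub>1 q) p\<^sub>2 \<oplus>\<^bsub>W\<^esub> \<phi> Odot p\<^sub>1 (bracket A p\<^sub>2 q) =
      \<phi> Odot p\<^sub>1 (bracket A p\<^sub>2 q) \<oplus>\<^bsub>W\<^esub> \<phi> Odot (bracket A p\<^sub>1 q) p\<^sub>2"
    "\<phi> Odot (bracket A p\<^sub>1 p\<^sub>2) q \<oplus>\<^bsub>W\<^esub> \<phi> Odot p\<^sub>1 (bracket A q p\<^sub>2) =
      \<phi> Odot p\<^sub>1 (bracket A q p\<^sub>2) \<oplus>\<^bsub>W\<^esub> \<phi> Odot (bracket A p\<^sub>1 p\<^sub>2) q"
    using carr by (simp_all add: L.W.M.a_comm \<phi>.closed bracket_closed)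
  then show ?thesis
    using lr ops p1 p2 q by (auto simp: pq qp L.map_add \<phi>.assoc \<phi>.deriv carr)
qed

lemma tensor_rels_respected:
  assumes L: "linear_map K (free_vs K syms) W L" and \<phi>: "bar_family K A W \<phi>"
    and val: "\<And>g. g \<in> syms \<Longrightarrow> L (free_gen K g) = sym_val \<phi> g"
    and lr: "(l, r) \<in> rels"
  shows "l \<in> carrier (free_vs K syms) \<and> r \<in> carrier (free_vs K syms) \<and> L l = L r"
proof -
  let ?F = "free_vs K syms"
  let ?mn = "\<lambda>s m n. free_gen K (MN s m n)" and ?nm = "\<lambda>s n m. free_gen K (NM s n m)"
  interpret \<phi>: bar_family K A W \<phi> by fact
  have mn: "?mn s m n \<in> carrier ?F \<and> L (?mn s m n) = \<phi> s m n"
    and nm: "?nm s n m \<in> carrier ?F \<and> L (?nm s n m) = \<phi> s n m"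
    if "m \<in> carrier MA" "n \<in> carrier A" for s m n
    using that by (simp_all add: K.free_gen_closed MN_mem NM_mem val)
  have sub: "carrier MA \<subseteq> carrier A" using ideal_mem_carrier by auto
  from lr consider
    (MN_bilinear) "(l, r) \<in> bilinear_rels K ?F MA A ?mn"
    | (NM_bilinear) "(l, r) \<in> bilinear_rels K ?F A MA ?nm"
    | (basic) s u\<^sub>M u\<^sub>N v\<^sub>M v\<^sub>N where "l = ?mn s u\<^sub>M v\<^sub>N" "r = ?nm s u\<^sub>N v\<^sub>M"
        "(u\<^sub>M, u\<^sub>N) \<in> basic_pairs MA A (own_action A) (own_action A)"
        "(v\<^sub>M, v\<^sub>N) \<in> basic_pairs MA A (own_action A) (own_action A)"
    | (MN_action) "(l, r) \<in> action_rels ?F MA A (own_action A) ?mn ?nm"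
    | (NM_action) "(l, r) \<in> action_rels ?F A MA (own_action A) ?nm ?mn"
    unfolding tensor_rels_def Let_def by blast
  then show ?thesis
  proof cases
    case MN_bilinear
    show ?thesis
      by (rule bilinear_rels_respected[OF L \<phi>.bilinear_family_axioms sub _ _ _ _ _ ideal_module A.module_axioms mn MN_bilinear])
        simp_all
  next
    case NM_bilinear
    show ?thesis
      by (rule bilinear_rels_respected[OF L \<phi>.bilinear_family_axioms _ _ _ sub _ _ A.module_axioms ideal_module nm NM_bilinear])
        simp_all
  next
    case basic
    \<comment> \<open>Both actions are computed in the ambient algebra, so the two entries of a basic pair agree.\<close>
    have "u = v \<and> u \<in> M" if "(u, v) \<in> basic_pairs MA A (own_action A) (own_action A)" for u v
      using that by (auto simp: basic_pairs_def sym_M_own sym_N_own ideal_op_left ideal_op_right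
          elim!: syms_cases)
    from this[OF basic(3)] this[OF basic(4)]
    have "u\<^sub>M = u\<^sub>N" "v\<^sub>M = v\<^sub>N" "u\<^sub>N \<in> M" "v\<^sub>N \<in> M" by auto
    then show ?thesis
      using basic(1,2) mn[of u\<^sub>N v\<^sub>N s] nm[of v\<^sub>N u\<^sub>N s] ideal_mem_carrier by simp
  next
    case MN_action
    show ?thesis
      by (rule action_rels_respected[OF L \<phi> sub _ _ _ _ _ mn nm MN_action])
        (simp_all add: ideal_op_left awb_op_closed ideal_mem_carrier)
  next
    case NM_action
    show ?thesis
      by (rule action_rels_respected[OF L \<phi> _ _ _ sub _ _ nm mn NM_action])
        (simp_all add: ideal_op_left ideal_op_right awb_op_closed ideal_mem_carrier)
  qed
qed

lemma sym_val_closed: "bar_family K A W \<phi> \<Longrightarrow> g \<in> syms \<Longrightarrow> sym_val \<phi> g \<in> carrier W"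
  by (erule syms_cases) (auto simp: ideal_mem_carrier bilinear_family.closed[OF bar_family.axioms(1)])

lemma sym_val_op_ideal: "g \<in> syms \<Longrightarrow> sym_val (awb_op A) g \<in> M"
  by (erule syms_cases) (auto simp: ideal_op_left ideal_op_right)

lemma lin_ext_respects_rels:
  assumes W: "module K W" and \<phi>: "bar_family K A W \<phi>" and lr: "(l, r) \<in> rels"
  shows "l \<in> carrier (free_vs K syms) \<and> r \<in> carrier (free_vs K syms) \<and>
    lin_ext K W (sym_val \<phi>) l = lin_ext K W (sym_val \<phi>) r"
  by (rule tensor_rels_respected[OF module.lin_ext_linear[OF W sym_val_closed[OF \<phi>]] \<phi>
        module.lin_ext_gen[OF W sym_val_closed[OF \<phi>]] lr])

text \<open>
  That the relations lie in the free space is part of the preceding lemma; the family of the two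
  operations is one to which it applies.
\<close>

lemma tensor_presentation: "presentation K syms rels"
  using lin_ext_respects_rels[OF A.module_axioms awb_op_bar_family]
  by unfold_locales auto

definition tensor_elem :: "('a, 'a) tensor_sym \<Rightarrow> (('a, 'a) tensor_sym \<Rightarrow> 'k) set"
  where "tensor_elem = pres_gen K syms rels"

definition tensor_to_coker :: "(('a, 'a) tensor_sym \<Rightarrow> 'k) set \<Rightarrow> ('a chain_sym \<Rightarrow> 'k) set set"
  where "tensor_to_coker = pres_map K (one_coker K A) (sym_val (bar K A))"

lemma ideal_tensor_eq: "ideal_tensor K A M = pres_vs K syms rels"
  by (simp add: ideal_tensor_def nonab_tensor_def)

lemma tensor_elem_closed: "g \<in> syms \<Longrightarrow> tensor_elem g \<in> carrier (ideal_tensor K A M)"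
  unfolding tensor_elem_def ideal_tensor_eq
  by (rule presentation.pres_gen_closed[OF tensor_presentation])

lemma ideal_tensor_span:
  assumes U: "submodule U K (ideal_tensor K A M)" and gen: "\<And>g. g \<in> syms \<Longrightarrow> tensor_elem g \<in> U"
    and z: "z \<in> carrier (ideal_tensor K A M)"
  shows "z \<in> U"
  using presentation.pres_span[OF tensor_presentation, of U z] assms
  by (simp add: tensor_elem_def ideal_tensor_eq)

lemma tensor_to_coker_linear: "linear_map K (ideal_tensor K A M) (one_coker K A) tensor_to_coker"
  and tensor_to_coker_elem: "g \<in> syms \<Longrightarrow> tensor_to_coker (tensor_elem g) = sym_val (bar K A) g"
proof -
  note resp = conjunct2[OF conjunct2[OF lin_ext_respects_rels[OF one_coker_module bar_bar_family]]]
  show "linear_map K (ideal_tensor K A M) (one_coker K A) tensor_to_coker"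
    unfolding tensor_to_coker_def ideal_tensor_eq
    by (rule presentation.pres_map_linear[OF tensor_presentation one_coker_module
          sym_val_closed[OF bar_bar_family] resp])
  show "tensor_to_coker (tensor_elem g) = sym_val (bar K A) g" if "g \<in> syms"
    unfolding tensor_to_coker_def tensor_elem_def
    by (rule presentation.pres_map_gen[OF tensor_presentation one_coker_module
          sym_val_closed[OF bar_bar_family] resp that])
qed

lemma ideal_incl_linear: "linear_map K MA A (\<lambda>x. x)"
proof -
  interpret MA: module K MA by (rule ideal_module)
  show ?thesis by unfold_locales (auto simp: ideal_mem_carrier)
qed

abbreviation psi where "psi \<equiv> psi_M K MA (own_action A)"

lemma psi_linear: "linear_map K (ideal_tensor K A M) MA psi"
  and psi_elem: "g \<in> syms \<Longrightarrow> psi (tensor_elem g) = sym_val (awb_op A) g"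
proof -
  have sym: "sym_M (own_action A) = sym_val (awb_op A)" by (intro ext) (rule sym_M_own)
  have val: "sym_val (awb_op A) g \<in> carrier MA" if "g \<in> syms" for g
    using sym_val_op_ideal[OF that] by simp
  note L = module.lin_ext_linear[OF ideal_module val]
  \<comment> \<open>The relations are checked in the ambient algebra, into which the ideal injects.\<close>
  have resp: "lin_ext K MA (sym_val (awb_op A)) l = lin_ext K MA (sym_val (awb_op A)) r"
    if "(l, r) \<in> rels" for l r
    using tensor_rels_respected[OF linear_map.comp[OF L ideal_incl_linear] awb_op_bar_family
        module.lin_ext_gen[OF ideal_module val] that] by simp
  show "linear_map K (ideal_tensor K A M) MA psi"
    unfolding psi_M_def ideal_tensor_eq sym
    by (rule presentation.pres_map_linear[OF tensor_presentation ideal_module val resp])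
  show "psi (tensor_elem g) = sym_val (awb_op A) g" if "g \<in> syms"
    unfolding psi_M_def tensor_elem_def sym
    by (rule presentation.pres_map_gen[OF tensor_presentation ideal_module val resp that])
qed

text \<open>
  The left square of the diagram: multiplying out in \<open>A\<close> is the same before and after passing to
  \<open>T(A)\<close>.
\<close>

lemma coker_diff_tensor:
  assumes "z \<in> carrier (ideal_tensor K A M)"
  shows "coker_diff K A (tensor_to_coker z) = psi z"
proof (rule presentation.pres_linear_eqI[OF tensor_presentation])
  show "linear_map K (pres_vs K syms rels) A (\<lambda>z. coker_diff K A (tensor_to_coker z))"
    using linear_map.comp[OF tensor_to_coker_linear coker_diff_linear] by (simp add: ideal_tensor_eq)
  show "linear_map K (pres_vs K syms rels) A psi"
    using linear_map.comp[OF psi_linear ideal_incl_linear] by (simp add: ideal_tensor_eq)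
  show "z \<in> carrier (pres_vs K syms rels)" using assms by (simp add: ideal_tensor_eq)
  fix g assume g: "g \<in> syms"
  then have "coker_diff K A (sym_val (bar K A) g) = sym_val (awb_op A) g"
    by (rule syms_cases) (simp_all add: coker_diff_bar ideal_mem_carrier)
  then show "coker_diff K A (tensor_to_coker (pres_gen K syms rels g)) = psi (pres_gen K syms rels g)"
    using tensor_to_coker_elem[OF g] psi_elem[OF g] by (simp add: tensor_elem_def)
qed

text \<open>
  Exactness of \<open>M \<boxtimes> A \<rightarrow> T(A) \<rightarrow> T(A/M)\<close>. The composite vanishes since one entry of every generator
  becomes 0. For the converse let \<open>I\<close> be the image of the first map. As \<open>I\<close> contains all classes
  with an entry in \<open>M\<close>, the class modulo \<open>I\<close> of a generator depends only on the entries modulo \<open>M\<close>.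
  This gives a map \<open>\<sigma> : T(A/M) \<rightarrow> T(A)/I\<close> whose composite with the projection \<open>T(A) \<rightarrow> T(A/M)\<close> is the
  quotient map, so an element that becomes 0 in \<open>T(A/M)\<close> lies in \<open>I\<close>.
\<close>

lemma tensor_to_coker_image:
  "tensor_to_coker ` carrier (ideal_tensor K A M) = a_kernel (one_coker K A) (one_coker K Q) coker_proj"
proof -
  interpret Q: awb_record K Q by (rule quot_awb)
  interpret q: linear_map K A Q q by (rule quot_proj_linear)
  interpret T: module K "one_coker K A" by (rule one_coker_module)
  interpret \<theta>: linear_map K "ideal_tensor K A M" "one_coker K A" tensor_to_coker
    by (rule tensor_to_coker_linear)
  interpret \<pi>: linear_map K "one_coker K A" "one_coker K Q" coker_proj by (rule coker_proj_linear)
  interpret b: bar_family K A "one_coker K A" "bar K A" by (rule bar_bar_family)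
  interpret bQ: bar_family K Q "one_coker K Q" "bar K Q" by (rule Q.bar_bar_family)
  define I where "I = tensor_to_coker ` carrier (ideal_tensor K A M)"
  have I: "submodule I K (one_coker K A)" unfolding I_def by (rule \<theta>.image_submodule)
  have qM: "q m = \<zero>\<^bsub>Q\<^esub>" if "m \<in> M" for m
  proof -
    have "q m = M"
      by (rule iffD2[OF A.coset_eq_zero_iff[OF ideal_submodule ideal_mem_carrier[OF that]] that])
    then show ?thesis by (simp only: quot_fields)
  qed
  have image_le_kernel: "X \<in> a_kernel (one_coker K A) (one_coker K Q) coker_proj"
    if X: "X \<in> tensor_to_coker ` carrier (ideal_tensor K A M)" for X
  proof -
    obtain z where z: "z \<in> carrier (ideal_tensor K A M)" "X = tensor_to_coker z" using X by blast
    interpret c: linear_map K "ideal_tensor K A M" "one_coker K Q" "\<lambda>z. coker_proj (tensor_to_coker z)"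
      by (rule linear_map.comp[OF tensor_to_coker_linear coker_proj_linear])
    have "z \<in> a_kernel (ideal_tensor K A M) (one_coker K Q) (\<lambda>z. coker_proj (tensor_to_coker z))"
      using c.kernel_submodule _ z(1)
    proof (rule ideal_tensor_span)
      fix g assume g: "g \<in> syms"
      then have "coker_proj (sym_val (bar K A) g) = \<zero>\<^bsub>one_coker K Q\<^esub>"
        by (rule syms_cases)
          (simp_all add: coker_proj_bar ideal_mem_carrier qM q.map_closed
            bQ.zero_left[OF Q.A.module_axioms Q.one_coker_module]
            bQ.zero_right[OF Q.A.module_axioms Q.one_coker_module])
      then show "tensor_elem g \<in> a_kernel (ideal_tensor K A M) (one_coker K Q) (\<lambda>z. coker_proj (tensor_to_coker z))"
        using g by (simp add: a_kernel_def' tensor_elem_closed tensor_to_coker_elem)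
    qed
    then show ?thesis using z \<theta>.map_closed by (simp add: a_kernel_def')
  qed
  have bar_I: "bar K A s m a \<in> I" "bar K A s a m \<in> I" if "m \<in> M" "a \<in> carrier A" for s m a
    using tensor_to_coker_elem[OF MN_mem[OF that], of s] tensor_to_coker_elem[OF NM_mem[OF that], of s]
      tensor_elem_closed[OF MN_mem[OF that], of s] tensor_elem_closed[OF NM_mem[OF that], of s]
    unfolding I_def by (metis imageI sym_val.simps)+
  interpret TI: module K "quot_mod (one_coker K A) I" by (rule T.quot_mod_module[OF I])
  interpret r: linear_map K "one_coker K A" "quot_mod (one_coker K A) I" "\<lambda>X. I +>\<^bsub>one_coker K A\<^esub> X"
    by (rule T.quot_proj_linear[OF I])
  \<comment> \<open>\<open>\<sigma>\<close> is prescribed on generators through arbitrary representatives of the entries.\<close>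
  define rep where "rep X = (SOME x. x \<in> X)" for X :: "'a set"
  define \<beta> where "\<beta> s X Y = I +>\<^bsub>one_coker K A\<^esub> bar K A s (rep X) (rep Y)" for s X Y
  have \<beta>: "\<beta> s (q a) (q b) = I +>\<^bsub>one_coker K A\<^esub> bar K A s a b"
    if a: "a \<in> carrier A" and b: "b \<in> carrier A" for s a b
  proof -
    have rep: "rep (q x) \<in> carrier A \<and> rep (q x) \<ominus> x \<in> M" if "x \<in> carrier A" for x
    proof -
      have "rep (q x) \<in> q x"
        unfolding rep_def by (rule someI) (rule A.coset_self[OF ideal_submodule that])
      then show ?thesis
        using A.coset_subset[OF ideal_submodule that] A.coset_mem_iff[OF ideal_submodule that] by auto
    qed
    define x y where "x = rep (q a)" and "y = rep (q b)"
    have x: "x \<in> carrier A" "x \<ominus> a \<in> M" and y: "y \<in> carrier A" "y \<ominus> b \<in> M"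
      using rep[OF a] rep[OF b] by (simp_all add: x_def y_def)
    have split: "x = (x \<ominus> a) \<oplus> a" "y = (y \<ominus> b) \<oplus> b"
      using x y a b by (simp_all add: a_minus_def A.M.a_assoc A.M.l_neg)
    have "bar K A s x y = bar K A s (x \<ominus> a) y \<oplus>\<^bsub>one_coker K A\<^esub> bar K A s a y"
      using b.add_left[of "x \<ominus> a" a y s] split(1) x y a by simp
    also have "bar K A s a y = bar K A s a (y \<ominus> b) \<oplus>\<^bsub>one_coker K A\<^esub> bar K A s a b"
      using b.add_right[of a "y \<ominus> b" b s] split(2) y a b by simp
    finally have "bar K A s x y = (bar K A s (x \<ominus> a) y \<oplus>\<^bsub>one_coker K A\<^esub> bar K A s a (y \<ominus> b))
        \<oplus>\<^bsub>one_coker K A\<^esub> bar K A s a b"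
      using x y a b by (simp add: b.closed T.M.a_assoc)
    then have "bar K A s x y \<ominus>\<^bsub>one_coker K A\<^esub> bar K A s a b =
        bar K A s (x \<ominus> a) y \<oplus>\<^bsub>one_coker K A\<^esub> bar K A s a (y \<ominus> b)"
      using x y a b by (simp add: b.closed a_minus_def T.M.a_assoc T.M.r_neg)
    also have "\<dots> \<in> I"
      using T.submoduleE(5)[OF I] bar_I x y a by simp
    finally show ?thesis
      using T.coset_eq_iff[OF I] b.closed x y a b by (simp add: \<beta>_def x_def y_def)
  qed
  interpret rb: bar_family K A "quot_mod (one_coker K A) I" "\<lambda>s a b. I +>\<^bsub>one_coker K A\<^esub> bar K A s a b"
    by (rule bar_family_comp[OF bar_bar_family r.linear_map_axioms awb_record_axioms])
  have "bar_family K Q (quot_mod (one_coker K A) I) \<beta>"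
  proof
    fix s X Y Z assume "X \<in> carrier Q" "Y \<in> carrier Q" "Z \<in> carrier Q"
    then obtain x y z where xyz: "x \<in> carrier A" "y \<in> carrier A" "z \<in> carrier A"
      and XYZ: "X = q x" "Y = q y" "Z = q z"
      by (auto simp: quot_carrier)
    note simps = XYZ \<beta> quot_mult quot_bracket q.map_add[symmetric] xyz mult_closed bracket_closed
      A.M.a_closed
    show "\<beta> s (X \<oplus>\<^bsub>Q\<^esub> Y) Z = \<beta> s X Z \<oplus>\<^bsub>quot_mod (one_coker K A) I\<^esub> \<beta> s Y Z"
      using rb.add_left[OF xyz] by (simp only: simps)
    show "\<beta> s X (Y \<oplus>\<^bsub>Q\<^esub> Z) = \<beta> s X Y \<oplus>\<^bsub>quot_mod (one_coker K A) I\<^esub> \<beta> s X Z"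
      using rb.add_right[OF xyz] by (simp only: simps)
    show "\<beta> Odot (X \<otimes>\<^bsub>Q\<^esub> Y) Z = \<beta> Odot X (Y \<otimes>\<^bsub>Q\<^esub> Z)"
      using rb.assoc[OF xyz] by (simp only: simps)
    show "\<beta> Ast (X \<otimes>\<^bsub>Q\<^esub> Y) Z =
        \<beta> Odot (bracket Q X Z) Y \<oplus>\<^bsub>quot_mod (one_coker K A) I\<^esub> \<beta> Odot X (bracket Q Y Z)"
      using rb.deriv[OF xyz] by (simp only: simps)
  next
    fix s X Y assume "X \<in> carrier Q" "Y \<in> carrier Q"
    then obtain x y where xy: "x \<in> carrier A" "y \<in> carrier A" and XY: "X = q x" "Y = q y"
      by (auto simp: quot_carrier)
    show "\<beta> s X Y \<in> carrier (quot_mod (one_coker K A) I)"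
      using rb.closed[OF xy] by (simp only: XY \<beta>[OF xy])
    {
      fix k assume k: "k \<in> carrier K"
      show "\<beta> s (k \<odot>\<^bsub>Q\<^esub> X) Y = k \<odot>\<^bsub>quot_mod (one_coker K A) I\<^esub> \<beta> s X Y"
        using rb.smult_left[OF k xy] by (simp only: XY \<beta> xy q.map_smult[symmetric] k A.smult_closed)
      show "\<beta> s X (k \<odot>\<^bsub>Q\<^esub> Y) = k \<odot>\<^bsub>quot_mod (one_coker K A) I\<^esub> \<beta> s X Y"
        using rb.smult_right[OF k xy] by (simp only: XY \<beta> xy q.map_smult[symmetric] k A.smult_closed)
    }
  qed
  from Q.one_coker_lift_exists[OF TI.module_axioms this]
  obtain \<sigma> where \<sigma>_ex: "linear_map K (one_coker K Q) (quot_mod (one_coker K A) I) \<sigma> \<and>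
      (\<forall>s. \<forall>X\<in>carrier Q. \<forall>Y\<in>carrier Q. \<sigma> (bar K Q s X Y) = \<beta> s X Y)" by (rule exE)
  then have \<sigma>: "linear_map K (one_coker K Q) (quot_mod (one_coker K A) I) \<sigma>"
    and \<sigma>_bar: "\<And>s X Y. X \<in> carrier Q \<Longrightarrow> Y \<in> carrier Q \<Longrightarrow> \<sigma> (bar K Q s X Y) = \<beta> s X Y"
    by simp_all
  interpret \<sigma>: linear_map K "one_coker K Q" "quot_mod (one_coker K A) I" \<sigma> by (rule \<sigma>)
  have kernel_le_image: "X \<in> tensor_to_coker ` carrier (ideal_tensor K A M)"
    if X: "X \<in> a_kernel (one_coker K A) (one_coker K Q) coker_proj" for X
  proof -
    have Xc: "X \<in> carrier (one_coker K A)" and X0: "coker_proj X = \<zero>\<^bsub>one_coker K Q\<^esub>"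
      using X by (auto simp: a_kernel_def')
    have "\<sigma> (coker_proj X) = I +>\<^bsub>one_coker K A\<^esub> X"
      by (rule one_coker_eqI[OF linear_map.comp[OF coker_proj_linear \<sigma>] r.linear_map_axioms _ Xc])
        (simp add: coker_proj_bar \<sigma>_bar \<beta> q.map_closed)
    then have "I +>\<^bsub>one_coker K A\<^esub> X = I" using X0 \<sigma>.map_zero by simp
    then show ?thesis using T.coset_eq_zero_iff[OF I Xc] by (simp add: I_def)
  qed
  show ?thesis using image_le_kernel kernel_le_image by blast
qed

lemma psi_image_ops:
  assumes "m \<in> M" "a \<in> carrier A"
  shows "awb_op A s m a \<in> psi ` carrier (ideal_tensor K A M)"
    "awb_op A s a m \<in> psi ` carrier (ideal_tensor K A M)"
  using psi_elem[OF MN_mem[OF assms], of s] psi_elem[OF NM_mem[OF assms], of s]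
    tensor_elem_closed[OF MN_mem[OF assms], of s] tensor_elem_closed[OF NM_mem[OF assms], of s]
  by (metis imageI sym_val.simps)+

text \<open>
  The image of \<open>\<psi>\<close> is spanned by the products and brackets that generate the ideal \<open>[[A,M]]\<close>. It is
  itself an ideal: it lies in \<open>M\<close>, and every product or bracket of an element of \<open>M\<close> with one of \<open>A\<close>
  is such a generator.
\<close>

lemma psi_image: "psi ` carrier (ideal_tensor K A M) = awb_commutator K A (carrier A) M"
proof
  interpret \<psi>: linear_map K "ideal_tensor K A M" A psi
    by (rule linear_map.comp[OF psi_linear ideal_incl_linear])
  interpret \<psi>M: linear_map K "ideal_tensor K A M" MA psi by (rule psi_linear)
  let ?S = "\<Union>b\<in>carrier A. \<Union>c\<in>M. {b \<otimes> c, c \<otimes> b, bracket A b c, bracket A c b}"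
  have S: "awb_op A s a m \<in> ?S \<and> awb_op A s m a \<in> ?S" if "a \<in> carrier A" "m \<in> M" for s a m
    using that by (cases s) auto
  show "psi ` carrier (ideal_tensor K A M) \<subseteq> awb_commutator K A (carrier A) M"
    unfolding awb_commutator_def hull_def
  proof (intro Inter_greatest subsetI)
    fix t y assume "t \<in> {t. awb_ideal K A t \<and> ?S \<subseteq> t}" and "y \<in> psi ` carrier (ideal_tensor K A M)"
    then obtain z where t: "awb_ideal K A t" "?S \<subseteq> t" and z: "z \<in> carrier (ideal_tensor K A M)" "y = psi z"
      by blast
    have "z \<in> {z \<in> carrier (ideal_tensor K A M). psi z \<in> t}"
      using \<psi>.preimage_submodule[OF awb_ideal.axioms(1)[OF t(1)]] _ z(1)
    proof (rule ideal_tensor_span)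
      fix g assume g: "g \<in> syms"
      then have "sym_val (awb_op A) g \<in> ?S"
        by (rule syms_cases) (simp_all only: sym_val.simps S)
      then show "tensor_elem g \<in> {z \<in> carrier (ideal_tensor K A M). psi z \<in> t}"
        using t(2) psi_elem[OF g] tensor_elem_closed[OF g] by auto
    qed
    then show "y \<in> t" using z by simp
  qed
  have sub: "x \<in> M" if "x \<in> psi ` carrier (ideal_tensor K A M)" for x
    using that \<psi>M.map_closed by auto
  show "awb_commutator K A (carrier A) M \<subseteq> psi ` carrier (ideal_tensor K A M)"
    unfolding awb_commutator_def
  proof (rule hull_minimal)
    show "?S \<subseteq> psi ` carrier (ideal_tensor K A M)"
      using psi_image_ops[of _ _ Odot] psi_image_ops[of _ _ Ast] by auto
    show "awb_ideal K A (psi ` carrier (ideal_tensor K A M))"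
      using \<psi>.image_submodule psi_image_ops[OF sub, of _ _ Odot] psi_image_ops[OF sub, of _ _ Ast]
      by (intro awb_ideal.intro awb_ideal_axioms.intro) simp_all
  qed
qed

end

text \<open>
  The image of \<open>T(A) \<rightarrow> A\<close> contains all products and brackets and hence is an ideal, so it is
  \<open>[[A,A]]\<close>.
\<close>

lemma (in awb_record) coker_diff_surj:
  assumes "awb_perfect K A"
  shows "coker_diff K A ` carrier (one_coker K A) = carrier A"
proof
  interpret d: linear_map K "one_coker K A" A "coker_diff K A" by (rule coker_diff_linear)
  show "coker_diff K A ` carrier (one_coker K A) \<subseteq> carrier A" using d.map_closed by auto
  have op: "awb_op A s a b \<in> coker_diff K A ` carrier (one_coker K A)"
    if "a \<in> carrier A" "b \<in> carrier A" for s a b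
    using coker_diff_bar[OF that, of s] bar_closed[OF that, of s] by (metis imageI)
  have sub: "x \<in> carrier A" if "x \<in> coker_diff K A ` carrier (one_coker K A)" for x
    using that d.map_closed by auto
  have "awb_commutator K A (carrier A) (carrier A) \<subseteq> coker_diff K A ` carrier (one_coker K A)"
    unfolding awb_commutator_def
  proof (rule hull_minimal)
    show "(\<Union>b\<in>carrier A. \<Union>c\<in>carrier A. {b \<otimes> c, c \<otimes> b, bracket A b c, bracket A c b})
        \<subseteq> coker_diff K A ` carrier (one_coker K A)"
      using op[of _ _ Odot] op[of _ _ Ast] by auto
    show "awb_ideal K A (coker_diff K A ` carrier (one_coker K A))"
      using d.image_submodule op[OF sub, of _ _ Odot] op[OF _ sub, of _ _ Odot]
        op[OF sub, of _ _ Ast] op[OF _ sub, of _ _ Ast]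
      by (intro awb_ideal.intro awb_ideal_axioms.intro) simp_all
  qed
  then show "carrier A \<subseteq> coker_diff K A ` carrier (one_coker K A)"
    using assms unfolding awb_perfect_def by blast
qed

section \<open>The snake lemma and the exact sequence\<close>

text \<open>
  The snake lemma for a diagram with exact rows
  \<open>N \<rightarrow> T \<rightarrow> S \<rightarrow> 0\<close> and \<open>0 \<rightarrow> M \<rightarrow> A \<rightarrow> Q\<close>
  and vertical maps \<open>\<psi>\<close>, \<open>d\<close>, \<open>e\<close>, of which \<open>d\<close> is onto. The space \<open>M\<close> is a subspace of \<open>A\<close>,
  not merely embedded in it. The connecting map \<open>h\<close> sends \<open>\<pi> t\<close> to the class of \<open>d t\<close>; its
  cokernel vanishes because it embeds into that of \<open>d\<close>.
\<close>

lemma snake: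
  assumes \<theta>: "linear_map K N T \<theta>" and \<pi>: "linear_map K T S \<pi>"
    and exT: "\<theta> ` carrier N = a_kernel T S \<pi>" and surj: "\<pi> ` carrier T = carrier S"
    and q: "linear_map K A Q q" and M: "a_kernel A Q q = M"
    and \<psi>: "linear_map K N (A\<lparr>carrier := M\<rparr>) \<psi>" and d: "linear_map K T A d" and e: "linear_map K S Q e"
    and sq1: "\<And>n. n \<in> carrier N \<Longrightarrow> d (\<theta> n) = \<psi> n"
    and sq2: "\<And>t. t \<in> carrier T \<Longrightarrow> e (\<pi> t) = q (d t)"
    and d_surj: "d ` carrier T = carrier A"
  defines "N' \<equiv> N\<lparr>carrier := a_kernel N (A\<lparr>carrier := M\<rparr>) \<psi>\<rparr>"
    and "T' \<equiv> T\<lparr>carrier := a_kernel T A d\<rparr>"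
    and "S' \<equiv> S\<lparr>carrier := a_kernel S Q e\<rparr>"
    and "C \<equiv> quot_mod (A\<lparr>carrier := M\<rparr>) (\<psi> ` carrier N)"
  shows "\<exists>f h. linear_map K N' T' f \<and> linear_map K T' S' \<pi> \<and> linear_map K S' C h \<and>
    f ` carrier N' = a_kernel T' S' \<pi> \<and> \<pi> ` carrier T' = a_kernel S' C h \<and>
    h ` carrier S' = carrier C"
proof -
  interpret \<theta>: linear_map K N T \<theta> by fact
  interpret \<pi>: linear_map K T S \<pi> by fact
  interpret q: linear_map K A Q q by fact
  interpret \<psi>: linear_map K N "A\<lparr>carrier := M\<rparr>" \<psi> by fact
  interpret d: linear_map K T A d by fact
  interpret e: linear_map K S Q e by fact
  have "submodule M K A" using q.kernel_submodule M by simp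
  then have M_carrier: "m \<in> carrier A" and M_q: "q m = \<zero>\<^bsub>Q\<^esub>" if "m \<in> M" for m
    using that M by (auto simp: a_kernel_def')
  have in_M: "m \<in> M" if "m \<in> carrier A" "q m = \<zero>\<^bsub>Q\<^esub>" for m using that M by (auto simp: a_kernel_def')
  have lin_\<theta>: "linear_map K N' T' \<theta>"
    unfolding N'_def T'_def
    by (rule \<theta>.restrict[OF \<psi>.kernel_submodule d.kernel_submodule])
      (auto simp: a_kernel_def' sq1 \<theta>.map_closed)
  have lin_\<pi>: "linear_map K T' S' \<pi>"
    unfolding T'_def S'_def
    by (rule \<pi>.restrict[OF d.kernel_submodule e.kernel_submodule])
      (auto simp: a_kernel_def' sq2 \<pi>.map_closed q.map_zero)
  have exact_T: "\<theta> ` carrier N' = a_kernel T' S' \<pi>"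
  proof (rule equalityI; rule subsetI)
    fix t assume "t \<in> \<theta> ` carrier N'"
    then obtain n where "n \<in> carrier N" "\<psi> n = \<zero>\<^bsub>A\<^esub>" "t = \<theta> n" by (auto simp: N'_def a_kernel_def')
    then show "t \<in> a_kernel T' S' \<pi>"
      using exT sq1[of n] by (auto simp: T'_def S'_def a_kernel_def')
  next
    fix t assume "t \<in> a_kernel T' S' \<pi>"
    then have t: "t \<in> carrier T" "d t = \<zero>\<^bsub>A\<^esub>" "\<pi> t = \<zero>\<^bsub>S\<^esub>" by (auto simp: T'_def S'_def a_kernel_def')
    then have "t \<in> \<theta> ` carrier N" using exT by (simp add: a_kernel_def')
    then obtain n where "n \<in> carrier N" "t = \<theta> n" by blast
    then show "t \<in> \<theta> ` carrier N'" using t sq1[of n] by (auto simp: N'_def a_kernel_def')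
  qed
  define U where "U = \<psi> ` carrier N"
  have U: "submodule U K (A\<lparr>carrier := M\<rparr>)" unfolding U_def by (rule \<psi>.image_submodule)
  let ?c = "\<lambda>x. U +>\<^bsub>A\<lparr>carrier := M\<rparr>\<^esub> x"
  interpret C: linear_map K "A\<lparr>carrier := M\<rparr>" C ?c
    unfolding C_def U_def[symmetric] by (rule \<psi>.W.quot_proj_linear[OF U])
  have C_carrier: "carrier C = ?c ` M" and C_zero: "\<zero>\<^bsub>C\<^esub> = U"
    by (simp_all add: C_def U_def \<psi>.W.quot_mod_carrier)
  \<comment> \<open>Two lifts of \<open>s\<close> differ by some \<open>\<theta> n\<close>, which changes the value of \<open>d\<close> by \<open>\<psi> n\<close>.\<close>
  define h where "h s = ?c (d (SOME t. t \<in> carrier T \<and> \<pi> t = s))" for s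
  have h: "h (\<pi> t) = ?c (d t)" if t: "t \<in> carrier T" and dt: "d t \<in> M" for t
  proof -
    define t' where "t' = (SOME t'. t' \<in> carrier T \<and> \<pi> t' = \<pi> t)"
    have t': "t' \<in> carrier T" "\<pi> t' = \<pi> t"
      unfolding t'_def using someI[of "\<lambda>t'. t' \<in> carrier T \<and> \<pi> t' = \<pi> t" t] t by auto
    have "q (d t') = \<zero>\<^bsub>Q\<^esub>" using sq2[OF t'(1)] sq2[OF t] t'(2) M_q[OF dt] by simp
    then have dt': "d t' \<in> M" using in_M d.map_closed[OF t'(1)] by simp
    have "t' \<ominus>\<^bsub>T\<^esub> t \<in> \<theta> ` carrier N"
      unfolding exT using t t' by (simp add: a_kernel_def' \<pi>.map_minus \<pi>.W.minus_eq_zero_iff \<pi>.map_closed)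
    then obtain n where n: "n \<in> carrier N" "t' \<ominus>\<^bsub>T\<^esub> t = \<theta> n" by blast
    have "d t' = d t \<oplus>\<^bsub>A\<^esub> \<psi> n"
      using sq1[OF n(1)] n(2)[symmetric] d.map_minus[OF t'(1) t] d.map_closed[OF t] d.map_closed[OF t'(1)]
      by (simp add: a_minus_def q.V.M.a_lcomm q.V.M.r_neg)
    then have "?c (d t') = ?c (d t) \<oplus>\<^bsub>C\<^esub> ?c (\<psi> n)"
      using C.map_add[of "d t" "\<psi> n"] dt \<psi>.map_closed[OF n(1)] by simp
    also have "?c (\<psi> n) = \<zero>\<^bsub>C\<^esub>"
      using \<psi>.W.coset_eq_zero_iff[OF U \<psi>.map_closed[OF n(1)]] n(1) C_zero by (simp add: U_def)
    finally have "?c (d t') = ?c (d t)" using C.map_closed[of "d t"] dt by simp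
    then show ?thesis by (simp add: h_def t'_def)
  qed
  have lift: "\<exists>t. t \<in> carrier T \<and> d t \<in> M \<and> s = \<pi> t" if "s \<in> carrier S'" for s
  proof -
    have s: "s \<in> carrier S" "e s = \<zero>\<^bsub>Q\<^esub>" using that by (auto simp: S'_def a_kernel_def')
    then obtain t where t: "t \<in> carrier T" "s = \<pi> t" using surj by blast
    then have "d t \<in> M" using in_M[OF d.map_closed[OF t(1)]] sq2[OF t(1)] s(2) by simp
    then show ?thesis using t by blast
  qed
  have S'_mem: "\<pi> t \<in> carrier S'" if "t \<in> carrier T" "d t \<in> M" for t
    using that sq2 M_q \<pi>.map_closed by (simp add: S'_def a_kernel_def')
  interpret S': module K S' using lin_\<pi> by (rule linear_map.axioms(2))
  have S'_ops: "add S' = add S" "smult S' = smult S" "zero S' = zero S" by (simp_all add: S'_def)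
  have lin_h: "linear_map K S' C h"
  proof unfold_locales
    fix s assume "s \<in> carrier S'"
    then obtain t where t: "t \<in> carrier T" "d t \<in> M" "s = \<pi> t" using lift by blast
    show "h s \<in> carrier C" using h[OF t(1,2)] t by (simp add: C_carrier)
    {
      fix s' assume "s' \<in> carrier S'"
      then obtain t' where t': "t' \<in> carrier T" "d t' \<in> M" "s' = \<pi> t'" using lift by blast
      have "d (t \<oplus>\<^bsub>T\<^esub> t') \<in> M" using \<psi>.W.M.a_closed[of "d t" "d t'"] t t' d.map_add by simp
      then have "h (\<pi> (t \<oplus>\<^bsub>T\<^esub> t')) = ?c (d t \<oplus>\<^bsub>A\<^esub> d t')"
        using h[of "t \<oplus>\<^bsub>T\<^esub> t'"] t t' d.map_add by simp
      also have "\<dots> = ?c (d t) \<oplus>\<^bsub>C\<^esub> ?c (d t')" using C.map_add[of "d t" "d t'"] t t' by simp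
      finally show "h (s \<oplus>\<^bsub>S'\<^esub> s') = h s \<oplus>\<^bsub>C\<^esub> h s'"
        using t t' h[OF t(1,2)] h[OF t'(1,2)] \<pi>.map_add by (simp add: S'_ops)
    }
    {
      fix k assume k: "k \<in> carrier K"
      have "d (k \<odot>\<^bsub>T\<^esub> t) \<in> M" using \<psi>.W.smult_closed[OF k, of "d t"] t d.map_smult[OF k] by simp
      then have "h (\<pi> (k \<odot>\<^bsub>T\<^esub> t)) = ?c (k \<odot>\<^bsub>A\<^esub> d t)"
        using h[of "k \<odot>\<^bsub>T\<^esub> t"] k t d.map_smult by simp
      also have "\<dots> = k \<odot>\<^bsub>C\<^esub> ?c (d t)" using C.map_smult[OF k, of "d t"] t by simp
      finally show "h (k \<odot>\<^bsub>S'\<^esub> s) = k \<odot>\<^bsub>C\<^esub> h s"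
        using k t h[OF t(1,2)] \<pi>.map_smult by (simp add: S'_ops)
    }
  qed
  have exact_S: "\<pi> ` carrier T' = a_kernel S' C h"
  proof (rule equalityI; rule subsetI)
    fix s assume "s \<in> \<pi> ` carrier T'"
    then obtain t where t: "t \<in> carrier T" "d t = \<zero>\<^bsub>A\<^esub>" "s = \<pi> t" by (auto simp: T'_def a_kernel_def')
    moreover have "\<zero>\<^bsub>A\<^esub> \<in> M" using in_M q.map_zero by simp
    ultimately show "s \<in> a_kernel S' C h"
      using h[of t] C.map_zero S'_mem[of t] by (simp add: a_kernel_def')
  next
    fix s assume "s \<in> a_kernel S' C h"
    then have "s \<in> carrier S'" and hs: "h s = U" by (auto simp: a_kernel_def' C_zero)
    then obtain t where t: "t \<in> carrier T" "d t \<in> M" "s = \<pi> t" using lift by blast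
    have "d t \<in> U" using hs h[OF t(1,2)] t \<psi>.W.coset_eq_zero_iff[OF U, of "d t"] by simp
    then obtain n where n: "n \<in> carrier N" "d t = \<psi> n" by (auto simp: U_def)
    \<comment> \<open>Subtracting \<open>\<theta> n\<close> moves the lift of \<open>s\<close> into the kernel of \<open>d\<close> without changing its image.\<close>
    have \<theta>n: "\<theta> n \<in> carrier T" "\<pi> (\<theta> n) = \<zero>\<^bsub>S\<^esub>" using n(1) exT by (auto simp: a_kernel_def')
    have "d (t \<ominus>\<^bsub>T\<^esub> \<theta> n) = \<zero>\<^bsub>A\<^esub>"
      using d.map_minus[OF t(1) \<theta>n(1)] sq1[OF n(1)] n(2) d.map_closed[OF t(1)]
      by (simp add: q.V.minus_eq_zero_iff)
    moreover have "\<pi> (t \<ominus>\<^bsub>T\<^esub> \<theta> n) = s"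
      using \<pi>.map_minus[OF t(1) \<theta>n(1)] \<theta>n(2) t \<pi>.map_closed[OF t(1)] by (simp add: \<pi>.W.minus_zero)
    ultimately show "s \<in> \<pi> ` carrier T'"
      using t(1) \<theta>n(1) by (intro image_eqI[of _ _ "t \<ominus>\<^bsub>T\<^esub> \<theta> n"]) (auto simp: T'_def a_kernel_def')
  qed
  have surj_h: "h ` carrier S' = carrier C"
  proof (rule equalityI; rule subsetI)
    fix c assume "c \<in> h ` carrier S'"
    then show "c \<in> carrier C" using linear_map.map_closed[OF lin_h] by blast
  next
    fix c assume "c \<in> carrier C"
    then obtain m where m: "m \<in> M" "c = ?c m" by (auto simp: C_carrier)
    then obtain t where t: "t \<in> carrier T" "m = d t" using d_surj M_carrier by blast
    show "c \<in> h ` carrier S'"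
      using m t h[of t] S'_mem[of t] by (intro image_eqI[of _ _ "\<pi> t"]) auto
  qed
  show ?thesis
    by (rule exI[of _ \<theta>], rule exI[of _ h], intro conjI lin_\<theta> lin_\<pi> lin_h exact_T exact_S surj_h)
qed

theorem theorem4p11:
  fixes K :: "('k, 'z) ring_scheme" and A :: "('k, 'a) awb" and M :: "'a set"
  assumes "awb K A"
    and "awb_perfect K A"
    and "awb_ideal K A M"
  shows "\<exists>f h.
    (let H\<^sub>A = homology K A 1;
         H\<^sub>Q = homology K (awb_quot A M) 1;
         g = homology_map K (awb_quot A M) (\<lambda>a. M +>\<^bsub>A\<^esub> a) 1;
         C = quot_mod (A\<lparr>carrier := M\<rparr>) (awb_commutator K A (carrier A) M)
     in linear_map K (ker_psi K A M) H\<^sub>A f \<and>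
        linear_map K H\<^sub>A H\<^sub>Q g \<and>
        linear_map K H\<^sub>Q C h \<and>
        f ` carrier (ker_psi K A M) = a_kernel H\<^sub>A H\<^sub>Q g \<and>
        g ` carrier H\<^sub>A = a_kernel H\<^sub>Q C h \<and>
        h ` carrier H\<^sub>Q = carrier C)"
proof -
  interpret awb_with_ideal K A M
    using assms(1,3) by (simp add: awb_with_ideal_def awb_record_def awb_with_ideal_axioms_def)
  interpret Q: awb_record K "awb_quot A M" by (rule quot_awb)
  have ker: "a_kernel A (awb_quot A M) (\<lambda>a. M +>\<^bsub>A\<^esub> a) = M"
    using A.coset_eq_zero_iff[OF ideal_submodule] ideal_mem_carrier
    by (auto simp: a_kernel_def' quot_fields)
  have ker_psi: "ker_psi K A M = (ideal_tensor K A M)\<lparr>carrier := a_kernel (ideal_tensor K A M) MA psi\<rparr>"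
    by (simp add: ker_psi_def)
  show ?thesis
    unfolding Let_def homology_1_eq Q.homology_1_eq coker_proj_def[symmetric]
      psi_image[symmetric] ker_psi
    by (rule snake[OF tensor_to_coker_linear coker_proj_linear tensor_to_coker_image
          coker_proj_surj quot_proj_linear ker psi_linear coker_diff_linear Q.coker_diff_linear
          coker_diff_tensor coker_diff_proj coker_diff_surj[OF assms(2)]])
qed

end
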